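(* Let $K\subseteq\mathbb{R}^n$ be a centrally symmetric convex body in minimal surface area position. Then $$S(K)\leqslant\frac{n}{M(B_\infty^n)}\,|K|\,M(K).$$
   Context: A convex body in $\mathbb{R}^n$ is a compact convex set with non-empty interior; it is centrally symmetric if $x\in K$ implies $-x\in K$. $K$ is in minimal surface area position if $S(K)\leqslant S(T(K))$ for every volume preserving linear map $T$ (that is, $|\det T|=1$). $B_\infty^n=[-1,1]^n$. $|\cdot|$ is volume, $S(K)$ is the surface area of $K$, $\sigma$ is the rotationally invariant probability measure on $S^{n-1}$, $\|x\|_K=\min\{t\geqslant0:x\in tK\}$ is the Minkowski functional of $K$, and $M(K)=\int_{S^{n-1}}\|\xi\|_K\,d\sigma(\xi)$. *)

theory Defs
  imports "HOL-Probability.Probability"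
begin

definition convex_body :: "'a::euclidean_space set \<Rightarrow> bool" where
  "convex_body K \<longleftrightarrow> compact K \<and> convex K \<and> interior K \<noteq> {}"

definition centrally_symmetric :: "'a::real_vector set \<Rightarrow> bool" where
  "centrally_symmetric K \<longleftrightarrow> (\<forall>x\<in>K. - x \<in> K)"

text \<open>For a convex body containing the origin in its interior this infimum is attained, i.e. it is
  the minimum.\<close>

definition minkowski_functional :: "'a::real_vector set \<Rightarrow> 'a \<Rightarrow> real" where
  "minkowski_functional K x = Inf {t. 0 \<le> t \<and> x \<in> (\<lambda>y. t *\<^sub>R y) ` K}"

text \<open>Surface area in the sense of Minkowski: the derivative at \<open>t = 0\<close> from the right of the
  volume of the outer parallel body \<open>K + t B\<close>, where \<open>B\<close> is the Euclidean unit ball.\<close>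

definition surface_area :: "'a::euclidean_space set \<Rightarrow> real" where
  "surface_area K =
     Lim (at_right 0)
       (\<lambda>t. (measure lborel {x + t *\<^sub>R u |x u. x \<in> K \<and> u \<in> cball 0 1} - measure lborel K) / t)"

definition minimal_surface_area_position :: "(real^'n) set \<Rightarrow> bool" where
  "minimal_surface_area_position K \<longleftrightarrow>
     (\<forall>T. linear T \<and> \<bar>det (matrix T)\<bar> = 1 \<longrightarrow> surface_area K \<le> surface_area (T ` K))"

definition B_infty :: "(real^'n) set" where
  "B_infty = {x. \<forall>i. -1 \<le> x $ i \<and> x $ i \<le> 1}"


section \<open>The rotationally invariant probability measure on the sphere\<close>

text \<open>Invariance is required under the full orthogonal group; for \<open>n \<ge> 2\<close> this gives the same
  measure as invariance under \<open>SO(n)\<close>, and for \<open>n = 1\<close> it is what makes the measure unique.\<close>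

definition rotation_invariant_prob :: "'a::euclidean_space measure \<Rightarrow> bool" where
  "rotation_invariant_prob \<sigma> \<longleftrightarrow>
     sets \<sigma> = sets (restrict_space borel (sphere 0 1)) \<and> prob_space \<sigma> \<and>
     (\<forall>f. orthogonal_transformation f \<longrightarrow> distr \<sigma> \<sigma> f = \<sigma>)"

definition sphere_prob :: "'a::euclidean_space measure" where
  "sphere_prob = (THE \<sigma>. rotation_invariant_prob \<sigma>)"

text \<open>Existence and uniqueness of \<open>\<sigma>\<close>, so that the definite description above is meaningful.\<close>

lemma orthogonal_transformation_isometry_dist:
  assumes f: "orthogonal_transformation f"
  shows "dist (f x) (f y) = dist x y"
proof -
  have "f x - f y = f (x - y)"
    using f by (simp add: orthogonal_transformation_linear linear_diff)
  then show ?thesis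
    by (simp add: dist_norm orthogonal_transformation_norm[OF f])
qed

lemma nn_integral_dist_less:
  fixes N :: "'a::euclidean_space measure"
  assumes "sets N = sets borel"
  shows "(\<integral>\<^sup>+y. (if dist x y < r then 1 else 0) \<partial>N) = emeasure N (ball x r)"
proof -
  have "(\<integral>\<^sup>+y. indicator (ball x r) y \<partial>N) = emeasure N (ball x r)"
    by (rule nn_integral_indicator) (simp add: assms)
  moreover have "indicator (ball x r) = (\<lambda>y. if dist x y < r then 1 else (0::ennreal))"
    by (auto simp: indicator_def)
  ultimately show ?thesis by simp
qed

lemma emeasure_mono_uniformly_distributed:
  fixes M N :: "'a::euclidean_space measure"
  assumes sM: "sets M = sets borel" and sN: "sets N = sets borel"
    and sf: "sigma_finite_measure M" "sigma_finite_measure N"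
    and S: "AE x in M. x \<in> S" "AE x in N. x \<in> S"
    and M: "\<And>x r. x \<in> S \<Longrightarrow> 0 < r \<Longrightarrow> emeasure M (ball x r) = a r"
    and N: "\<And>x r. x \<in> S \<Longrightarrow> 0 < r \<Longrightarrow> emeasure N (ball x r) = a r"
    and a: "\<And>r. 0 < r \<Longrightarrow> a r \<noteq> 0" "\<And>r. 0 < r \<Longrightarrow> a r \<noteq> \<infinity>"
    and U: "open U"
  shows "emeasure M U \<le> emeasure N U"
proof -
  interpret M: sigma_finite_measure M by fact
  interpret N: sigma_finite_measure N by fact
  interpret pair_sigma_finite N M ..
  define V where "V r = {x. ball x r \<subseteq> U}" for r
  have Vm: "V r \<in> sets borel" for r
  proof -
    have "- V r = (\<Union>y\<in>-U. ball y r)"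
      by (auto simp: V_def dist_commute)
    then have "closed (V r)" by (simp add: closed_def open_UN)
    then show ?thesis by simp
  qed
  have step: "emeasure M (V r) \<le> emeasure N U" if r: "0 < r" for r
  proof -
    have [measurable_cong]: "sets M = sets borel" "sets N = sets borel" by fact+
    have [measurable]: "V r \<in> sets borel" "U \<in> sets borel" using Vm U by auto
    have "emeasure M (V r) * a r = (\<integral>\<^sup>+x. a r * indicator (V r) x \<partial>M)"
      using Vm sM by (simp add: nn_integral_cmult_indicator mult.commute)
    also have "\<dots> = (\<integral>\<^sup>+x. indicator (V r) x * emeasure N (ball x r) \<partial>M)"
      by (intro nn_integral_cong_AE eventually_mono[OF S(1)]) (simp add: N r mult.commute)
    also have "\<dots> = (\<integral>\<^sup>+x. (\<integral>\<^sup>+y. indicator (V r) x * (if dist x y < r then 1 else 0) \<partial>N) \<partial>M)"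
    proof (intro nn_integral_cong)
      fix x
      have "(\<integral>\<^sup>+y. (if dist x y < r then 1 else 0) \<partial>N) = emeasure N (ball x r)"
        using nn_integral_dist_less[OF sN] by simp
      then show "indicator (V r) x * emeasure N (ball x r) =
          (\<integral>\<^sup>+y. indicator (V r) x * (if dist x y < r then 1 else 0) \<partial>N)"
        by (subst nn_integral_cmult) auto
    qed
    also have "\<dots> \<le> (\<integral>\<^sup>+x. (\<integral>\<^sup>+y. indicator U y * (if dist x y < r then 1 else 0) \<partial>N) \<partial>M)"
      by (intro nn_integral_mono) (auto simp: indicator_def V_def)
    also have "\<dots> = (\<integral>\<^sup>+y. (\<integral>\<^sup>+x. indicator U y * (if dist x y < r then 1 else 0) \<partial>M) \<partial>N)"
      by (rule Fubini') measurable
    also have "\<dots> = (\<integral>\<^sup>+y. indicator U y * emeasure M (ball y r) \<partial>N)"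
    proof (intro nn_integral_cong)
      fix y
      have "(\<integral>\<^sup>+x. (if dist x y < r then 1 else 0) \<partial>M) = emeasure M (ball y r)"
        using nn_integral_dist_less[OF sM, of y r] by (simp add: dist_commute)
      then show "(\<integral>\<^sup>+x. indicator U y * (if dist x y < r then 1 else 0) \<partial>M)
          = indicator U y * emeasure M (ball y r)"
        by (subst nn_integral_cmult) auto
    qed
    also have "\<dots> = (\<integral>\<^sup>+y. a r * indicator U y \<partial>N)"
      by (intro nn_integral_cong_AE eventually_mono[OF S(2)]) (simp add: M r mult.commute)
    also have "\<dots> = emeasure N U * a r"
      using U sN by (simp add: nn_integral_cmult_indicator mult.commute)
    finally show ?thesis
      using a[OF r] by (simp add: ennreal_mult_le_mult_iff mult.commute[of _ "a r"])
  qed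
  have "(\<Union>n. V (1 / real (Suc n))) = U"
  proof (intro equalityI subsetI)
    fix x assume "x \<in> U"
    then obtain e where e: "e > 0" "ball x e \<subseteq> U" using U openE by blast
    then obtain n where "1 / real (Suc n) < e" using nat_approx_posE by blast
    then show "x \<in> (\<Union>n. V (1 / real (Suc n)))"
      using e by (auto simp: V_def intro!: exI[of _ n])
  next
    fix x assume "x \<in> (\<Union>n. V (1 / real (Suc n)))"
    then obtain n where "ball x (1 / real (Suc n)) \<subseteq> U" unfolding V_def by blast
    moreover have "x \<in> ball x (1 / real (Suc n))" by simp
    ultimately show "x \<in> U" by blast
  qed
  moreover have "(SUP n. emeasure M (V (1 / real (Suc n)))) = emeasure M (\<Union>n. V (1 / real (Suc n)))"
  proof (rule SUP_emeasure_incseq)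
    show "range (\<lambda>n. V (1 / real (Suc n))) \<subseteq> sets M" using Vm sM by auto
    show "incseq (\<lambda>n. V (1 / real (Suc n)))"
      unfolding V_def incseq_def
    proof (intro allI impI Collect_mono)
      fix m n :: nat and x :: 'a assume "m \<le> n"
      then have "ball x (1 / real (Suc n)) \<subseteq> ball x (1 / real (Suc m))"
        by (intro subset_ball) (simp add: frac_le)
      then show "ball x (1 / real (Suc n)) \<subseteq> U" if "ball x (1 / real (Suc m)) \<subseteq> U"
        using that by blast
    qed
  qed
  ultimately have "emeasure M U = (SUP n. emeasure M (V (1 / real (Suc n))))" by simp
  also have "\<dots> \<le> emeasure N U"
    by (rule SUP_least) (rule step, simp)
  finally show ?thesis .
qed

lemma uniformly_distributed_measure_unique:
  fixes M N :: "'a::euclidean_space measure"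
  assumes "sets M = sets borel" "sets N = sets borel"
    and "sigma_finite_measure M" "sigma_finite_measure N"
    and "AE x in M. x \<in> S" "AE x in N. x \<in> S"
    and "\<And>x r. x \<in> S \<Longrightarrow> 0 < r \<Longrightarrow> emeasure M (ball x r) = a r"
    and "\<And>x r. x \<in> S \<Longrightarrow> 0 < r \<Longrightarrow> emeasure N (ball x r) = a r"
    and "\<And>r. 0 < r \<Longrightarrow> a r \<noteq> 0" "\<And>r. 0 < r \<Longrightarrow> a r \<noteq> \<infinity>"
    and fin: "\<And>r. emeasure M (ball 0 r) \<noteq> \<infinity>"
  shows "M = N"
proof (rule measure_eqI_generator_eq[where E="{U. open U}" and \<Omega>=UNIV and A="\<lambda>n. ball 0 (real n)"])
  show "emeasure M X = emeasure N X" if "X \<in> {U. open U}" for X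
    using that assms(1-10)
    by (intro antisym; intro emeasure_mono_uniformly_distributed[where a=a and S=S]) auto
  show "(\<Union>i. ball 0 (real i)) = (UNIV :: 'a set)"
    using reals_Archimedean2 by auto
qed (use assms in \<open>auto simp: Int_stable_def borel_def\<close>)

lemma distr_lborel_orthogonal_transformation:
  fixes f :: "'a::euclidean_space \<Rightarrow> 'a"
  assumes f: "orthogonal_transformation f"
  shows "distr lborel borel f = lborel"
proof -
  have [measurable]: "f \<in> borel_measurable borel"
    using f by (simp add: orthogonal_transformation_linear linear_linear borel_measurable_continuous_onI
        linear_continuous_on)
  have ball: "emeasure lborel (ball x r) = emeasure lborel (ball (0::'a) r)" if "0 < r" for x :: "'a" and r
    using that by (simp add: emeasure_ball)
  have vim: "f -` ball x r = ball (inv f x) r" for x r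
  proof -
    have "dist x (f y) = dist (inv f x) y" for y
    proof -
      have "x = f (inv f x)" using f by (simp add: orthogonal_transformation_surj surj_f_inv_f)
      then show ?thesis
        using orthogonal_transformation_isometry_dist[OF f, of "inv f x" y] by simp
    qed
    then show ?thesis by auto
  qed
  have em: "emeasure (distr lborel borel f) (ball x r) = emeasure lborel (ball (0::'a) r)" if "0 < r" for x :: "'a" and r
    using ball[OF that, of "inv f x"] by (simp add: emeasure_distr vim)
  show ?thesis
  proof (rule uniformly_distributed_measure_unique[where S=UNIV and a="\<lambda>r. emeasure lborel (ball (0::'a) r)"])
    show fin: "emeasure (distr lborel borel f) (ball 0 r) \<noteq> \<infinity>" for r
      using em[of r 0] emeasure_lborel_ball_finite[of "0::'a" r]
      by (cases "r > 0") (auto simp: ball_empty)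
    show "sigma_finite_measure (distr lborel borel f)"
    proof (unfold_locales, intro exI[of _ "range (\<lambda>n. ball 0 (real n))"] conjI ballI)
      show "\<Union> (range (\<lambda>n. ball 0 (real n))) = space (distr lborel borel f)"
        using reals_Archimedean2 by auto
    qed (use fin in auto)
    show "emeasure lborel (ball (0::'a) r) \<noteq> 0" if "0 < r" for r
      using that less_imp_neq[OF unit_ball_vol_pos[of "real DIM('a)"]] by (auto simp: emeasure_ball)
    show "emeasure lborel (ball (0::'a) r) \<noteq> \<infinity>" for r
      using emeasure_lborel_ball_finite[of "0::'a" r] by simp
    show "emeasure (distr lborel borel f) (ball x r) = emeasure lborel (ball (0::'a) r)"
      if "0 < r" for x r by (rule em[OF that])
    show "emeasure lborel (ball x r) = emeasure lborel (ball (0::'a) r)"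
      if "0 < r" for x :: 'a and r by (rule ball[OF that])
  qed (auto intro: lborel.sigma_finite_measure_axioms)
qed


lemma nn_integral_emeasure_ball_swap:
  fixes M N :: "'a::euclidean_space measure"
  assumes sM: "sets M = sets borel" and sN: "sets N = sets borel"
    and sf: "sigma_finite_measure M" "sigma_finite_measure N"
  shows "(\<integral>\<^sup>+x. emeasure N (ball x r) \<partial>M) = (\<integral>\<^sup>+y. emeasure M (ball y r) \<partial>N)"
proof -
  interpret M: sigma_finite_measure M by fact
  interpret N: sigma_finite_measure N by fact
  interpret pair_sigma_finite N M ..
  have [measurable_cong]: "sets M = sets borel" "sets N = sets borel" by fact+
  have N: "emeasure N (ball x r) = (\<integral>\<^sup>+y. (if dist x y < r then 1 else 0) \<partial>N)" for x
    using nn_integral_dist_less[OF sN] by simp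
  have M: "emeasure M (ball y r) = (\<integral>\<^sup>+x. (if dist x y < r then 1 else 0) \<partial>M)" for y
    using nn_integral_dist_less[OF sM, of y r] by (simp add: dist_commute)
  show ?thesis
    unfolding N M by (rule Fubini') measurable
qed

lemma rotation_invariant_prob_ball:
  fixes \<sigma> :: "(real^'n) measure"
  assumes \<sigma>: "rotation_invariant_prob \<sigma>"
  defines "M \<equiv> distr \<sigma> borel (\<lambda>x. x)"
  shows "prob_space M" "AE x in M. x \<in> sphere 0 1"
    and "A \<in> sets \<sigma> \<Longrightarrow> emeasure \<sigma> A = emeasure M A"
    and "x \<in> sphere 0 1 \<Longrightarrow> y \<in> sphere 0 1 \<Longrightarrow> emeasure M (ball x r) = emeasure M (ball y r)"
    and "x \<in> sphere 0 1 \<Longrightarrow> 0 < r \<Longrightarrow> emeasure M (ball x r) \<noteq> 0"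
proof -
  have s: "sets \<sigma> = sets (restrict_space borel (sphere 0 1))" and "prob_space \<sigma>"
    and inv: "\<And>f. orthogonal_transformation f \<Longrightarrow> distr \<sigma> \<sigma> f = \<sigma>"
    using \<sigma> by (auto simp: rotation_invariant_prob_def)
  interpret prob_space \<sigma> by fact
  have sp: "space \<sigma> = sphere 0 1"
    using sets_eq_imp_space_eq[OF s] by (simp add: space_restrict_space)
  have id: "(\<lambda>x. x) \<in> measurable \<sigma> borel"
    using measurable_restrict_space1[of "\<lambda>x. x" borel borel "sphere 0 1"] measurable_cong_sets[OF s refl]
    by auto
  show M: "prob_space M" unfolding M_def by (rule prob_space_distr[OF id])
  then interpret M: prob_space M .
  have sM: "sets M = sets borel" "space M = UNIV" by (auto simp: M_def)
  show ae: "AE x in M. x \<in> sphere 0 1"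
    unfolding M_def by (subst AE_distr_iff[OF id]) (auto simp: sp)
  show "emeasure \<sigma> A = emeasure M A" if "A \<in> sets \<sigma>" for A
  proof -
    have "A \<in> sets borel" "A \<subseteq> sphere 0 1"
      using that s by (auto simp: sets_restrict_space)
    then show ?thesis
      unfolding M_def by (subst emeasure_distr[OF id]) (auto simp: sp Int_absorb2)
  qed
  show eq: "emeasure M (ball x r) = emeasure M (ball y r)"
    if xy: "x \<in> sphere 0 1" "y \<in> sphere 0 1" for x y r
  proof -
    obtain f where f: "orthogonal_transformation f" "f x = y"
      using xy orthogonal_transformation_exists[of x y] by auto
    have fb: "f \<in> borel_measurable borel"
      using f by (simp add: orthogonal_transformation_linear linear_linear
          borel_measurable_continuous_onI linear_continuous_on)
    have fm: "f \<in> measurable \<sigma> \<sigma>"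
      unfolding measurable_cong_sets[OF s s]
      using fb f(1) by (auto simp: orthogonal_transformation_norm
          intro!: measurable_restrict_space3)
    have "distr M borel f = distr (distr \<sigma> \<sigma> f) borel (\<lambda>x. x)"
      unfolding M_def using fb fm id by (simp add: distr_distr comp_def)
    then have "distr M borel f = M"
      by (simp add: inv f M_def)
    then have "emeasure M (ball y r) = emeasure (distr M borel f) (ball y r)" by simp
    also have "\<dots> = emeasure M (f -` ball y r)"
      using fb by (subst emeasure_distr) (auto simp: sM measurable_cong_sets[OF sM(1) refl])
    also have "f -` ball y r = ball x r"
    proof -
      have "dist y (f z) = dist x z" for z
        using orthogonal_transformation_isometry_dist[OF f(1), of x z] f(2) by simp
      then show ?thesis by auto
    qed
    finally show ?thesis by simp
  qed
  show "emeasure M (ball x r) \<noteq> 0" if x: "x \<in> sphere 0 1" and r: "0 < r" for x r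
  proof
    assume 0: "emeasure M (ball x r) = 0"
    obtain D :: "(real^'n) set" where D: "D \<subseteq> sphere 0 1" "finite D" "sphere 0 1 \<subseteq> (\<Union>y\<in>D. ball y r)"
      by (rule compactE_image[OF compact_sphere, of "sphere 0 1" "\<lambda>y. ball y r" 0 1]) (use r in auto)
    have "emeasure M (\<Union>y\<in>D. ball y r) \<le> (\<Sum>y\<in>D. emeasure M (ball y r))"
      using D by (intro emeasure_subadditive_finite) (auto simp: sM)
    also have "\<dots> = 0"
      using D(1) eq[OF _ x] 0 by (intro sum.neutral) (metis subsetD)
    finally have "AE x in M. x \<notin> (\<Union>y\<in>D. ball y r)"
      using sM by (intro AE_not_in) (auto simp: null_sets_def intro!: borel_open open_UN)
    with ae have "AE x in M. False"
      by eventually_elim (use D in blast)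
    then show False by (simp add: M.AE_False)
  qed
qed

lemma rotation_invariant_prob_unique:
  fixes \<sigma> \<tau> :: "(real^'n) measure"
  assumes \<sigma>: "rotation_invariant_prob \<sigma>" and \<tau>: "rotation_invariant_prob \<tau>"
  shows "\<sigma> = \<tau>"
proof -
  define M N where "M = distr \<sigma> borel (\<lambda>x. x)" and "N = distr \<tau> borel (\<lambda>x. x)"
  note M = rotation_invariant_prob_ball[OF \<sigma>, folded M_def]
  note N = rotation_invariant_prob_ball[OF \<tau>, folded N_def]
  interpret M: prob_space M by (rule M)
  interpret N: prob_space N by (rule N)
  obtain e :: "real^'n" where e: "e \<in> sphere 0 1"
    using vector_choose_size[of 1] by auto
  have s: "sets M = sets borel" "sets N = sets borel" by (auto simp: M_def N_def)
  have ab: "emeasure M (ball e r) = emeasure N (ball e r)" for r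
  proof -
    have "emeasure N (ball e r) = (\<integral>\<^sup>+x. emeasure N (ball e r) \<partial>M)"
      by (simp add: M.emeasure_space_1)
    also have "\<dots> = (\<integral>\<^sup>+x. emeasure N (ball x r) \<partial>M)"
      by (intro nn_integral_cong_AE eventually_mono[OF M(2)] N(4) e)
    also have "\<dots> = (\<integral>\<^sup>+x. emeasure M (ball x r) \<partial>N)"
      by (intro nn_integral_emeasure_ball_swap s) unfold_locales
    also have "\<dots> = (\<integral>\<^sup>+x. emeasure M (ball e r) \<partial>N)"
      by (intro nn_integral_cong_AE eventually_mono[OF N(2)] M(4) e)
    also have "\<dots> = emeasure M (ball e r)"
      by (simp add: N.emeasure_space_1)
    finally show ?thesis by simp
  qed
  have "M = N"
  proof (rule uniformly_distributed_measure_unique[where S="sphere 0 1" and a="\<lambda>r. emeasure M (ball e r)"])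
    show "emeasure N (ball x r) = emeasure M (ball e r)" if "x \<in> sphere 0 1" for x r
      using N(4)[OF that e] ab by simp
    show "sigma_finite_measure M" "sigma_finite_measure N" by unfold_locales
    show "emeasure M (ball x r) = emeasure M (ball e r)" if "x \<in> sphere 0 1" for x r
      by (rule M(4)[OF that e])
    show "emeasure M (ball e r) \<noteq> 0" if "0 < r" for r
      by (rule M(5)[OF e that])
    show "emeasure M (ball e r) \<noteq> \<infinity>" for r
      using M.emeasure_finite by simp
    show "emeasure M (ball 0 r) \<noteq> \<infinity>" for r
      using M.emeasure_finite by simp
  qed (rule s M(2) N(2))+
  show ?thesis
  proof (rule measure_eqI)
    show ss: "sets \<sigma> = sets \<tau>" using \<sigma> \<tau> by (simp add: rotation_invariant_prob_def)
    show "emeasure \<sigma> A = emeasure \<tau> A" if "A \<in> sets \<sigma>" for A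
      using M(3)[OF that] N(3)[of A] that ss \<open>M = N\<close> by simp
  qed
qed

lemma rotation_invariant_prob_exists:
  "rotation_invariant_prob
     (restrict_space (distr (uniform_measure lborel (ball 0 1)) borel sgn) (sphere 0 1)
        :: (real^'n) measure)"
proof -
  define U :: "(real^'n) measure" where "U = uniform_measure lborel (ball 0 1)"
  define P where "P = distr U borel sgn"
  define \<sigma> where "\<sigma> = restrict_space P (sphere 0 1)"
  have b: "emeasure lborel (ball (0::real^'n) 1) \<noteq> 0" "emeasure lborel (ball (0::real^'n) 1) \<noteq> \<infinity>"
    using less_imp_neq[OF unit_ball_vol_pos[of "real CARD('n)"]] by (auto simp: emeasure_ball)
  interpret U: prob_space U unfolding U_def by (rule prob_space_uniform_measure[OF b])
  have sU: "sets U = sets borel" "space U = UNIV" by (auto simp: U_def)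
  have sgn: "sgn \<in> borel_measurable (borel :: (real^'n) measure)"
    unfolding sgn_div_norm by measurable
  then have sgnU: "sgn \<in> measurable U borel"
    by (simp add: measurable_cong_sets[OF sU(1) refl])
  interpret P: prob_space P unfolding P_def by (rule U.prob_space_distr[OF sgnU])
  have sP: "sets P = sets borel" "space P = UNIV" by (auto simp: P_def)
  have P: "emeasure P A = emeasure lborel (ball 0 1 \<inter> sgn -` A) / emeasure lborel (ball (0::real^'n) 1)"
    if "A \<in> sets borel" for A
  proof -
    have "sgn -` A \<in> sets (borel :: (real^'n) measure)"
      using measurable_sets[OF sgn that] by simp
    then show ?thesis using that sgnU sU(2) unfolding P_def
      by (subst emeasure_distr) (auto simp: U_def)
  qed
  have "emeasure P (sphere 0 1) = 1"
  proof -
    have "ball 0 1 \<inter> sgn -` sphere 0 1 = ball (0::real^'n) 1 - {0}"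
      by (auto simp: norm_sgn split: if_splits)
    moreover have "{0::real^'n} \<in> null_sets lborel" by (simp add: null_sets_def)
    ultimately have "emeasure P (sphere 0 1)
        = emeasure lborel (ball (0::real^'n) 1) / emeasure lborel (ball (0::real^'n) 1)"
      by (simp add: P emeasure_Diff_null_set)
    then show ?thesis
      using b by (metis ennreal_divide_self infinity_ennreal_def top.not_eq_extremum)
  qed
  then have "prob_space \<sigma>"
    unfolding \<sigma>_def by (intro prob_spaceI) (simp add: emeasure_restrict_space sP space_restrict_space)
  moreover have s: "sets \<sigma> = sets (restrict_space borel (sphere 0 1))"
    unfolding \<sigma>_def using sP by (simp add: sets_restrict_space)
  moreover have "distr \<sigma> \<sigma> f = \<sigma>" if f: "orthogonal_transformation f" for f
  proof (rule measure_eqI)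
    fix A assume "A \<in> sets (distr \<sigma> \<sigma> f)"
    then have A: "A \<in> sets \<sigma>" "A \<in> sets borel" "A \<subseteq> sphere 0 1"
      using s by (auto simp: sets_restrict_space)
    have fb: "f \<in> borel_measurable borel"
      using f by (simp add: orthogonal_transformation_linear linear_linear
          borel_measurable_continuous_onI linear_continuous_on)
    have fm: "f \<in> measurable \<sigma> \<sigma>"
      unfolding measurable_cong_sets[OF s s]
      using fb f by (auto simp: orthogonal_transformation_norm
          intro!: measurable_restrict_space3)
    have sp: "space \<sigma> = sphere 0 1" by (simp add: \<sigma>_def sP space_restrict_space)
    have fA: "f -` A \<in> sets borel" "f -` A \<subseteq> sphere 0 1"
      using measurable_sets[OF fb A(2)] A(3) f by (auto simp: orthogonal_transformation_norm)
    have sg: "sgn -` A \<in> sets borel"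
      using measurable_sets[OF sgn A(2)] by simp
    have "emeasure (distr \<sigma> \<sigma> f) A = emeasure \<sigma> (f -` A)"
      using A fA by (subst emeasure_distr[OF fm]) (auto simp: sp Int_absorb2)
    also have "\<dots> = emeasure P (f -` A)"
      using fA unfolding \<sigma>_def by (intro emeasure_restrict_space) (auto simp: sP)
    also have "\<dots> = emeasure lborel (ball 0 1 \<inter> sgn -` (f -` A)) / emeasure lborel (ball (0::real^'n) 1)"
      by (rule P) (rule fA)
    also have "ball 0 1 \<inter> sgn -` (f -` A) = f -` (ball 0 1 \<inter> sgn -` A)"
      using f by (auto simp: orthogonal_transformation_norm sgn_div_norm
          orthogonal_transformation_scaleR)
    also have "emeasure lborel \<dots> = emeasure (distr lborel borel f) (ball 0 1 \<inter> sgn -` A)"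
      using fb sg by (subst emeasure_distr) auto
    also have "\<dots> = emeasure lborel (ball 0 1 \<inter> sgn -` A)"
      by (simp add: distr_lborel_orthogonal_transformation[OF f])
    also have "\<dots> / emeasure lborel (ball (0::real^'n) 1) = emeasure P A"
      by (rule P[symmetric]) (rule A)
    also have "\<dots> = emeasure \<sigma> A"
      using A unfolding \<sigma>_def by (intro emeasure_restrict_space[symmetric]) (auto simp: sP)
    finally show "emeasure (distr \<sigma> \<sigma> f) A = emeasure \<sigma> A" .
  qed simp
  ultimately show ?thesis
    unfolding rotation_invariant_prob_def \<sigma>_def P_def U_def by blast
qed

lemma rotation_invariant_prob_sphere_prob:
  "rotation_invariant_prob (sphere_prob :: (real^'n) measure)"
  unfolding sphere_prob_def
  by (rule theI[where P=rotation_invariant_prob, OF rotation_invariant_prob_exists])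
     (rule rotation_invariant_prob_unique[OF _ rotation_invariant_prob_exists])

lemma sphere_prob_eq:
  "(sphere_prob :: (real^'n) measure) =
     restrict_space (distr (uniform_measure lborel (ball 0 1)) borel sgn) (sphere 0 1)"
  by (rule rotation_invariant_prob_unique[OF rotation_invariant_prob_sphere_prob
        rotation_invariant_prob_exists])


section \<open>The mean of the Minkowski functional over the sphere\<close>

definition mean_norm :: "'a::euclidean_space set \<Rightarrow> real" where
  "mean_norm K = (\<integral>\<xi>. minkowski_functional K \<xi> \<partial>sphere_prob)"

end

theory Submission
  imports Defs
begin

text \<open>If \<open>K\<close> is in minimal surface area position then, by Petty's criterion, there are unit vectors
  \<open>u\<^sub>i\<close> and weights \<open>c\<^sub>i \<ge> 0\<close> with \<open>\<Sum> c\<^sub>i u\<^sub>i \<otimes> u\<^sub>i = I\<close> and \<open>\<Sum> c\<^sub>i h\<^sub>K(u\<^sub>i) = n r\<close>, where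
  \<open>r = n |K| / S(K)\<close>. Finitely many vectors suffice, and the surface area measure is not needed: if there
  were no such decomposition, a separating quadratic form would give a linear perturbation of the
  identity that decreases the surface area. Since \<open>K\<close> lies in the slabs \<open>|\<langle>x, u\<^sub>i\<rangle>| \<le> h\<^sub>K(u\<^sub>i)\<close>, the
  Brascamp--Lieb inequality and the log-concavity of \<open>t \<mapsto> \<gamma>\<^sub>1([-t, t])\<close> give
  \<open>\<gamma>(t K) \<le> \<gamma>(t r B_infty)\<close> for the Gaussian measure \<open>\<gamma>\<close>. Integrating over \<open>t\<close>, the Gaussian mean of
  \<open>\<parallel>x\<parallel>\<^sub>K\<close> is at least \<open>1/r\<close> times that of the maximum norm, and Gaussian means of norms are a
  constant multiple of spherical means.\<close>

section \<open>Existence of the surface area\<close>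

text \<open>\<open>surface_area\<close> is defined through \<open>Lim\<close>, which carries
  information only once the difference quotient is known to converge. Convergence comes from
  superadditivity of the volumes of the shells around K, without Steiner's formula. The position
  enters through T(K) + tB = T(K + t T^{-1}B): a volume preserving change of K becomes a change of
  the ball. When T^{-1} is a normalised I + sQ, the ellipsoid lies, up to an error of order s^2, in
  B + sK as soon as v . Qv is at most the support function of K at every unit vector v. Minimality
  then bounds trace Q by n r for every such Q. This is a linear programming bound, and the
  decomposition of the identity is its dual; r arises as the extremal value. Gaussian measure takes
  the place of volume because its values on all dilates of K determine a mean of the norm, and
  because it is a product measure, so that the cube attains exactly the bound obtained for the
  slabs. The constant relating Gaussian and spherical means depends only on the dimension and
  cancels, so its value is never computed.\<close>

lemma lmeasurable_outer_open_measure_less: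
  assumes S: "S \<in> lmeasurable" and "e > 0"
  obtains U where "open U" "S \<subseteq> U" "U \<in> lmeasurable" "measure lebesgue (U - S) < e"
proof -
  obtain U where U: "open U" "S \<subseteq> U" "(U - S) \<in> lmeasurable" "emeasure lebesgue (U - S) < ennreal e"
    using sets_lebesgue_outer_open[of S e] assms by (auto simp: fmeasurableD)
  have "U = (U - S) \<union> S" using U by blast
  then have "U \<in> lmeasurable" using U S by (metis fmeasurable.Un)
  moreover have "measure lebesgue (U - S) < e"
    using U by (metis assms(2) emeasure_eq_measure2 ennreal_less_iff measure_nonneg)
  ultimately show ?thesis using U that by blast
qed

text \<open>Vitali: almost all of \<open>S\<close> is covered by disjoint balls with centres in
  \<open>S\<close>, inside an open set of nearly the same measure. The balls of the same radii about
  the images of the centres cover the image up to a null set, and they have the same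
  volumes.\<close>

lemma measure_contraction_image_le:
  fixes f :: "'a::euclidean_space \<Rightarrow> 'a"
  assumes S: "S \<in> lmeasurable" and f: "\<And>x y. x \<in> S \<Longrightarrow> y \<in> S \<Longrightarrow> dist (f x) (f y) \<le> dist x y"
    and fS: "f ` S \<in> sets lebesgue"
  shows "measure lebesgue (f ` S) \<le> measure lebesgue S"
proof (rule field_le_epsilon)
  fix e :: real assume "e > 0"
  then obtain U where U: "open U" "S \<subseteq> U" "U \<in> lmeasurable" "measure lebesgue (U - S) < e"
    by (rule lmeasurable_outer_open_measure_less[OF S])
  have mU: "measure lebesgue U \<le> measure lebesgue S + e"
    using U S by (simp add: measurable_measure_Diff fmeasurableD)
  \<comment> \<open>Centres must lie in \<open>S\<close>, since \<open>f\<close> is controlled only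
    there; containment in \<open>U\<close> bounds the total volume.\<close>
  define I where "I = {(x, r). x \<in> S \<and> 0 < r \<and> ball x r \<subseteq> U}"
  obtain C where C: "countable C" "C \<subseteq> I"
     "pairwise (\<lambda>i j. disjnt (ball (fst i) (snd i)) (ball (fst j) (snd j))) C"
     "negligible (S - (\<Union>i \<in> C. ball (fst i) (snd i)))"
  proof (rule Vitali_covering_theorem_balls[of S I fst snd])
    fix x and d :: real assume x: "x \<in> S" "0 < d"
    then obtain r where r: "r > 0" "ball x r \<subseteq> U" using U openE by blast
    then have "ball x (min r (d/2)) \<subseteq> U" by (auto simp: subset_iff)
    then show "\<exists>i. i \<in> I \<and> x \<in> ball (fst i) (snd i) \<and> snd i < d"
      using x r by (intro exI[of _ "(x, min r (d/2))"]) (auto simp: I_def)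
  qed
  define N where "N = S - (\<Union>i \<in> C. ball (fst i) (snd i))"
  have N: "negligible (f ` N)"
  proof (rule negligible_locally_Lipschitz_image)
    show "negligible N" using C N_def by simp
    fix x assume "x \<in> N"
    then show "\<exists>T B. open T \<and> x \<in> T \<and> (\<forall>y\<in>N \<inter> T. norm (f y - f x) \<le> B * norm (y - x))"
      using f by (intro exI[of _ UNIV] exI[of _ 1]) (auto simp: N_def dist_norm)
  qed simp
  define V where "V = (\<Union>i\<in>C. ball (f (fst i)) (snd i))"
  \<comment> \<open>The image balls may overlap, so subadditivity is used for them; disjointness
    matters only for the balls in the domain.\<close>
  have bound: "measure lebesgue (\<Union>i\<in>F. ball (f (fst i)) (snd i)) \<le> measure lebesgue U"
    if F: "F \<subseteq> C" "finite F" for F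
  proof -
    have "measure lebesgue (\<Union>i\<in>F. ball (f (fst i)) (snd i)) \<le> (\<Sum>i\<in>F. measure lebesgue (ball (f (fst i)) (snd i)))"
      using F by (intro measure_UNION_le) auto
    also have "\<dots> = (\<Sum>i\<in>F. measure lebesgue (ball (fst i) (snd i)))"
      using F C by (intro sum.cong) (auto simp: I_def content_ball measure_completion)
    also have "\<dots> = measure lebesgue (\<Union>i\<in>F. ball (fst i) (snd i))"
      using F pairwise_subset[OF C(3) F(1)] by (intro measure_UNION'[symmetric]) auto
    also have "\<dots> \<le> measure lebesgue U"
    proof (intro measure_mono_fmeasurable U(3))
      show "(\<Union>i\<in>F. ball (fst i) (snd i)) \<subseteq> U"
        using subset_trans[OF F(1) C(2)] unfolding I_def by fastforce
      show "(\<Union>i\<in>F. ball (fst i) (snd i)) \<in> sets lebesgue"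
        using F(2) by (intro sets.finite_UN) auto
    qed
    finally show ?thesis .
  qed
  have V: "V \<in> lmeasurable" "measure lebesgue V \<le> measure lebesgue U"
    unfolding V_def
    using fmeasurable_UN_bound[OF C(1), where A="\<lambda>i. ball (f (fst i)) (snd i)" and M=lebesgue, OF _ bound]
      measure_UN_bound[OF C(1), where A="\<lambda>i. ball (f (fst i)) (snd i)" and M=lebesgue, OF _ bound]
    by simp_all
  have sub: "f ` S \<subseteq> V \<union> f ` N"
  proof
    fix y assume "y \<in> f ` S"
    then obtain x where x: "x \<in> S" "y = f x" by blast
    show "y \<in> V \<union> f ` N"
    proof (cases "x \<in> N")
      case False
      then obtain i where i: "i \<in> C" "x \<in> ball (fst i) (snd i)" using x N_def by auto
      then have "fst i \<in> S" using C I_def by auto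
      then have "dist (f (fst i)) (f x) < snd i" using f[of "fst i" x] x i by simp
      then show ?thesis using i x unfolding V_def by auto
    qed (use x in auto)
  qed
  have "measure lebesgue (f ` S) \<le> measure lebesgue (V \<union> f ` N)"
    using V N by (intro measure_mono_fmeasurable[OF sub fS] fmeasurable.Un) (auto simp: negligible_imp_measurable)
  also have "\<dots> = measure lebesgue V"
    using N V by (intro measure_Un_null_set) (auto simp: negligible_iff_null_sets)
  also note V(2)
  also note mU
  finally show "measure lebesgue (f ` S) \<le> measure lebesgue S + e" .
qed

section \<open>Outer parallel bodies and their shells\<close>

definition parallel_body :: "'a::euclidean_space set \<Rightarrow> real \<Rightarrow> 'a set" where
  "parallel_body K t = {x + t *\<^sub>R u |x u. x \<in> K \<and> u \<in> cball 0 1}"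

lemma surface_area_parallel_body:
  "surface_area K = Lim (at_right 0) (\<lambda>t. (measure lborel (parallel_body K t) - measure lborel K) / t)"
  by (simp add: surface_area_def parallel_body_def)

lemma compact_parallel_body:
  assumes "compact K" shows "compact (parallel_body K t)"
proof -
  have "parallel_body K t = {x + y |x y. x \<in> K \<and> y \<in> (\<lambda>u. t *\<^sub>R u) ` cball 0 1}"
    unfolding parallel_body_def by blast
  then show ?thesis using assms by (simp add: compact_sums compact_scaling)
qed

lemma parallel_body_0 [simp]: "parallel_body K 0 = K"
  by (auto simp: parallel_body_def intro: exI[of _ 0])

text \<open>A Minkowski sum becomes a sublevel set of the distance function, so that shells can be
  described by foot point, normal and distance.\<close>

lemma parallel_body_iff_closest_point:
  assumes K: "compact K" "K \<noteq> {}" and t: "0 \<le> t"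
  shows "x \<in> parallel_body K t \<longleftrightarrow> dist x (closest_point K x) \<le> t"
proof
  assume "x \<in> parallel_body K t"
  then obtain y u where y: "x = y + t *\<^sub>R u" "y \<in> K" "norm u \<le> 1" by (auto simp: parallel_body_def)
  have "dist x (closest_point K x) \<le> dist x y"
    using K y by (intro closest_point_le compact_imp_closed)
  also have "\<dots> \<le> t" using y t by (simp add: dist_norm mult_left_le)
  finally show "dist x (closest_point K x) \<le> t" .
next
  assume d: "dist x (closest_point K x) \<le> t"
  have p: "closest_point K x \<in> K" using K by (simp add: closest_point_in_set compact_imp_closed)
  show "x \<in> parallel_body K t"
  proof (cases "t = 0")
    case True
    then show ?thesis using d p by auto
  next
    case False
    then have "norm ((1/t) *\<^sub>R (x - closest_point K x)) \<le> 1"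
      using d t by (simp add: dist_norm)
    then show ?thesis using False p unfolding parallel_body_def
      by (intro CollectI exI[of _ "closest_point K x"] exI[of _ "(1/t) *\<^sub>R (x - closest_point K x)"]) auto
  qed
qed

text \<open>Moving every point of the outer shell inwards by \<open>a\<close> along its normal is a contraction,
  because the normal cone is a monotone operator.\<close>

lemma measure_parallel_body_superadditive:
  fixes K :: "'a::euclidean_space set"
  assumes K: "compact K" "convex K" "K \<noteq> {}" and a: "0 \<le> a" and b: "0 \<le> b"
  shows "measure lborel (parallel_body K b) - measure lborel K
      \<le> measure lborel (parallel_body K (a + b)) - measure lborel (parallel_body K a)"
proof -
  define p where "p = closest_point K"
  define n where "n x = sgn (x - p x)" for x
  define f where "f x = x - a *\<^sub>R n x" for x
  define d where "d x = dist x (p x)" for x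
  note cl = compact_imp_closed[OF K(1)]
  have P: "x \<in> parallel_body K t \<longleftrightarrow> d x \<le> t" if "0 \<le> t" for x t
    using parallel_body_iff_closest_point[OF K(1,3) that] by (simp add: p_def d_def)
  have pK: "p x \<in> K" for x using K cl by (simp add: p_def closest_point_in_set)
  have x_eq: "x = p x + d x *\<^sub>R n x" for x
    by (cases "x = p x") (simp_all add: n_def d_def dist_norm sgn_div_norm)
  have nn: "norm (n x) = 1" if "0 < d x" for x
    using that by (auto simp: n_def d_def norm_sgn dist_norm)
  have dn: "n x \<bullet> (z - p x) \<le> 0" if "z \<in> K" for x z
    using closest_point_dot[OF K(2) cl that, of x]
    by (auto simp: p_def n_def sgn_div_norm mult_nonneg_nonpos)
  have d_nonneg: "0 \<le> d x" for x by (simp add: d_def)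
  \<comment> \<open>If \<open>w\<close> is an outward normal at \<open>q\<close>, the squared
    distance to \<open>z\<close> exceeds the one to \<open>q\<close> by twice
    \<open>s * - (w \<bullet> (z - q))\<close> plus the squared norm of \<open>z - q\<close>, both
    nonnegative.\<close>
  have foot: "p (q + s *\<^sub>R w) = q" if "q \<in> K" "0 \<le> s" "\<And>z. z \<in> K \<Longrightarrow> w \<bullet> (z - q) \<le> 0" for q s w
  proof -
    have "dist (q + s *\<^sub>R w) q \<le> dist (q + s *\<^sub>R w) z" if z: "z \<in> K" for z
    proof -
      have "0 \<le> s * - (w \<bullet> (z - q))"
        using that(1) \<open>0 \<le> s\<close> \<open>\<And>z. z \<in> K \<Longrightarrow> w \<bullet> (z - q) \<le> 0\<close>[OF z] by (intro mult_nonneg_nonneg) auto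
      moreover have "(dist (q + s *\<^sub>R w) z)\<^sup>2 = (dist (q + s *\<^sub>R w) q)\<^sup>2 + 2 * (s * - (w \<bullet> (z - q))) + (norm (z - q))\<^sup>2"
        by (simp only: dist_norm power2_norm_eq_inner) (simp add: inner_simps inner_commute algebra_simps)
      ultimately have "(dist (q + s *\<^sub>R w) q)\<^sup>2 \<le> (dist (q + s *\<^sub>R w) z)\<^sup>2"
        using zero_le_power2[of "norm (z - q)"] by linarith
      then show ?thesis by simp
    qed
    then show ?thesis unfolding p_def
      using closest_point_unique[OF K(2) cl that(1), of "q + s *\<^sub>R w"] by simp
  qed
  have contr: "dist (f x) (f y) \<le> dist x y" if xy: "a < d x" "a < d y" for x y
  proof -
    have *: "0 \<le> (p x - p y) \<bullet> (n x - n y)"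
      using dn[OF pK[of y], of x] dn[OF pK[of x], of y] by (simp add: inner_simps inner_commute)
    have n1: "norm (n x) = 1" "norm (n y) = 1" using nn a xy by auto
    have **: "n x \<bullet> n y \<le> 1" using norm_cauchy_schwarz[of "n x" "n y"] n1 by simp
    have "f x - f y = (p x - p y) + ((d x - a) *\<^sub>R n x - (d y - a) *\<^sub>R n y)"
      using x_eq[of x] x_eq[of y] by (simp add: f_def algebra_simps)
    \<comment> \<open>The first summand is nonnegative by monotonicity of the normals, the second
      because unit vectors have inner product at most 1. Adding back \<open>a\<close> times the
      difference of the normals can therefore only increase the norm of
      \<open>f x - f y\<close>.\<close>
    then have "(f x - f y) \<bullet> (n x - n y) = (p x - p y) \<bullet> (n x - n y) + ((d x - a) + (d y - a)) * (1 - n x \<bullet> n y)"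
      using n1 by (simp only:) (simp add: inner_simps inner_commute norm_eq_1 algebra_simps)
    then have pos: "0 \<le> (f x - f y) \<bullet> (n x - n y)" using * ** xy by simp
    have "x - y = (f x - f y) + a *\<^sub>R (n x - n y)" by (simp add: f_def algebra_simps)
    then have "(norm (x - y))\<^sup>2 = (norm (f x - f y))\<^sup>2 + 2 * a * ((f x - f y) \<bullet> (n x - n y)) + (norm (a *\<^sub>R (n x - n y)))\<^sup>2"
      by (simp only: power2_norm_eq_inner) (simp add: inner_simps inner_commute algebra_simps)
    then have "(norm (f x - f y))\<^sup>2 \<le> (norm (x - y))\<^sup>2" using pos a by simp
    then show ?thesis by (simp add: dist_norm)
  qed
  have lm: "parallel_body K t \<in> lmeasurable" for t
    using K by (intro lmeasurable_compact compact_parallel_body)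
  define Sh where "Sh a b = parallel_body K b - parallel_body K a" for a b
  have ms: "measure lebesgue (Sh s t) = measure lebesgue (parallel_body K t) - measure lebesgue (parallel_body K s)"
    "Sh s t \<in> lmeasurable" if "0 \<le> s" "s \<le> t" for s t
  proof -
    have "parallel_body K s \<subseteq> parallel_body K t" using P that by force
    then show "measure lebesgue (Sh s t) = measure lebesgue (parallel_body K t) - measure lebesgue (parallel_body K s)"
      "Sh s t \<in> lmeasurable"
      unfolding Sh_def using lm by (auto simp: measurable_measure_Diff fmeasurableD)
  qed
  \<comment> \<open>Foot point and normal survive the inward shift, so only the distance drops by
    \<open>a\<close>: the shell over distances in (a, a + b] is mapped onto the one over (0,
    b].\<close>
  have img: "f ` Sh a (a + b) = Sh 0 b"
  proof (intro equalityI subsetI)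
    fix y assume "y \<in> f ` Sh a (a + b)"
    then obtain x where x: "x \<in> Sh a (a + b)" "y = f x" by blast
    then have dx: "a < d x" "d x \<le> a + b" using P a b by (auto simp: Sh_def simp del: parallel_body_0)
    have y: "y = p x + (d x - a) *\<^sub>R n x" using x x_eq[of x] by (simp add: f_def algebra_simps)
    have py: "p x = p y"
      unfolding y using foot[OF pK, of "d x - a" "n x" x] dn dx by simp
    have "y - p y = (d x - a) *\<^sub>R n x" by (metis y py add_diff_cancel_left')
    then have "d y = d x - a" using nn[of x] dx a by (simp add: d_def[of y] dist_norm)
    then show "y \<in> Sh 0 b" using dx P[of 0 y] P[of b y] b by (auto simp: Sh_def)
  next
    fix y assume "y \<in> Sh 0 b"
    then have dy: "0 < d y" "d y \<le> b" using P[of 0 y] P[of b y] b by (auto simp: Sh_def)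
    define x where "x = y + a *\<^sub>R n y"
    have x': "x = p y + (d y + a) *\<^sub>R n y" using x_eq[of y] by (simp add: x_def algebra_simps)
    have px: "p x = p y"
      unfolding x' using foot[OF pK, of "d y + a" "n y" y] dn dy a by simp
    have xd: "x - p x = (d y + a) *\<^sub>R n y" using x' px by simp
    have "n x = n y" unfolding n_def[of x] xd using dy a nn[OF dy(1)]
      by (simp add: sgn_div_norm)
    then have "y = f x" by (simp add: f_def x_def)
    moreover have "d x = d y + a" using xd nn[OF dy(1)] dy a by (simp add: d_def[of x] dist_norm)
    then have "x \<in> Sh a (a + b)" using dy P[of a x] P[of "a + b" x] a b by (simp add: Sh_def)
    ultimately show "y \<in> f ` Sh a (a + b)" by blast
  qed
  have "measure lebesgue (Sh 0 b) \<le> measure lebesgue (Sh a (a + b))"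
    unfolding img[symmetric]
  proof (rule measure_contraction_image_le)
    show "dist (f x) (f y) \<le> dist x y" if "x \<in> Sh a (a + b)" "y \<in> Sh a (a + b)" for x y
      using that a b by (intro contr) (auto simp: Sh_def P)
  qed (use ms a b img in auto)
  then show ?thesis
    using ms[of 0 b] ms[of a "a + b"] a b lm K
    by (simp add: measure_completion borel_compact compact_parallel_body)
qed

text \<open>A version at 0 of Fekete's lemma: more than (t - s)/s - 1/2 whole steps of length s need
  not be counted exactly, since at least (t - s)/s of them fit into t. Thus \<phi>(s)/s is at most
  \<phi>(t)/(t - s), and one t with quotient close to the infimum controls all small s.\<close>

lemma superadditive_quotient_tendsto:
  fixes \<phi> :: "real \<Rightarrow> real"
  assumes sup: "\<And>a b. 0 \<le> a \<Longrightarrow> 0 \<le> b \<Longrightarrow> \<phi> a + \<phi> b \<le> \<phi> (a + b)" and nn: "\<And>a. 0 \<le> a \<Longrightarrow> 0 \<le> \<phi> a"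
  shows "((\<lambda>t. \<phi> t / t) \<longlongrightarrow> (INF t\<in>{0<..}. \<phi> t / t)) (at_right 0)"
proof -
  define L where "L = (INF t\<in>{0<..}. \<phi> t / t)"
  have bdd: "bdd_below ((\<lambda>t. \<phi> t / t) ` {0<..})" using nn by (intro bdd_belowI2[of _ 0]) auto
  have low: "L \<le> \<phi> t / t" if "0 < t" for t unfolding L_def using that bdd by (intro cINF_lower) auto
  have mult: "real k * \<phi> s \<le> \<phi> (real k * s)" if "0 \<le> s" for k s
  proof (induction k)
    case (Suc k)
    have "real (Suc k) * \<phi> s = real k * \<phi> s + \<phi> s" by (simp add: algebra_simps)
    also have "\<dots> \<le> \<phi> (real k * s) + \<phi> s" using Suc by simp
    also have "\<dots> \<le> \<phi> (real k * s + s)" using that by (intro sup) auto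
    finally show ?case by (simp add: algebra_simps)
  qed (use nn in auto)
  have mono: "\<phi> s \<le> \<phi> t" if "0 \<le> s" "s \<le> t" for s t
    using sup[of s "t - s"] nn[of "t - s"] that by simp
  have key: "(t - s) * \<phi> s / s \<le> \<phi> t" if s: "0 < s" "s < t" for s t
  proof -
    define k where "k = nat \<lfloor>t / s\<rfloor>"
    have k: "real k \<le> t / s" "t / s < real k + 1"
      using s floor_correct[of "t / s"] unfolding k_def by (simp_all add: of_nat_nat)
    have "(t - s) / s \<le> real k" using k s by (simp add: field_simps)
    then have "(t - s) / s * \<phi> s \<le> real k * \<phi> s" using nn[of s] s by (intro mult_right_mono) auto
    also have "\<dots> \<le> \<phi> (real k * s)" using s by (intro mult) auto
    also have "\<dots> \<le> \<phi> t" using k s by (intro mono) (auto simp: field_simps)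
    finally show ?thesis by simp
  qed
  show ?thesis unfolding L_def[symmetric]
  proof (rule order_tendstoI)
    fix y assume "y < L"
    then show "\<forall>\<^sub>F t in at_right 0. y < \<phi> t / t"
      using low by (intro eventually_at_rightI[of 0 1]) (auto intro: less_le_trans)
  next
    fix y assume "L < y"
    then obtain t where t: "0 < t" "\<phi> t / t < y"
      using bdd unfolding L_def by (subst (asm) cINF_less_iff) auto
    have "((\<lambda>s. \<phi> t / (t - s)) \<longlongrightarrow> \<phi> t / (t - 0)) (at_right 0)"
      using t by (intro tendsto_intros) auto
    then have "\<forall>\<^sub>F s in at_right 0. \<phi> t / (t - s) < y"
      using t by (intro order_tendstoD(2)) auto
    moreover have "\<forall>\<^sub>F s in at_right 0. s < t \<and> 0 < s"
      using t by (intro eventually_at_rightI[of 0 t]) auto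
    ultimately show "\<forall>\<^sub>F s in at_right 0. \<phi> s / s < y"
    proof eventually_elim
      case (elim s)
      then have "\<phi> s / s \<le> \<phi> t / (t - s)" using key[of s t] by (simp add: field_simps)
      then show ?case using elim by linarith
    qed
  qed
qed

text \<open>Makes the \<open>Lim\<close> in the definition a genuine limit; every later statement
  about \<open>surface_area\<close> goes through this one.\<close>

lemma surface_area_tendsto:
  fixes K :: "'a::euclidean_space set"
  assumes K: "compact K" "convex K" "K \<noteq> {}"
  shows "((\<lambda>t. (measure lborel (parallel_body K t) - measure lborel K) / t) \<longlongrightarrow> surface_area K) (at_right 0)"
    and "0 \<le> surface_area K"
proof -
  define \<phi> where "\<phi> t = measure lborel (parallel_body K t) - measure lborel K" for t
  have nn: "0 \<le> \<phi> a" if "0 \<le> a" for a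
  proof -
    have "K \<subseteq> parallel_body K a" using that
      by (force simp: parallel_body_def intro: exI[of _ "0::'a"])
    then show ?thesis unfolding \<phi>_def using K
      by (auto intro!: measure_mono_fmeasurable fmeasurable_compact compact_parallel_body borel_compact)
  qed
  have "((\<lambda>t. \<phi> t / t) \<longlongrightarrow> (INF t\<in>{0<..}. \<phi> t / t)) (at_right 0)"
    using measure_parallel_body_superadditive[OF K] nn
    by (intro superadditive_quotient_tendsto) (force simp: \<phi>_def)+
  moreover from this have "surface_area K = (INF t\<in>{0<..}. \<phi> t / t)"
    unfolding surface_area_parallel_body \<phi>_def by (intro tendsto_Lim) auto
  moreover have "0 \<le> (INF t\<in>{0<..}. \<phi> t / t)"
    using nn by (intro cINF_greatest) auto
  ultimately show "((\<lambda>t. (measure lborel (parallel_body K t) - measure lborel K) / t) \<longlongrightarrow> surface_area K) (at_right 0)"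
    "0 \<le> surface_area K" by (auto simp: \<phi>_def)
qed

section \<open>Change of variables over an arbitrary finite index type\<close>

text \<open>The change of variables theorem of the library requires a well-ordered index type, so it is applied
  to a copy of the index type that carries an arbitrary well-order.\<close>

typedef 'a wo = "UNIV :: 'a set" morphisms of_wo to_wo ..

lemma of_wo_to_wo [simp]: "to_wo (of_wo x) = x" "of_wo (to_wo y) = y"
  by (simp_all add: of_wo_inverse to_wo_inverse)

lemma bij_of_wo: "bij of_wo"
  by (rule o_bij[of to_wo]) auto

lemma bij_to_wo: "bij to_wo"
  by (rule o_bij[of of_wo]) auto

instance wo :: (finite) finite
proof
  have "finite (range (to_wo :: 'a \<Rightarrow> 'a wo))" by simp
  then show "finite (UNIV :: 'a wo set)" by (simp add: bij_is_surj[OF bij_to_wo])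
qed

definition wo_key :: "'a::finite \<Rightarrow> nat" where
  "wo_key = (SOME f. inj f)"

lemma inj_wo_key: "inj wo_key"
  unfolding wo_key_def
  using finite_imp_inj_to_nat_seg[OF finite_class.finite_UNIV] by (intro someI_ex[of inj]) blast

instantiation wo :: (finite) wellorder
begin

definition "x \<le> y \<longleftrightarrow> wo_key (of_wo x) \<le> wo_key (of_wo y)"
definition "x < y \<longleftrightarrow> wo_key (of_wo x) < wo_key (of_wo y)"

instance
proof
  fix P :: "'a wo \<Rightarrow> bool" and a
  assume step: "\<And>x. (\<And>y. y < x \<Longrightarrow> P y) \<Longrightarrow> P x"
  show "P a"
    by (induction "wo_key (of_wo a)" arbitrary: a rule: less_induct) (metis step less_wo_def)
next
  fix x y :: "'a wo" assume "x \<le> y" "y \<le> x"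
  then have "wo_key (of_wo x) = wo_key (of_wo y)" by (simp add: less_eq_wo_def)
  then show "x = y" by (metis injD inj_wo_key of_wo_inject)
qed (auto simp: less_eq_wo_def less_wo_def)

end

section \<open>Lebesgue measure and determinants under reindexing\<close>

definition wo_vec :: "real^'n \<Rightarrow> real^'n wo" where "wo_vec x = (\<chi> i. x $ of_wo i)"
definition of_wo_vec :: "real^'n wo \<Rightarrow> real^'n" where "of_wo_vec x = (\<chi> i. x $ to_wo i)"

lemma wo_vec_inverse [simp]: "of_wo_vec (wo_vec x) = x" "wo_vec (of_wo_vec y) = y"
  by (simp_all add: wo_vec_def of_wo_vec_def)

lemma bij_wo_vec: "bij wo_vec" by (rule o_bij[of of_wo_vec]) auto

lemma linear_wo_vec: "linear wo_vec" and linear_of_wo_vec: "linear of_wo_vec"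
  by (auto intro!: linearI simp: wo_vec_def of_wo_vec_def vec_eq_iff)

lemma measurable_wo_vec [measurable]: "wo_vec \<in> borel_measurable borel" "of_wo_vec \<in> borel_measurable borel"
  by (auto intro!: borel_measurable_continuous_onI linear_continuous_on linear_wo_vec linear_of_wo_vec
      simp flip: linear_conv_bounded_linear)

text \<open>Conjugation by \<open>f\<close> is a sign preserving bijection between the permutations
  of the two index types, matching the Leibniz sums term by term.\<close>

lemma det_reindex:
  fixes A :: "'a::comm_ring_1^'n^'n" and f :: "'m::finite \<Rightarrow> 'n"
  assumes f: "bij f"
  shows "det (\<chi> i j. A $ f i $ f j) = det A"
  unfolding det_def
proof (rule sum.reindex_bij_witness[where i="map_permutation UNIV (inv f)" and j="map_permutation UNIV f"])
  have f': "inj f" "bij_betw f UNIV UNIV" "bij_betw (inv f) UNIV UNIV" "inj (inv f)"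
    using f bij_imp_bij_inv[OF f] by (auto simp: bij_is_inj)
  have inv[simp]: "inv f (f x) = x" "f (inv f y) = y" for x y
    using f by (auto simp: bij_is_inj bij_is_surj surj_f_inv_f)
  fix p :: "'m \<Rightarrow> 'm" assume "p \<in> {p. p permutes UNIV}"
  then have p: "p permutes UNIV" by simp
  show "map_permutation UNIV (inv f) (map_permutation UNIV f p) = p"
    using f' p by (intro map_permutation_compose_inv) auto
  show "map_permutation UNIV f p \<in> {p. p permutes UNIV}"
    using map_permutation_permutes[OF f'(2) p] by simp
  have ap: "map_permutation UNIV f p (f i) = f (p i)" for i
    using f' by (intro map_permutation_apply) auto
  have "(\<Prod>i\<in>UNIV. A $ i $ map_permutation UNIV f p i) = (\<Prod>i\<in>UNIV. A $ f i $ map_permutation UNIV f p (f i))"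
    using prod.reindex_bij_betw[OF f'(2), of "\<lambda>i. A $ i $ map_permutation UNIV f p i"] by simp
  then show "of_int (sign (map_permutation UNIV f p)) * (\<Prod>i\<in>UNIV. A $ i $ map_permutation UNIV f p i) =
      of_int (sign p) * (\<Prod>i\<in>UNIV. (\<chi> i j. A $ f i $ f j) $ i $ p i)"
    using sign_map_permutation[OF _ p, of f] f' by (simp add: ap)
next
  have f': "bij_betw (inv f) UNIV UNIV" "inj (inv f)" "inv (inv f) = f"
    using bij_imp_bij_inv[OF f] by (auto simp: bij_is_inj f inv_inv_eq)
  fix p :: "'n \<Rightarrow> 'n" assume "p \<in> {p. p permutes UNIV}"
  then have p: "p permutes UNIV" by simp
  show "map_permutation UNIV f (map_permutation UNIV (inv f) p) = p"
    using f' p f by (intro map_permutation_compose_inv) (auto simp: bij_is_surj surj_f_inv_f bij_betw_def)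
  show "map_permutation UNIV (inv f) p \<in> {p. p permutes UNIV}"
    using map_permutation_permutes[OF f'(1) p] by simp
qed

lemma det_matrix_wo_conj:
  fixes L :: "real^'n \<Rightarrow> real^'n"
  shows "det (matrix (wo_vec \<circ> L \<circ> of_wo_vec)) = det (matrix L)"
proof -
  have ax: "of_wo_vec (axis j 1) = axis (of_wo j) 1" for j :: "'n wo"
    by (auto simp: of_wo_vec_def axis_def vec_eq_iff)
  have "matrix (wo_vec \<circ> L \<circ> of_wo_vec) = (\<chi> i j. matrix L $ of_wo i $ of_wo j)"
    by (simp add: matrix_def ax wo_vec_def)
  then show ?thesis by (simp add: det_reindex[OF bij_of_wo])
qed

lemma prod_Basis_vec: "(\<Prod>b\<in>Basis. (x :: real^'n) \<bullet> b) = (\<Prod>i\<in>UNIV. x $ i)"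
proof -
  have "bij_betw (\<lambda>i. axis i 1 :: real^'n) UNIV Basis"
    by (auto simp: bij_betw_def inj_on_def axis_eq_axis Basis_vec_def)
  from prod.reindex_bij_betw[OF this, of "\<lambda>b. x \<bullet> b"] show ?thesis by (simp add: inner_axis)
qed

text \<open>Boxes pull back to boxes with the same side lengths in another order.\<close>

lemma lborel_wo_vec: "distr lborel borel (wo_vec :: real^'n \<Rightarrow> _) = lborel"
proof (rule lborel_eqI[symmetric])
  fix l u :: "real^'n wo" assume lu: "\<And>b. b \<in> Basis \<Longrightarrow> l \<bullet> b \<le> u \<bullet> b"
  then have le: "l $ i \<le> u $ i" for i using lu[of "axis i 1"] by (simp add: inner_axis)
  have vim: "wo_vec -` box l u = box (of_wo_vec l) (of_wo_vec u)"
    by (auto simp: mem_box_cart wo_vec_def of_wo_vec_def) (metis of_wo_to_wo)+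
  have "emeasure (distr lborel borel wo_vec) (box l u) = emeasure lborel (box (of_wo_vec l) (of_wo_vec u))"
    by (simp add: emeasure_distr vim)
  also have "\<dots> = (\<Prod>b\<in>Basis. (of_wo_vec u - of_wo_vec l) \<bullet> b)"
    using le by (intro emeasure_lborel_box) (auto simp: Basis_vec_def inner_axis of_wo_vec_def)
  also have "(\<Prod>b\<in>Basis. (of_wo_vec u - of_wo_vec l) \<bullet> b) = (\<Prod>i\<in>UNIV. (of_wo_vec u - of_wo_vec l) $ i)"
    by (rule prod_Basis_vec)
  also have "\<dots> = (\<Prod>i\<in>UNIV. (u - l) $ i)"
    using prod.reindex_bij_betw[OF bij_to_wo, of "\<lambda>i. (u - l) $ i"] by (simp add: of_wo_vec_def)
  also have "\<dots> = (\<Prod>b\<in>Basis. (u - l) \<bullet> b)"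
    by (rule prod_Basis_vec[symmetric])
  finally show "emeasure (distr lborel borel wo_vec) (box l u) = (\<Prod>b\<in>Basis. (u - l) \<bullet> b)" .
qed simp

lemma measure_linear_image_compact:
  fixes T :: "real^'n \<Rightarrow> real^'n"
  assumes T: "linear T" and S: "compact S"
  shows "measure lborel (T ` S) = \<bar>det (matrix T)\<bar> * measure lborel S"
proof -
  have pull: "measure lborel (wo_vec ` X) = measure lborel X" if "compact X" for X :: "(real^'n) set"
  proof -
    have X: "wo_vec ` X \<in> sets borel"
      using that linear_wo_vec by (intro borel_compact compact_continuous_image linear_continuous_on linear_conv_bounded_linear[THEN iffD1])
    have "measure lborel (wo_vec ` X) = measure (distr lborel borel wo_vec) (wo_vec ` X)"
      by (simp add: lborel_wo_vec)
    also have "\<dots> = measure lborel (wo_vec -` wo_vec ` X)"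
      using X by (simp add: measure_distr)
    also have "wo_vec -` wo_vec ` X = X" by (rule inj_vimage_image_eq[OF bij_is_inj[OF bij_wo_vec]])
    finally show ?thesis .
  qed
  define T' where "T' = wo_vec \<circ> T \<circ> of_wo_vec"
  have T': "linear T'" unfolding T'_def by (intro linear_compose linear_of_wo_vec linear_wo_vec T)
  have lin: "bounded_linear (wo_vec :: real^'n \<Rightarrow> _)" "bounded_linear T" "bounded_linear T'"
    using T T' linear_wo_vec linear_conv_bounded_linear by blast+
  have cS: "compact (wo_vec ` S)" "compact (T ` S)" "compact (T' ` wo_vec ` S)"
    using S lin by (auto intro!: compact_continuous_image linear_continuous_on)
  have "wo_vec ` T ` S = T' ` wo_vec ` S" by (simp add: T'_def image_comp comp_def)
  then have "measure lborel (T ` S) = measure lborel (T' ` wo_vec ` S)"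
    using pull[OF cS(2)] by simp
  also have "\<dots> = measure lebesgue (T' ` wo_vec ` S)"
    using cS(3) by (intro measure_completion[symmetric]) (auto intro!: borel_compact)
  also have "\<dots> = \<bar>det (matrix T')\<bar> * measure lebesgue (wo_vec ` S)"
    using cS(1) T' by (intro measure_linear_image lmeasurable_compact)
  also have "measure lebesgue (wo_vec ` S) = measure lborel (wo_vec ` S)"
    using cS(1) by (intro measure_completion) (auto intro!: borel_compact)
  finally show ?thesis using pull[OF S] unfolding T'_def det_matrix_wo_conj by simp
qed

lemma set_nn_integral_eq:
  fixes f :: "'a \<Rightarrow> real"
  assumes "set_integrable M S f" "\<And>x. 0 \<le> f x"
  shows "(\<integral>\<^sup>+x\<in>S. ennreal (f x) \<partial>M) = ennreal (LINT x:S|M. f x)"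
proof -
  have "(\<integral>\<^sup>+x\<in>S. ennreal (f x) \<partial>M) = (\<integral>\<^sup>+x. ennreal (indicator S x *\<^sub>R f x) \<partial>M)"
    by (intro nn_integral_cong) (auto simp: indicator_def)
  also have "\<dots> = ennreal (\<integral>x. indicator S x *\<^sub>R f x \<partial>M)"
    using assms by (intro nn_integral_eq_integral) (auto simp: set_integrable_def)
  finally show ?thesis by (simp add: set_lebesgue_integral_def)
qed

text \<open>Only an inequality can hold: the image of \<open>S\<close> may miss part of the space,
  and \<open>\<phi>\<close> is merely dominated by the Jacobian times the pulled back
  density.\<close>

lemma nn_integral_le_change_of_variables_wo:
  fixes g :: "real^'n::{finite,wellorder} \<Rightarrow> real^'n::_" and f :: "real^'n::_ \<Rightarrow> real"
  assumes S: "open S" and der: "\<And>x. x \<in> S \<Longrightarrow> (g has_derivative g' x) (at x)" and inj: "inj_on g S"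
    and f: "integrable lborel f" "\<And>y. 0 \<le> f y"
    and \<phi>: "\<phi> \<in> borel_measurable borel" "\<And>x. x \<in> S \<Longrightarrow> \<phi> x \<le> \<bar>det (matrix (g' x))\<bar> * f (g x)"
  shows "(\<integral>\<^sup>+x\<in>S. ennreal (\<phi> x) \<partial>lborel) \<le> (\<integral>\<^sup>+y. ennreal (f y) \<partial>lborel)"
proof -
  have Sm: "S \<in> sets lebesgue" using S by simp
  have der': "(g has_derivative g' x) (at x within S)" if "x \<in> S" for x
    using der[OF that] by (rule has_derivative_at_withinI)
  have fi: "set_integrable lebesgue UNIV f"
    using f(1) by (simp add: set_integrable_def integrable_completion borel_measurable_integrable)
  have gS: "g ` S \<in> sets lebesgue"
    by (rule differentiable_image_in_sets_lebesgue[OF Sm]) (auto simp: differentiable_on_def differentiable_def intro: der')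
  have fS: "set_integrable lebesgue (g ` S) f"
    using set_integrable_subset[OF fi gS] by simp
  have bl: "bounded_linear (vec :: real \<Rightarrow> real^1)" "bounded_linear (\<lambda>v::real^1. v $ 1)"
    by (auto intro!: bounded_linear_vec_nth linearI simp: vec_eq_iff simp flip: linear_conv_bounded_linear)
  define J where "J x = \<bar>det (matrix (g' x))\<bar>" for x
  \<comment> \<open>The change of variables theorem is applied to vector valued integrands, so the
    scalar \<open>f\<close> is viewed as a vector with one coordinate.\<close>
  have *: "(\<lambda>x. J x *\<^sub>R (vec (f (g x)) :: real^1)) absolutely_integrable_on S"
    "integral S (\<lambda>x. J x *\<^sub>R (vec (f (g x)) :: real^1)) = integral (g ` S) (\<lambda>y. vec (f y))"
    using has_absolute_integral_change_of_variables[OF Sm der' inj, of "\<lambda>y. vec (f y) :: real^1"]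
      absolutely_integrable_linear[OF fS bl(1)]
    unfolding J_def comp_def by auto
  have Ji: "(\<lambda>x. J x * f (g x)) absolutely_integrable_on S"
    using absolutely_integrable_linear[OF *(1) bl(2)] by (simp add: comp_def)
  have "integral S (\<lambda>x. J x * f (g x)) = (integral S (\<lambda>x. J x *\<^sub>R (vec (f (g x)) :: real^1))) $ 1"
    using integral_linear[OF set_lebesgue_integral_eq_integral(1)[OF *(1)] bl(2)] by (simp add: comp_def)
  also have "\<dots> = integral (g ` S) f"
    using integral_linear[OF set_lebesgue_integral_eq_integral(1)[OF fS] bl(1)] *(2) by (simp add: comp_def)
  finally have eq: "(LINT x:S|lebesgue. J x * f (g x)) = (LINT y:g ` S|lebesgue. f y)"
    using set_lebesgue_integral_eq_integral(2)[OF Ji] set_lebesgue_integral_eq_integral(2)[OF fS] by simp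
  have "(\<integral>\<^sup>+x\<in>S. ennreal (\<phi> x) \<partial>lborel) = (\<integral>\<^sup>+x\<in>S. ennreal (\<phi> x) \<partial>lebesgue)"
    by (simp add: nn_integral_completion)
  also have "\<dots> \<le> (\<integral>\<^sup>+x\<in>S. ennreal (J x * f (g x)) \<partial>lebesgue)"
    using \<phi>(2) by (intro nn_integral_mono) (auto simp: J_def indicator_def intro!: ennreal_leI)
  also have "\<dots> = ennreal (LINT x:S|lebesgue. J x * f (g x))"
    by (rule set_nn_integral_eq[OF Ji]) (simp add: J_def f(2))
  also have "\<dots> = (\<integral>\<^sup>+y\<in>g ` S. ennreal (f y) \<partial>lebesgue)"
    unfolding eq by (rule set_nn_integral_eq[OF fS f(2), symmetric])
  also have "\<dots> \<le> (\<integral>\<^sup>+y. ennreal (f y) \<partial>lebesgue)"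
    by (intro nn_integral_mono) (auto simp: indicator_def)
  also have "\<dots> = (\<integral>\<^sup>+y. ennreal (f y) \<partial>lborel)"
    using f(1) by (simp add: nn_integral_completion)
  finally show ?thesis .
qed

lemma nn_integral_le_change_of_variables:
  fixes g :: "real^'n \<Rightarrow> real^'n" and f :: "real^'n \<Rightarrow> real"
  assumes S: "open S" and der: "\<And>x. x \<in> S \<Longrightarrow> (g has_derivative g' x) (at x)" and inj: "inj_on g S"
    and f: "integrable lborel f" "\<And>y. 0 \<le> f y"
    and \<phi>: "\<phi> \<in> borel_measurable borel" "\<And>x. x \<in> S \<Longrightarrow> \<phi> x \<le> \<bar>det (matrix (g' x))\<bar> * f (g x)"
  shows "(\<integral>\<^sup>+x\<in>S. ennreal (\<phi> x) \<partial>lborel) \<le> (\<integral>\<^sup>+y. ennreal (f y) \<partial>lborel)"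
proof -
  have push: "(\<integral>\<^sup>+x. h (of_wo_vec x) \<partial>lborel) = (\<integral>\<^sup>+x. h x \<partial>lborel)"
    if [measurable]: "h \<in> borel_measurable borel" for h :: "real^'n \<Rightarrow> ennreal"
  proof -
    have "(\<integral>\<^sup>+x. h (of_wo_vec x) \<partial>lborel) = (\<integral>\<^sup>+x. h (of_wo_vec x) \<partial>distr lborel borel wo_vec)"
      by (simp add: lborel_wo_vec)
    also have "\<dots> = (\<integral>\<^sup>+x. h x \<partial>lborel)" by (subst nn_integral_distr) auto
    finally show ?thesis .
  qed
  have [measurable]: "f \<in> borel_measurable borel" using borel_measurable_integrable[OF f(1)] by simp
  note [measurable] = \<phi>(1)
  have [measurable]: "S \<in> sets borel" using S by simp
  define S' where "S' = of_wo_vec -` S"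
  have bl: "bounded_linear (wo_vec :: real^'n \<Rightarrow> _)" "bounded_linear (of_wo_vec :: _ \<Rightarrow> real^'n)"
    using linear_wo_vec linear_of_wo_vec linear_conv_bounded_linear by blast+
  have "(\<integral>\<^sup>+x\<in>S. ennreal (\<phi> x) \<partial>lborel) = (\<integral>\<^sup>+x\<in>S'. ennreal (\<phi> (of_wo_vec x)) \<partial>lborel)"
    by (subst push[symmetric]) (auto simp: S'_def indicator_def)
  also have "\<dots> \<le> (\<integral>\<^sup>+y. ennreal (f (of_wo_vec y)) \<partial>lborel)"
  proof (rule nn_integral_le_change_of_variables_wo[where g="wo_vec \<circ> g \<circ> of_wo_vec" and g'="\<lambda>x. wo_vec \<circ> g' (of_wo_vec x) \<circ> of_wo_vec"])
    show "open S'" unfolding S'_def using S bl(2)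
      by (intro open_vimage) (auto simp: linear_continuous_on)
    show "inj_on (wo_vec \<circ> g \<circ> of_wo_vec) S'"
      using inj by (auto simp: inj_on_def S'_def) (metis wo_vec_inverse)
    show "integrable lborel (\<lambda>y. f (of_wo_vec y))"
    proof -
      have "integrable (distr lborel borel wo_vec) (\<lambda>y. f (of_wo_vec y))"
        using f(1) by (subst integrable_distr_eq) auto
      then show ?thesis by (simp add: lborel_wo_vec)
    qed
    fix x assume "x \<in> S'"
    then have x: "of_wo_vec x \<in> S" by (simp add: S'_def)
    show "((wo_vec \<circ> g \<circ> of_wo_vec) has_derivative wo_vec \<circ> g' (of_wo_vec x) \<circ> of_wo_vec) (at x)"
      using der[OF x] bl
      by (intro diff_chain_at bounded_linear_imp_has_derivative) auto
    show "\<phi> (of_wo_vec x) \<le> \<bar>det (matrix (wo_vec \<circ> g' (of_wo_vec x) \<circ> of_wo_vec))\<bar> * f (of_wo_vec ((wo_vec \<circ> g \<circ> of_wo_vec) x))"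
      using \<phi>(2)[OF x] by (simp add: det_matrix_wo_conj)
  qed (use f in auto)
  also have "\<dots> = (\<integral>\<^sup>+y. ennreal (f y) \<partial>lborel)" by (rule push) measurable
  finally show ?thesis .
qed

section \<open>Minimal surface area position\<close>

text \<open>Absorbs a small multiple of \<open>K\<close> added to \<open>K\<close> into a dilate of
  \<open>K\<close>.\<close>

lemma convex_cone_combination:
  assumes "convex K" "x \<in> K" "y \<in> K" "0 \<le> (s::real)"
  obtains z where "z \<in> K" "x + s *\<^sub>R y = (1 + s) *\<^sub>R z"
proof
  show "(1 / (1 + s)) *\<^sub>R x + (s / (1 + s)) *\<^sub>R y \<in> K"
    using assms by (intro convexD) (auto simp: field_simps)
  show "x + s *\<^sub>R y = (1 + s) *\<^sub>R ((1 / (1 + s)) *\<^sub>R x + (s / (1 + s)) *\<^sub>R y)"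
    using assms by (simp add: scaleR_add_right)
qed

lemma measure_scaleR_compact:
  fixes S :: "'a::euclidean_space set"
  assumes "compact S" "0 \<le> c"
  shows "measure lborel ((*\<^sub>R) c ` S) = c ^ DIM('a) * measure lborel S"
proof -
  have "measure lborel ((*\<^sub>R) c ` S) = measure lebesgue ((\<lambda>x. c *\<^sub>R x + 0) ` S)"
    using assms by (subst measure_completion) (auto intro!: borel_compact compact_scaling)
  also have "\<dots> = c ^ DIM('a) * measure lborel S"
    using assms by (subst measure_lebesgue_affine) (auto simp: measure_completion borel_compact)
  finally show ?thesis .
qed

text \<open>Write T for the map of \<open>R'\<close>. As R maps B into \<alpha>B + \<kappa>K, the
  body T(K) + tB = T(K + tRB) lies in T((1 + t\<kappa>)K + t\<alpha>B). T preserves volume, and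
  differentiating the volume of the larger set at t = 0 gives the two terms: dilation contributes
  n\<kappa>|K|, the ball \<alpha>S(K).\<close>

lemma surface_area_inverse_image_le:
  fixes K :: "(real^'n) set" and R R' :: "real^'n^'n"
  assumes K: "compact K" "convex K" "K \<noteq> {}" and R: "R' ** R = mat 1" "\<bar>det R'\<bar> = 1"
    and \<alpha>: "0 < \<alpha>" and \<kappa>: "0 \<le> \<kappa>"
    and incl: "\<And>u. norm u \<le> 1 \<Longrightarrow> \<exists>w x. norm w \<le> 1 \<and> x \<in> K \<and> R *v u = \<alpha> *\<^sub>R w + \<kappa> *\<^sub>R x"
  shows "surface_area ((*v) R' ` K) \<le> \<alpha> * surface_area K + real CARD('n) * \<kappa> * measure lborel K"
proof -
  define T where "T = (*v) R'"
  have T: "linear T" "bounded_linear T" unfolding T_def by simp_all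
  have cT: "compact (T ` X)" if "compact X" for X
    using that T by (intro compact_continuous_image linear_continuous_on)
  have TK: "compact (T ` K)" "convex (T ` K)" "T ` K \<noteq> {}"
    using K T cT by (auto intro: convex_linear_image)
  have mT: "measure lborel (T ` X) = measure lborel X" if "compact X" for X
    using measure_linear_image_compact[OF T(1) that] R(2) by (simp add: T_def)
  define f where "f t = measure lborel (parallel_body K t)" for t
  define g where "g t = (f t - f 0) / t" for t
  define \<tau> where "\<tau> t = t * \<alpha> / (1 + t * \<kappa>)" for t
  let ?n = "CARD('n)"
  have f0: "f 0 = measure lborel K" by (simp add: f_def)
  have gS: "(g \<longlongrightarrow> surface_area K) (at_right 0)"
    using surface_area_tendsto(1)[OF K] unfolding g_def f_def by simp
  have le: "(measure lborel (parallel_body (T ` K) t) - measure lborel (T ` K)) / t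
      \<le> f 0 * (((1 + t * \<kappa>) ^ ?n - 1) / t) + (1 + t * \<kappa>) ^ ?n * (\<alpha> / (1 + t * \<kappa>)) * g (\<tau> t)"
    if t: "0 < t" for t
  proof -
    have pos: "0 < 1 + t * \<kappa>" using t \<kappa> by (simp add: add_pos_nonneg)
    have "parallel_body (T ` K) t \<subseteq> T ` (*\<^sub>R) (1 + t * \<kappa>) ` parallel_body K (\<tau> t)"
    proof
      fix y assume "y \<in> parallel_body (T ` K) t"
      then obtain x u where xu: "x \<in> K" "norm u \<le> 1" "y = T x + t *\<^sub>R u"
        by (auto simp: parallel_body_def)
      obtain w x' where w: "norm w \<le> 1" "x' \<in> K" "R *v u = \<alpha> *\<^sub>R w + \<kappa> *\<^sub>R x'" using incl[OF xu(2)] by blast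
      obtain z where z: "z \<in> K" "x + (t * \<kappa>) *\<^sub>R x' = (1 + t * \<kappa>) *\<^sub>R z"
        using convex_cone_combination[OF K(2) xu(1) w(2), of "t * \<kappa>"] t \<kappa> by auto
      have "u = T (R *v u)" using R(1) by (simp add: T_def matrix_vector_mul_assoc)
      then have "y = T (x + t *\<^sub>R (R *v u))" using T(1) xu(3) by (simp add: linear_add linear_scale)
      also have "x + t *\<^sub>R (R *v u) = (x + (t * \<kappa>) *\<^sub>R x') + (t * \<alpha>) *\<^sub>R w"
        by (simp add: w algebra_simps)
      also have "\<dots> = (1 + t * \<kappa>) *\<^sub>R (z + \<tau> t *\<^sub>R w)"
        using pos unfolding z(2) \<tau>_def by (simp add: scaleR_add_right)
      finally show "y \<in> T ` (*\<^sub>R) (1 + t * \<kappa>) ` parallel_body K (\<tau> t)"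
        using z(1) w(1) by (auto simp: parallel_body_def)
    qed
    then have "measure lborel (parallel_body (T ` K) t) \<le> measure lborel (T ` (*\<^sub>R) (1 + t * \<kappa>) ` parallel_body K (\<tau> t))"
      using K TK by (intro measure_mono_fmeasurable fmeasurable_compact cT compact_scaling compact_parallel_body)
        (auto intro: borel_compact compact_parallel_body)
    also have "\<dots> = (1 + t * \<kappa>) ^ ?n * f (\<tau> t)"
      using pos measure_scaleR_compact[OF compact_parallel_body[OF K(1)], of "1 + t * \<kappa>"]
      by (subst mT) (simp_all add: f_def compact_scaling compact_parallel_body[OF K(1)])
    finally have *: "measure lborel (parallel_body (T ` K) t) \<le> (1 + t * \<kappa>) ^ ?n * f (\<tau> t)" .
    have "0 < \<tau> t" using t pos \<alpha> by (simp add: \<tau>_def)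
    then have ft: "f (\<tau> t) = f 0 + \<tau> t * g (\<tau> t)" by (simp add: g_def)
    have "(measure lborel (parallel_body (T ` K) t) - measure lborel (T ` K)) / t
        \<le> ((1 + t * \<kappa>) ^ ?n * f (\<tau> t) - f 0) / t"
      using * t mT[OF K(1)] by (simp add: f0 divide_right_mono)
    also have "\<dots> = f 0 * (((1 + t * \<kappa>) ^ ?n - 1) / t) + (1 + t * \<kappa>) ^ ?n * (\<alpha> / (1 + t * \<kappa>)) * g (\<tau> t)"
      unfolding ft using t pos by (simp add: \<tau>_def field_simps)
    finally show ?thesis .
  qed
  have lim1: "((\<lambda>t. ((1 + t * \<kappa>) ^ ?n - 1) / t) \<longlongrightarrow> real ?n * \<kappa>) (at_right 0)"
  proof -
    have "((\<lambda>t. (1 + t * \<kappa>) ^ ?n) has_real_derivative real ?n * \<kappa>) (at 0)"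
      by (auto intro!: derivative_eq_intros)
    then have "((\<lambda>t. ((1 + t * \<kappa>) ^ ?n - 1) / t) \<longlongrightarrow> real ?n * \<kappa>) (at 0)"
      by (simp add: DERIV_def)
    then show ?thesis by (rule filterlim_mono) (auto simp: at_le)
  qed
  have lim\<tau>: "filterlim \<tau> (at_right 0) (at_right 0)"
    unfolding filterlim_at
  proof
    have "(\<tau> \<longlongrightarrow> 0 * \<alpha> / (1 + 0 * \<kappa>)) (at_right 0)"
      unfolding \<tau>_def by (intro tendsto_intros) auto
    then show "(\<tau> \<longlongrightarrow> 0) (at_right 0)" by simp
    show "\<forall>\<^sub>F x in at_right 0. \<tau> x \<in> {0<..} \<and> \<tau> x \<noteq> 0"
      using \<alpha> \<kappa> by (intro eventually_at_rightI[of 0 1]) (auto simp: \<tau>_def add_pos_nonneg less_imp_neq[symmetric])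
  qed
  have "((\<lambda>t. f 0 * (((1 + t * \<kappa>) ^ ?n - 1) / t) + (1 + t * \<kappa>) ^ ?n * (\<alpha> / (1 + t * \<kappa>)) * g (\<tau> t))
      \<longlongrightarrow> f 0 * (real ?n * \<kappa>) + (1 + 0 * \<kappa>) ^ ?n * (\<alpha> / (1 + 0 * \<kappa>)) * surface_area K) (at_right 0)"
    by (intro tendsto_intros lim1 filterlim_compose[OF gS lim\<tau>]) auto
  moreover have "\<forall>\<^sub>F t in at_right 0. (measure lborel (parallel_body (T ` K) t) - measure lborel (T ` K)) / t
      \<le> f 0 * (((1 + t * \<kappa>) ^ ?n - 1) / t) + (1 + t * \<kappa>) ^ ?n * (\<alpha> / (1 + t * \<kappa>)) * g (\<tau> t)"
    using le by (intro eventually_at_rightI[of 0 1]) auto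
  ultimately have "surface_area (T ` K) \<le> f 0 * (real ?n * \<kappa>) + (1 + 0 * \<kappa>) ^ ?n * (\<alpha> / (1 + 0 * \<kappa>)) * surface_area K"
    using surface_area_tendsto(1)[OF TK] by (intro tendsto_le) auto
  then show ?thesis by (simp add: T_def f0 algebra_simps)
qed

text \<open>A permutation other than the identity moves some i and also p(i), so its Leibniz term
  has at least two factors vanishing at s = 0 and contributes nothing to the derivative.\<close>

lemma has_real_derivative_det_one_add:
  fixes Q :: "real^'n^'n"
  shows "((\<lambda>s. det (mat 1 + s *\<^sub>R Q)) has_real_derivative trace Q) (at 0)"
proof -
  define F where "F s p = (\<Prod>i\<in>UNIV. (if p i = i then 1 else 0) + s * Q $ i $ p i)" for s and p :: "'n \<Rightarrow> 'n"
  define D where "D p = (\<Sum>i\<in>UNIV. Q $ i $ p i * (\<Prod>j\<in>UNIV - {i}. if p j = j then 1 else 0))" for p :: "'n \<Rightarrow> 'n"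
  have F: "((\<lambda>s. F s p) has_real_derivative D p) (at 0)" for p
    unfolding F_def has_field_derivative_def
    by (rule has_derivative_eq_rhs, (rule has_derivative_prod derivative_eq_intros | simp)+)
       (simp add: D_def fun_eq_iff sum_distrib_right sum_distrib_left mult_ac)
  have D0: "D p = 0" if p: "p permutes UNIV" "p \<noteq> id" for p
  proof -
    obtain i where i: "p i \<noteq> i" using p(2) by (auto simp: fun_eq_iff)
    have pi: "p (p i) \<noteq> p i" using p(1) i by (metis permutes_inj injD)
    have "(\<Prod>j\<in>UNIV - {k}. if p j = j then 1 else (0::real)) = 0" for k
      using i pi by (intro prod_zero[OF finite]) (metis DiffI UNIV_I singletonD)
    then show ?thesis by (simp only: D_def mult_zero_right sum.neutral_const)
  qed
  have det: "det (mat 1 + s *\<^sub>R Q) = (\<Sum>p\<in>{p. p permutes UNIV}. of_int (sign p) * F s p)" for s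
    unfolding det_def F_def by (intro sum.cong prod.cong arg_cong2[where f="(*)"]) (auto simp: mat_def)
  have "((\<lambda>s. det (mat 1 + s *\<^sub>R Q)) has_real_derivative (\<Sum>p\<in>{p. p permutes UNIV}. of_int (sign p) * D p)) (at 0)"
    unfolding det by (intro DERIV_sum DERIV_cmult F)
  also have "(\<Sum>p\<in>{p. p permutes (UNIV :: 'n set)}. of_int (sign p) * D p) = (\<Sum>p\<in>{id}. of_int (sign p) * D p)"
    by (rule sum.mono_neutral_right) (auto simp: D0 permutes_id)
  also have "\<dots> = trace Q" by (simp add: D_def trace_def)
  finally show ?thesis .
qed

lemma det_scaleR: "det (c *\<^sub>R A) = c ^ CARD('n) * det (A :: real^'n^'n)"
proof -
  have "c *\<^sub>R A = (\<chi> i. c *s A $ i)" by (simp add: vec_eq_iff)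
  then show ?thesis by (simp add: det_rows_mul)
qed

text \<open>Compare support functions in a unit direction v. For the image of the ball under I + sQ
  it is the norm of v + s vQ, which is at most 1 + s(v . Qv) + Cs^2; by hypothesis this is at most
  the support function of (1 + Cs^2)B + sK. The error is quadratic in s, so it is invisible to the
  derivative at 0.\<close>

lemma ellipsoid_subset_ball_plus:
  fixes K :: "(real^'n) set" and Q :: "real^'n^'n"
  assumes K: "compact K" "convex K" "K \<noteq> {}" and s: "0 \<le> s"
    and Q: "\<And>v. norm v = 1 \<Longrightarrow> \<exists>x\<in>K. v \<bullet> (Q *v v) \<le> v \<bullet> x"
    and C: "\<And>v. norm v = 1 \<Longrightarrow> (norm (v v* Q))\<^sup>2 \<le> 2 * C"
    and u: "norm u \<le> 1"
  shows "\<exists>w x. norm w \<le> 1 \<and> x \<in> K \<and> u + s *\<^sub>R (Q *v u) = (1 + C * s\<^sup>2) *\<^sub>R w + s *\<^sub>R x"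
proof (rule ccontr)
  assume neg: "\<not> ?thesis"
  define Z where "Z = {a + b |a b. a \<in> (*\<^sub>R) (1 + C * s\<^sup>2) ` cball 0 1 \<and> b \<in> (*\<^sub>R) s ` K}"
  have memZ: "(1 + C * s\<^sup>2) *\<^sub>R w + s *\<^sub>R x \<in> Z" if "norm w \<le> 1" "x \<in> K" for w x
    unfolding Z_def using that
    by (subst mem_Collect_eq, intro exI[of _ "(1 + C * s\<^sup>2) *\<^sub>R w", OF exI[of _ "s *\<^sub>R x"]] conjI imageI) simp_all
  have "compact Z"
    unfolding Z_def using K by (intro compact_sums compact_scaling) auto
  moreover have "convex Z"
    using convex_sums[OF convex_scaling[OF convex_cball, of "1 + C * s\<^sup>2" 0 1] convex_scaling[OF K(2), of s]]
    by (rule back_subst[of convex]) (auto simp: Z_def)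
  ultimately have Zc: "compact Z" "convex Z" by blast+
  have "u + s *\<^sub>R (Q *v u) \<notin> Z"
  proof
    assume "u + s *\<^sub>R (Q *v u) \<in> Z"
    then obtain w x where "u + s *\<^sub>R (Q *v u) = (1 + C * s\<^sup>2) *\<^sub>R w + s *\<^sub>R x" "w \<in> cball 0 1" "x \<in> K"
      unfolding Z_def by blast
    then show False using neg by auto
  qed
  then obtain a b where ab: "a \<bullet> (u + s *\<^sub>R (Q *v u)) < b" "\<And>z. z \<in> Z \<Longrightarrow> b < a \<bullet> z"
    using separating_hyperplane_closed_point[OF Zc(2) compact_imp_closed[OF Zc(1)]] by blast
  obtain k where k: "k \<in> K" using K by blast
  have "a \<noteq> 0" using ab(1) ab(2)[OF memZ[OF _ k, of 0]] by auto
  \<comment> \<open>The separating functional is smaller at the excluded point, hence the sign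
    change to a direction in which support values are compared.\<close>
  define v where "v = - (1 / norm a) *\<^sub>R a"
  have v: "norm v = 1" "a = - norm a *\<^sub>R v" using \<open>a \<noteq> 0\<close> by (auto simp: v_def)
  obtain x where x: "x \<in> K" "v \<bullet> (Q *v v) \<le> v \<bullet> x" using Q[OF v(1)] by blast
  have "(1 + C * s\<^sup>2) *\<^sub>R v + s *\<^sub>R x \<in> Z" using v(1) x(1) by (intro memZ) auto
  from ab(2)[OF this] ab(1) have "a \<bullet> (u + s *\<^sub>R (Q *v u)) < a \<bullet> ((1 + C * s\<^sup>2) *\<^sub>R v + s *\<^sub>R x)" by linarith
  then have "norm a * (v \<bullet> ((1 + C * s\<^sup>2) *\<^sub>R v + s *\<^sub>R x)) < norm a * (v \<bullet> (u + s *\<^sub>R (Q *v u)))"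
    by (subst (asm) (1 2) v(2)) simp
  then have less: "v \<bullet> ((1 + C * s\<^sup>2) *\<^sub>R v + s *\<^sub>R x) < v \<bullet> (u + s *\<^sub>R (Q *v u))"
    using \<open>a \<noteq> 0\<close> by simp
  define y where "y = v + s *\<^sub>R (v v* Q)"
  have "v \<bullet> (u + s *\<^sub>R (Q *v u)) = y \<bullet> u" by (simp add: y_def inner_simps dot_lmul_matrix)
  also have "\<dots> \<le> norm y * norm u" by (rule norm_cauchy_schwarz)
  also have "\<dots> \<le> norm y" using u by (simp add: mult_left_le)
  also have "norm y \<le> 1 + s * (v \<bullet> (Q *v v)) + C * s\<^sup>2"
  proof -
    \<comment> \<open>Linearises the square root: the norm of \<open>y\<close> is the root of 1 + X,
      hence at most 1 + X/2.\<close>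
    define X where "X = 2 * s * (v \<bullet> (Q *v v)) + s\<^sup>2 * (norm (v v* Q))\<^sup>2"
    have expand: "(norm (v + s *\<^sub>R q))\<^sup>2 = (norm v)\<^sup>2 + 2 * s * (q \<bullet> v) + s\<^sup>2 * (norm q)\<^sup>2" for q
      by (simp only: power2_norm_eq_inner) (simp add: inner_simps inner_commute power2_eq_square algebra_simps)
    have ny: "(norm y)\<^sup>2 = 1 + X"
      using v(1) unfolding y_def expand X_def dot_lmul_matrix by simp
    have "norm y \<le> 1 + X / 2"
    proof (rule power2_le_imp_le)
      have "(1 + X / 2)\<^sup>2 = 1 + X + (X / 2)\<^sup>2" unfolding power2_sum by simp
      then show "(norm y)\<^sup>2 \<le> (1 + X / 2)\<^sup>2" unfolding ny using zero_le_power2[of "X / 2"] by linarith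
      show "0 \<le> 1 + X / 2" using zero_le_power2[of "norm y"] unfolding ny by linarith
    qed
    also have "X / 2 \<le> s * (v \<bullet> (Q *v v)) + C * s\<^sup>2"
      using mult_left_mono[OF C[OF v(1)], of "s\<^sup>2"] by (simp add: X_def mult_ac)
    finally show ?thesis by simp
  qed
  also have "\<dots> \<le> 1 + C * s\<^sup>2 + s * (v \<bullet> x)" using mult_left_mono[OF x(2) s] by simp
  also have "\<dots> = v \<bullet> ((1 + C * s\<^sup>2) *\<^sub>R v + s *\<^sub>R x)"
    using v(1) by (simp add: inner_simps norm_eq_1)
  finally show False using less by simp
qed

lemma derivative_nonneg_of_right_minimum:
  fixes G :: "real \<Rightarrow> real"
  assumes "(G has_real_derivative l) (at x)" "\<forall>\<^sub>F y in at_right x. G x \<le> G y"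
  shows "0 \<le> l"
proof (rule ccontr)
  assume "\<not> 0 \<le> l"
  then obtain d where d: "0 < d" "\<And>h. 0 < h \<Longrightarrow> h < d \<Longrightarrow> G (x + h) < G x"
    using DERIV_neg_dec_right[OF assms(1)] by auto
  obtain b where b: "x < b" "\<And>y. x < y \<Longrightarrow> y < b \<Longrightarrow> G x \<le> G y"
    using assms(2) eventually_at_right[of x "x + 1"] by auto
  define h where "h = min d (b - x) / 2"
  have "0 < h" "h < d" "x + h < b" using d(1) b(1) by (auto simp: h_def min_def field_simps)
  then show False using d(2)[of h] b(2)[of "x + h"] by simp
qed

text \<open>First-order optimality of the position: compare \<open>K\<close> with its image under the inverse of the
  normalised \<open>I + s Q\<close> as \<open>s\<close> tends to \<open>0\<close>.\<close>

lemma minimal_surface_area_position_trace_le: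
  fixes K :: "(real^'n) set" and Q :: "real^'n^'n"
  assumes K: "compact K" "convex K" "K \<noteq> {}" and min: "minimal_surface_area_position K"
    and Q: "\<And>v. norm v = 1 \<Longrightarrow> \<exists>x\<in>K. v \<bullet> (Q *v v) \<le> v \<bullet> x"
  shows "trace Q * surface_area K \<le> (real CARD('n))\<^sup>2 * measure lborel K"
proof -
  let ?n = "real CARD('n)"
  \<comment> \<open>The constant of the quadratic error, from the operator norm of the transpose of
    \<open>Q\<close>.\<close>
  define C where "C = (onorm (\<lambda>v. v v* Q))\<^sup>2 / 2"
  have bl: "bounded_linear (\<lambda>v. v v* Q)"
  proof (rule back_subst[of bounded_linear])
    show "(*v) (transpose Q) = (\<lambda>v. v v* Q)"
      by (rule ext) (simp add: vector_matrix_mult_def matrix_vector_mult_def transpose_def mult.commute)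
  qed (rule matrix_vector_mul_bounded_linear)
  have C: "(norm (v v* Q))\<^sup>2 \<le> 2 * C" if "norm v = 1" for v
    using onorm[OF bl, of v] that by (simp add: C_def power_mono)
  have C0: "0 \<le> C" by (simp add: C_def)
  define D where "D s = det (mat 1 + s *\<^sub>R Q)" for s
  \<comment> \<open>Normalises I + sQ to determinant 1.\<close>
  define c where "c s = D s powr (- 1 / ?n)" for s
  \<comment> \<open>Bounds the surface area of the perturbed body from above and equals that of
    \<open>K\<close> at s = 0. Minimality thus makes 0 a right-sided minimum of \<open>G\<close>,
    and the nonnegative derivative there is the claim.\<close>
  define G where "G s = c s * ((1 + C * s\<^sup>2) * surface_area K + ?n * s * measure lborel K)" for s
  have D: "(D has_real_derivative trace Q) (at 0)" unfolding D_def by (rule has_real_derivative_det_one_add)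
  have D0: "D 0 = 1" by (simp add: D_def)
  have G0: "G 0 = surface_area K" by (simp add: G_def c_def D0)
  have "(G has_real_derivative - trace Q / ?n * surface_area K + ?n * measure lborel K) (at 0)"
    unfolding G_def c_def by (rule derivative_eq_intros D refl | simp add: D0)+
  moreover have "\<forall>\<^sub>F s in at_right 0. G 0 \<le> G s"
  proof -
    have "(D \<longlongrightarrow> 1) (at 0)" using DERIV_isCont[OF D] by (simp add: isCont_def D0)
    then have "\<forall>\<^sub>F s in at 0. 0 < D s" by (rule order_tendstoD) simp
    then have "\<forall>\<^sub>F s in at_right 0. 0 < D s" by (rule filter_leD[rotated]) (simp add: at_le)
    moreover have "\<forall>\<^sub>F s::real in at_right 0. 0 < s" by (simp add: eventually_at_right_less)
    ultimately show ?thesis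
    proof eventually_elim
      case (elim s)
      define R where "R = c s *\<^sub>R (mat 1 + s *\<^sub>R Q)"
      have c: "0 < c s" using elim by (simp add: c_def)
      have "c s ^ CARD('n) = c s powr ?n" using c by (simp add: powr_realpow)
      also have "\<dots> = inverse (D s)" unfolding c_def powr_powr using elim by (simp add: powr_minus)
      finally have "det R = 1" using elim by (simp add: R_def det_scaleR D_def[symmetric])
      then obtain R' where R': "R ** R' = mat 1" "R' ** R = mat 1"
        using invertible_det_nz[of R] by (auto simp: invertible_def)
      have dR': "det R' = 1" using det_mul[of R R'] R' \<open>det R = 1\<close> by simp
      have "surface_area K \<le> surface_area ((*v) R' ` K)"
        using min dR' unfolding minimal_surface_area_position_def by (auto dest: spec[of _ "(*v) R'"])
      also have "\<dots> \<le> (c s * (1 + C * s\<^sup>2)) * surface_area K + ?n * (c s * s) * measure lborel K"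
      proof (rule surface_area_inverse_image_le[OF K R'(2)])
        show "0 < c s * (1 + C * s\<^sup>2)" using c C0 by (simp add: add_pos_nonneg)
        fix u :: "real^'n" assume "norm u \<le> 1"
        then obtain w x where "norm w \<le> 1" "x \<in> K" "u + s *\<^sub>R (Q *v u) = (1 + C * s\<^sup>2) *\<^sub>R w + s *\<^sub>R x"
          using ellipsoid_subset_ball_plus[OF K less_imp_le[OF \<open>0 < s\<close>], of Q C u] Q C by blast
        then show "\<exists>w x. norm w \<le> 1 \<and> x \<in> K \<and> R *v u = (c s * (1 + C * s\<^sup>2)) *\<^sub>R w + (c s * s) *\<^sub>R x"
          by (intro exI[of _ w] exI[of _ x])
            (simp add: R_def scaleR_matrix_vector_assoc[symmetric] matrix_vector_mult_add_rdistrib flip: scaleR_scaleR scaleR_add_right)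
      qed (use c elim dR' in auto)
      also have "\<dots> = G s" by (simp add: G_def algebra_simps)
      finally show ?case by (simp add: G0)
    qed
  qed
  ultimately have "0 \<le> - trace Q / ?n * surface_area K + ?n * measure lborel K"
    by (rule derivative_nonneg_of_right_minimum)
  then show ?thesis by (simp add: field_simps power2_eq_square)
qed

section \<open>Petty's condition by separation\<close>

text \<open>The rank one matrix u \<otimes> u, placed in the Euclidean space of matrices so that
  linear functionals on these matrices are quadratic forms in u.\<close>

definition vec_square :: "real^'n \<Rightarrow> real^'n^'n" where
  "vec_square u = (\<chi> i j. u $ i * u $ j)"

lemma vec_square_mult_vec: "vec_square u *v x = (u \<bullet> x) *\<^sub>R u"
  by (simp add: vec_square_def matrix_vector_mult_def vec_eq_iff inner_vec_def sum_distrib_left mult_ac)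

lemma inner_vec_square: "A \<bullet> vec_square u = u \<bullet> (A *v u)"
  by (simp add: vec_square_def matrix_vector_mult_def inner_vec_def sum_distrib_left mult_ac)

lemma inner_mat_1: "(A :: real^'n^'n) \<bullet> mat 1 = trace A"
  by (simp add: inner_vec_def mat_def trace_def if_distrib cong: if_cong)

lemma continuous_on_vec_square: "continuous_on S vec_square"
  unfolding vec_square_def by (intro continuous_intros)

lemma trace_scaleR: "trace (c *\<^sub>R (A :: real^'n^'n)) = c * trace A"
  by (simp add: trace_def sum_distrib_left)

text \<open>Petty's theorem without the surface area measure: a separation argument in matrix space replaces the
  isotropic measure by a finite one.\<close>

lemma minimal_surface_area_position_decomposition:
  fixes K :: "(real^'n) set"
  assumes K: "compact K" "convex K" "K \<noteq> {}" and min: "minimal_surface_area_position K"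
    and S: "0 < surface_area K"
  obtains I :: "((real^'n^'n) \<times> real) set" and c u h where
    "finite I" "\<And>i. i \<in> I \<Longrightarrow> 0 \<le> c i" "\<And>i. i \<in> I \<Longrightarrow> norm (u i) = 1"
    "\<And>i x. i \<in> I \<Longrightarrow> x \<in> K \<Longrightarrow> u i \<bullet> x \<le> h i"
    "(\<Sum>i\<in>I. c i) = real CARD('n)"
    "\<And>x. (\<Sum>i\<in>I. c i *\<^sub>R ((u i \<bullet> x) *\<^sub>R u i)) = x"
    "(\<Sum>i\<in>I. c i * h i) * surface_area K = (real CARD('n))\<^sup>2 * measure lborel K"
proof -
  let ?n = "real CARD('n)"
  define r where "r = ?n * measure lborel K / surface_area K"
  obtain R where R: "\<And>x. x \<in> K \<Longrightarrow> norm x \<le> R"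
    using compact_imp_bounded[OF K(1)] unfolding bounded_iff by blast
  obtain x0 where x0: "x0 \<in> K" using K by blast
  \<comment> \<open>A cap on heights that makes \<open>P\<close> compact. It is above the support
    function on unit vectors and strictly above \<open>r\<close>; the strictness later forces
    \<beta> > 0.\<close>
  define M where "M = max R r + 1"
  \<comment> \<open>Heights between the support function and the cap are allowed, instead of exact
    support values; the points of height \<open>M\<close> are used to determine the sign of
    \<beta>.\<close>
  define P where "P = {p :: (real^'n) \<times> real. norm (fst p) = 1 \<and> (\<forall>x\<in>K. fst p \<bullet> x \<le> snd p) \<and> snd p \<le> M}"
  have P_sup: "(v, v \<bullet> x) \<in> P" if "norm v = 1" "x \<in> K" "\<And>y. y \<in> K \<Longrightarrow> v \<bullet> y \<le> v \<bullet> x" for v x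
    using norm_cauchy_schwarz[of v x] R[OF that(2)] that unfolding P_def M_def by simp
  have P_M: "(v, M) \<in> P" if "norm v = 1" for v
    using norm_cauchy_schwarz[of v] R that unfolding P_def M_def
    by (auto intro!: order_trans[OF norm_cauchy_schwarz] simp: le_max_iff_disj add_increasing2)
  have "compact P"
  proof -
    have "P = {p. norm (fst p) = 1} \<inter> (\<Inter>x\<in>K. {p. fst p \<bullet> x \<le> snd p}) \<inter> {p. snd p \<le> M}"
      by (auto simp: P_def)
    also have "closed \<dots>"
      by (intro closed_Int closed_INT ballI closed_Collect_eq closed_Collect_le continuous_intros)
    finally have "closed P" .
    moreover have "P \<subseteq> sphere 0 1 \<times> {- norm x0..M}"
    proof
      fix p assume p: "p \<in> P"
      then have "- norm x0 \<le> snd p"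
        using x0 Cauchy_Schwarz_ineq2[of "fst p" x0] unfolding P_def by fastforce
      then show "p \<in> sphere 0 1 \<times> {- norm x0..M}" using p by (cases p) (simp add: P_def)
    qed
    then have "bounded P" by (rule bounded_subset[rotated]) (intro bounded_Times, auto)
    ultimately show ?thesis by (simp add: compact_eq_bounded_closed)
  qed
  define E where "E = (\<lambda>p. (vec_square (fst p), snd p)) ` P"
  have "continuous_on P (\<lambda>p. (vec_square (fst p), snd p))"
    by (intro continuous_intros continuous_on_compose2[OF continuous_on_vec_square[of UNIV]]) auto
  then have E: "compact E" unfolding E_def using \<open>compact P\<close> by (rule compact_continuous_image)
  \<comment> \<open>The target averages, I/n for the matrices and \<open>r\<close> for the heights;
    multiplying convex weights by n then gives the decomposition of I.\<close>
  define z where "z = ((1 / ?n) *\<^sub>R (mat 1 :: real^'n^'n), r)"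
  have "z \<in> convex hull E"
  proof (rule ccontr)
    assume "z \<notin> convex hull E"
    then obtain a b where ab: "a \<bullet> z < b" "\<And>x. x \<in> convex hull E \<Longrightarrow> b < a \<bullet> x"
      using separating_hyperplane_closed_point[of "convex hull E" z] compact_imp_closed[OF compact_convex_hull[OF E]]
      by auto
    obtain A \<beta> where a: "a = (A, \<beta>)" by (cases a)
    have abP: "b < v \<bullet> (A *v v) + \<beta> * \<tau>" if "(v, \<tau>) \<in> P" for v \<tau>
    proof -
      have "(vec_square v, \<tau>) \<in> convex hull E" using that by (intro hull_inc) (force simp: E_def)
      from ab(2)[OF this] show ?thesis by (simp add: a inner_vec_square)
    qed
    have abz: "trace A / ?n + \<beta> * r < b" using ab(1) by (simp add: a z_def inner_mat_1)
    have diag: "axis j 1 \<bullet> (A *v axis j 1) = A $ j $ j" for j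
      by (simp add: inner_axis' matrix_vector_mul_component inner_axis)
    \<comment> \<open>Averaging the separation inequality over the points of height \<open>M\<close>
      above the coordinate vectors gives b \<le> trace A/n + \<beta>M; with the strict inequality at
      \<open>z\<close> this yields \<beta>(M - r) > 0.\<close>
    have "(\<Sum>j\<in>(UNIV :: 'n set). b) \<le> (\<Sum>j\<in>UNIV. A $ j $ j + \<beta> * M)"
      using abP[OF P_M[of "axis j 1" for j]] by (intro sum_mono less_imp_le) (simp add: diag)
    then have "b \<le> trace A / ?n + \<beta> * M" by (simp add: sum.distrib trace_def field_simps)
    then have "0 < \<beta> * (M - r)" using abz by (simp add: algebra_simps)
    moreover have "0 < M - r" by (simp add: M_def)
    ultimately have \<beta>: "0 < \<beta>" by (simp add: zero_less_mult_iff)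
    \<comment> \<open>Solving the separation inequality for the height says precisely that v . Qv
      lies below the support function of \<open>K\<close>, while the inequality at \<open>z\<close>
      says that trace Q exceeds n r. The trace bound excludes both holding.\<close>
    define Q where "Q = (1 / \<beta>) *\<^sub>R (b *\<^sub>R mat 1 - A)"
    have vQ: "v \<bullet> (Q *v v) = (b - v \<bullet> (A *v v)) / \<beta>" if "norm v = 1" for v
      using that by (simp add: Q_def scaleR_matrix_vector_assoc[symmetric] matrix_vector_mult_diff_rdistrib inner_simps norm_eq_1)
    have "trace Q * surface_area K \<le> ?n\<^sup>2 * measure lborel K"
    proof (rule minimal_surface_area_position_trace_le[OF K min])
      fix v :: "real^'n" assume v: "norm v = 1"
      obtain x where x: "x \<in> K" "\<And>y. y \<in> K \<Longrightarrow> v \<bullet> y \<le> v \<bullet> x"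
        using continuous_attains_sup[OF K(1,3) continuous_on_inner[OF continuous_on_const continuous_on_id], of v] by auto
      show "\<exists>x\<in>K. v \<bullet> (Q *v v) \<le> v \<bullet> x"
        using x(1) abP[OF P_sup[OF v x]] \<beta> by (intro bexI[of _ x]) (simp_all add: vQ[OF v] field_simps)
    qed
    moreover have "trace Q = (?n * b - trace A) / \<beta>"
      by (simp add: Q_def trace_scaleR trace_sub trace_I)
    moreover have "?n * r < (?n * b - trace A) / \<beta>"
      using abz \<beta> by (simp add: field_simps)
    ultimately have "?n * r * surface_area K < ?n\<^sup>2 * measure lborel K"
      using S by (metis less_le_trans mult_strict_right_mono)
    then show False using S by (simp add: r_def power2_eq_square)
  qed
  then obtain I w where I: "finite I" "I \<subseteq> E" "\<And>i. i \<in> I \<Longrightarrow> 0 \<le> w i" "sum w I = 1" "(\<Sum>v\<in>I. w v *\<^sub>R v) = z"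
    unfolding convex_hull_explicit by blast
  \<comment> \<open>The hull points are pairs of a matrix and a height, which explains the index
    type; a unit vector is chosen back from its rank one matrix, the sign being immaterial.\<close>
  define u where "u i = (SOME v. (v, snd i) \<in> P \<and> vec_square v = fst i)" for i :: "(real^'n^'n) \<times> real"
  have u: "(u i, snd i) \<in> P \<and> vec_square (u i) = fst i" if i: "i \<in> I" for i
  proof -
    obtain p where "p \<in> P" "i = (vec_square (fst p), snd p)" using I(2) i unfolding E_def by blast
    then have "\<exists>v. (v, snd i) \<in> P \<and> vec_square v = fst i" by (intro exI[of _ "fst p"]) simp
    then show ?thesis unfolding u_def by (rule someI_ex)
  qed
  show ?thesis
  proof (rule that[of I "\<lambda>i. ?n * w i" u snd])
    show "(\<Sum>i\<in>I. ?n * w i) = ?n" using I(4) by (simp add: sum_distrib_left[symmetric])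
    have "(\<Sum>i\<in>I. w i * snd i) = r" using arg_cong[OF I(5), of snd] by (simp add: snd_sum z_def)
    then show "(\<Sum>i\<in>I. ?n * w i * snd i) * surface_area K = ?n\<^sup>2 * measure lborel K"
      using S by (simp add: mult.assoc sum_distrib_left[symmetric] r_def power2_eq_square)
    fix x :: "real^'n"
    have lin: "linear (\<lambda>A. A *v x)"
      by (intro linearI) (simp_all add: matrix_vector_mult_add_rdistrib scaleR_matrix_vector_assoc)
    have "(\<Sum>i\<in>I. w i *\<^sub>R fst i) = (1 / ?n) *\<^sub>R mat 1" using arg_cong[OF I(5), of fst] by (simp add: fst_sum z_def)
    then have "(\<Sum>i\<in>I. w i *\<^sub>R fst i) *v x = (1 / ?n) *\<^sub>R x" by (simp add: scaleR_matrix_vector_assoc[symmetric])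
    also have "(\<Sum>i\<in>I. w i *\<^sub>R fst i) *v x = (\<Sum>i\<in>I. w i *\<^sub>R ((u i \<bullet> x) *\<^sub>R u i))"
      unfolding linear_sum[OF lin] linear_cmul[OF lin]
      using u by (intro sum.cong refl) (metis vec_square_mult_vec)
    finally have "?n *\<^sub>R (\<Sum>i\<in>I. w i *\<^sub>R ((u i \<bullet> x) *\<^sub>R u i)) = x" by simp
    then show "(\<Sum>i\<in>I. (?n * w i) *\<^sub>R ((u i \<bullet> x) *\<^sub>R u i)) = x"
      by (simp only: scaleR_sum_right scaleR_scaleR mult.assoc)
  next
    fix i x assume "i \<in> I" "x \<in> K"
    then show "u i \<bullet> x \<le> snd i" using u[of i] unfolding P_def by simp
  next
    fix i assume "i \<in> I"
    then show "norm (u i) = 1" using u[of i] unfolding P_def by simp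
  qed (use I in auto)
qed

section \<open>The determinant inequality\<close>

text \<open>Take a maximiser \<open>x\<close> of the quadratic form on the unit sphere of
  \<open>V\<close>. The first variation makes \<open>f x\<close> orthogonal to every vector of
  \<open>V\<close> orthogonal to \<open>x\<close>, and invariance of \<open>V\<close> allows this to
  be tested on the remainder \<open>f x - m *\<^sub>R x\<close>.\<close>

lemma symmetric_operator_eigenvector:
  fixes f :: "'a::euclidean_space \<Rightarrow> 'a"
  assumes f: "linear f" and sym: "\<And>x y. f x \<bullet> y = x \<bullet> f y"
    and V: "subspace V" "V \<noteq> {0}" and inv: "\<And>x. x \<in> V \<Longrightarrow> f x \<in> V"
  obtains x m where "x \<in> V" "norm x = 1" "f x = m *\<^sub>R x"
proof -
  obtain z where z: "z \<in> V" "z \<noteq> 0" using V subspace_0 by blast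
  let ?S = "V \<inter> sphere 0 1"
  have "compact ?S" using closed_subspace[OF V(1)] by (simp add: closed_Int_compact)
  moreover have "(1 / norm z) *\<^sub>R z \<in> ?S" using z V(1) by (simp add: subspace_scale)
  moreover have "continuous_on ?S (\<lambda>x. x \<bullet> f x)"
    using f by (intro continuous_intros linear_continuous_on) (simp add: linear_conv_bounded_linear)
  ultimately obtain x where x: "x \<in> ?S" "\<And>y. y \<in> ?S \<Longrightarrow> y \<bullet> f y \<le> x \<bullet> f x"
    using continuous_attains_sup[of ?S "\<lambda>x. x \<bullet> f x"] by blast
  define m where "m = x \<bullet> f x"
  have max: "y \<bullet> f y \<le> m * (norm y)\<^sup>2" if "y \<in> V" for y
  proof (cases "y = 0")
    case False
    then have "(1 / norm y) *\<^sub>R y \<in> ?S" using that V(1) by (simp add: subspace_scale)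
    from x(2)[OF this] show ?thesis
      using False f by (simp add: linear_scale m_def power2_eq_square field_simps)
  qed (use f in \<open>simp add: linear_0\<close>)
  have nx: "norm x = 1" "x \<in> V" using x(1) by auto
  have orth: "f x \<bullet> y = 0" if y: "y \<in> V" "x \<bullet> y = 0" for y
  proof (rule ccontr)
    assume ne: "f x \<bullet> y \<noteq> 0"
    define q where "q = f x \<bullet> y"
    define k where "k = m * (norm y)\<^sup>2 - y \<bullet> f y"
    have k: "0 \<le> k" using max[OF y(1)] by (simp add: k_def)
    have quad: "2 * t * q \<le> t\<^sup>2 * k" for t
    proof -
      have "x + t *\<^sub>R y \<in> V" using nx y V(1) by (simp add: subspace_add subspace_scale)
      from max[OF this] have "(x + t *\<^sub>R y) \<bullet> (f x + t *\<^sub>R f y) \<le> m * (norm (x + t *\<^sub>R y))\<^sup>2"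
        using f by (simp add: linear_add linear_scale)
      also have "(norm (x + t *\<^sub>R y))\<^sup>2 = 1 + t\<^sup>2 * (norm y)\<^sup>2"
        using nx y(2) by (simp only: power2_norm_eq_inner)
          (simp add: inner_simps norm_eq_1 inner_commute[of y x] power2_eq_square)
      also have "(x + t *\<^sub>R y) \<bullet> (f x + t *\<^sub>R f y) = m + 2 * t * q + t\<^sup>2 * (y \<bullet> f y)"
        using sym[of x y] by (simp add: inner_simps m_def q_def inner_commute[of y "f x"] power2_eq_square algebra_simps)
      finally show ?thesis by (simp add: k_def algebra_simps)
    qed
    have q2: "0 < q * q" using ne q_def by (auto simp: zero_less_mult_iff)
    \<comment> \<open>Near the optimal step q/k, with k + 1 in place of k since k may be 0.\<close>
    define t where "t = q / (k + 1)"
    define X where "X = q * q / (k + 1)"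
    have X: "0 < X" using q2 k by (simp add: X_def)
    have "2 * X \<le> X * (k / (k + 1))"
      using quad[of t] by (simp add: t_def X_def power2_eq_square mult_ac)
    also have "\<dots> \<le> X" using X k by (intro mult_left_le) auto
    finally show False using X by simp
  qed
  define w where "w = f x - m *\<^sub>R x"
  have "w \<in> V" using nx inv V(1) by (simp add: w_def subspace_diff subspace_scale)
  moreover have "x \<bullet> w = 0" using nx by (simp add: w_def m_def inner_simps norm_eq_1)
  ultimately have "f x \<bullet> w = 0" by (rule orth)
  then have "w \<bullet> w = 0" using \<open>x \<bullet> w = 0\<close> by (simp add: w_def inner_simps algebra_simps)
  then have "f x = m *\<^sub>R x" by (simp add: w_def)
  then show ?thesis using that nx by blast
qed

text \<open>Take an orthonormal set of eigenvectors of maximal cardinality. If it were too small,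
  its orthogonal complement would be nonzero and, by symmetry, invariant, so it would contain a
  further eigenvector.\<close>

lemma symmetric_operator_eigenbasis:
  fixes f :: "'a::euclidean_space \<Rightarrow> 'a"
  assumes f: "linear f" and sym: "\<And>x y. f x \<bullet> y = x \<bullet> f y"
  obtains B where "card B = DIM('a)" "finite B" "pairwise orthogonal B" "\<And>b. b \<in> B \<Longrightarrow> norm b = 1"
    "\<And>b. b \<in> B \<Longrightarrow> \<exists>m. f b = m *\<^sub>R b"
proof -
  define P where "P B \<longleftrightarrow> pairwise orthogonal B \<and> (\<forall>b\<in>B. norm b = 1 \<and> (\<exists>m. f b = m *\<^sub>R b))" for B
  have indep: "independent B" if "P B" for B
    using that by (intro pairwise_orthogonal_independent) (auto simp: P_def)
  have fin: "finite B" "card B \<le> DIM('a)" if "P B" for B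
    using independent_bound[OF indep[OF that]] by auto
  have "P {}" by (simp add: P_def pairwise_def)
  then obtain B where B: "P B" "\<And>B'. P B' \<Longrightarrow> card B' \<le> card B"
    using ex_has_greatest_nat[of P "{}" card "Suc (DIM('a))"] fin(2) by (auto simp: less_Suc_eq_le)
  have "card B = DIM('a)"
  proof (rule ccontr)
    assume "card B \<noteq> DIM('a)"
    then have less: "card B < DIM('a)" using fin(2)[OF B(1)] by simp
    define V where "V = {x. \<forall>b\<in>B. b \<bullet> x = 0}"
    have V: "subspace V" unfolding V_def by (auto simp: subspace_def inner_simps)
    have "dim (span B) = card B" using indep[OF B(1)] by (simp add: dim_eq_card_independent)
    then have "span B \<noteq> UNIV" using less by (metis dim_UNIV less_irrefl)
    then obtain a where a: "a \<noteq> 0" "\<And>x. x \<in> span B \<Longrightarrow> a \<bullet> x = 0"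
      using span_not_univ_subset_hyperplane[of B] by auto
    have "a \<in> V" unfolding V_def using a(2)[OF span_base] by (auto simp: inner_commute)
    then have "V \<noteq> {0}" using a(1) by auto
    moreover have "f x \<in> V" if x: "x \<in> V" for x
      unfolding V_def
    proof (intro CollectI ballI)
      fix b assume b: "b \<in> B"
      then obtain m where "f b = m *\<^sub>R b" using B(1) P_def by blast
      then show "b \<bullet> f x = 0" using sym[of b x] b x by (simp add: V_def)
    qed
    ultimately obtain x m where x: "x \<in> V" "norm x = 1" "f x = m *\<^sub>R x"
      using symmetric_operator_eigenvector[OF f sym V] by blast
    have "x \<notin> B" using x(1,2) by (auto simp: V_def)
    have "P (insert x B)"
      using B(1) x unfolding P_def by (auto simp: pairwise_insert orthogonal_def V_def inner_commute)
    from B(2)[OF this] show False using \<open>x \<notin> B\<close> fin(1)[OF B(1)] by simp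
  qed
  then show ?thesis using that[of B] B(1) fin(1)[OF B(1)] unfolding P_def by simp
qed

text \<open>Retains what Jensen's inequality requires: the determinant as a product of quadratic
  form values, and Parseval's identity for the basis.\<close>

lemma symmetric_matrix_diagonalisation:
  fixes A :: "real^'n^'n"
  assumes sym: "\<And>x y. (A *v x) \<bullet> y = x \<bullet> (A *v y)"
  obtains e :: "'n \<Rightarrow> real^'n" where
    "\<And>i. norm (e i) = 1" "det A = (\<Prod>i\<in>UNIV. e i \<bullet> (A *v e i))" "\<And>x. (\<Sum>i\<in>UNIV. (x \<bullet> e i)\<^sup>2) = (norm x)\<^sup>2"
proof -
  obtain B where B: "card B = DIM(real^'n)" "finite B" "pairwise orthogonal B" "\<And>b. b \<in> B \<Longrightarrow> norm b = 1"
    "\<And>b. b \<in> B \<Longrightarrow> \<exists>m. A *v b = m *\<^sub>R b"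
    using symmetric_operator_eigenbasis[OF matrix_vector_mul_linear sym] by blast
  obtain e where e: "bij_betw e (UNIV :: 'n set) B"
    using finite_same_card_bij[OF finite B(2)] B(1) by auto
  then have eB: "e i \<in> B" for i by (auto simp: bij_betw_def)
  define a where "a i = e i \<bullet> (A *v e i)" for i
  have ea: "A *v e i = a i *\<^sub>R e i" for i
  proof -
    obtain m where "A *v e i = m *\<^sub>R e i" using B(5)[OF eB] by blast
    then show ?thesis using B(4)[OF eB[of i]] by (simp add: a_def norm_eq_1)
  qed
  have ee: "e i \<bullet> e j = (if i = j then 1 else 0)" for i j
  proof (cases "i = j")
    case False
    then have "e i \<noteq> e j" using e by (auto simp: bij_betw_def inj_on_def)
    then show ?thesis using False B(3) eB by (simp add: pairwise_def orthogonal_def)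
  qed (use B(4) eB in \<open>simp add: norm_eq_1\<close>)
  define P where "P = (\<chi> i j. e j $ i)"
  have PP: "transpose P ** P = mat 1"
    by (simp add: P_def matrix_matrix_mult_def transpose_def mat_def vec_eq_iff ee[unfolded inner_vec_def inner_real_def])
  have detP: "det P * det P = 1" using arg_cong[OF PP, of det] by (simp add: det_mul)
  have "A ** P = P ** (\<chi> i j. if i = j then a i else 0)"
  proof -
    have "(A ** P) $ i $ j = (P ** (\<chi> i j. if i = j then a i else 0)) $ i $ j" for i j
      using arg_cong[OF ea[of j], of "\<lambda>v. v $ i"]
      by (simp add: P_def matrix_matrix_mult_def matrix_vector_mult_def if_distrib mult.commute cong: if_cong)
    then show ?thesis by (simp add: vec_eq_iff)
  qed
  from arg_cong[OF this, of det] have "det A * det P = det P * det (\<chi> i j. if i = j then a i else 0)"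
    by (simp add: det_mul)
  moreover have "det (\<chi> i j. if i = j then a i else 0) = (\<Prod>i\<in>UNIV. a i)"
    by (subst det_diagonal) auto
  moreover have "det P \<noteq> 0" using detP by auto
  ultimately have "det A = (\<Prod>i\<in>UNIV. a i)" by simp
  moreover have "(\<Sum>i\<in>UNIV. (x \<bullet> e i)\<^sup>2) = (norm x)\<^sup>2" for x
  proof -
    have "P ** transpose P = mat 1" using PP matrix_left_right_inverse by blast
    then have "x = (P ** transpose P) *v x" by simp
    then have x: "P *v (x v* P) = x" by (simp add: matrix_vector_mul_assoc[symmetric])
    have "x \<bullet> x = (x v* P) \<bullet> (x v* P)" by (simp add: dot_lmul_matrix x)
    moreover have "(x v* P) $ i = x \<bullet> e i" for i
      by (simp add: P_def vector_matrix_mult_def inner_vec_def mult.commute)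
    ultimately show ?thesis
      unfolding power2_norm_eq_inner by (simp add: inner_vec_def[of "x v* P"] power2_eq_square)
  qed
  ultimately show ?thesis using that[of e] B(4) eB by (simp add: a_def)
qed

text \<open>Jensen's inequality is applied to the diagonal entries in an eigenbasis.\<close>

lemma exp_sum_le_det:
  fixes u :: "'i \<Rightarrow> real^'n" and \<tau> :: "'i \<Rightarrow> real"
  assumes I: "finite I" and c: "\<And>i. i \<in> I \<Longrightarrow> 0 \<le> c i" and u: "\<And>i. i \<in> I \<Longrightarrow> norm (u i) = 1"
    and iso: "\<And>x. (\<Sum>i\<in>I. c i *\<^sub>R ((u i \<bullet> x) *\<^sub>R u i)) = x"
  shows "exp (\<Sum>i\<in>I. c i * \<tau> i) \<le> det (matrix (\<lambda>x. \<Sum>i\<in>I. (c i * exp (\<tau> i) * (u i \<bullet> x)) *\<^sub>R u i))"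
proof -
  define L where "L x = (\<Sum>i\<in>I. (c i * exp (\<tau> i) * (u i \<bullet> x)) *\<^sub>R u i)" for x
  have L: "linear L" unfolding L_def
    by (intro linearI) (simp_all add: inner_simps algebra_simps sum.distrib scaleR_sum_right)
  have Lxy: "L x \<bullet> y = (\<Sum>i\<in>I. c i * exp (\<tau> i) * (u i \<bullet> x) * (u i \<bullet> y))" for x y
    by (simp add: L_def inner_sum_left mult_ac)
  have mL: "matrix L *v x = L x" for x using L by (simp add: matrix_works linear_matrix_vector_mul_eq)
  obtain e :: "'n \<Rightarrow> real^'n" where e: "\<And>i. norm (e i) = 1" "det (matrix L) = (\<Prod>i\<in>UNIV. e i \<bullet> (matrix L *v e i))"
    "\<And>x. (\<Sum>i\<in>UNIV. (x \<bullet> e i)\<^sup>2) = (norm x)\<^sup>2"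
  proof (rule symmetric_matrix_diagonalisation[of "matrix L"])
    show "(matrix L *v x) \<bullet> y = x \<bullet> (matrix L *v y)" for x y
      unfolding mL by (simp add: Lxy inner_commute[of x] mult_ac)
  qed blast
  have iso': "(\<Sum>i\<in>I. c i * (u i \<bullet> x)\<^sup>2) = (norm x)\<^sup>2" for x
    using arg_cong[OF iso[of x], of "\<lambda>y. y \<bullet> x"]
    unfolding power2_norm_eq_inner by (simp add: inner_sum_left power2_eq_square mult_ac)
  have "I \<noteq> {}" using iso'[of "e undefined"] e(1) by auto
  \<comment> \<open>The array \<open>c i * (u i \<bullet> e j)\<^sup>2\<close> has sums
    \<open>c i\<close> over j, by Parseval, and sums 1 over i, by the decomposition of the identity.
    So for each j its entries are convex weights.\<close>
  have "exp (\<Sum>i\<in>I. c i * \<tau> i) = exp (\<Sum>i\<in>I. c i * \<tau> i * (\<Sum>j\<in>UNIV. (u i \<bullet> e j)\<^sup>2))"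
    using u by (simp add: e(3))
  also have "\<dots> = exp (\<Sum>j\<in>UNIV. \<Sum>i\<in>I. c i * (u i \<bullet> e j)\<^sup>2 * \<tau> i)"
    unfolding sum_distrib_left by (subst sum.swap) (simp add: mult_ac)
  also have "\<dots> = (\<Prod>j\<in>UNIV. exp (\<Sum>i\<in>I. c i * (u i \<bullet> e j)\<^sup>2 * \<tau> i))"
    by (simp add: exp_sum)
  also have "\<dots> \<le> (\<Prod>j\<in>UNIV. \<Sum>i\<in>I. c i * (u i \<bullet> e j)\<^sup>2 * exp (\<tau> i))"
  proof (intro prod_mono conjI)
    fix j
    show "exp (\<Sum>i\<in>I. c i * (u i \<bullet> e j)\<^sup>2 * \<tau> i) \<le> (\<Sum>i\<in>I. c i * (u i \<bullet> e j)\<^sup>2 * exp (\<tau> i))"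
      using convex_on_sum[OF I \<open>I \<noteq> {}\<close> exp_convex, of "\<lambda>i. c i * (u i \<bullet> e j)\<^sup>2" \<tau>] iso'[of "e j"] c e(1)
      by simp
  qed simp
  also have "\<dots> = det (matrix L)"
    unfolding e(2) mL by (intro prod.cong refl) (simp add: inner_commute[of _ "L _"] Lxy power2_eq_square mult_ac)
  finally show ?thesis unfolding L_def .
qed

section \<open>The one-dimensional Gaussian integral\<close>

text \<open>Unnormalised. The oriented integral makes it an odd function on the whole line, so a
  symmetric interval has mass twice its value.\<close>

definition gauss_int :: "real \<Rightarrow> real" where
  "gauss_int x = (LBINT y=ereal 0..ereal x. exp (- (y\<^sup>2 / 2)))"

lemma gauss_int_0 [simp]: "gauss_int 0 = 0"
  by (simp add: gauss_int_def interval_integral_endpoints_same)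

lemma gauss_int_deriv: "(gauss_int has_real_derivative exp (- (x\<^sup>2 / 2))) (at x)"
proof -
  define a where "a = \<bar>x\<bar> + 1"
  have "(gauss_int has_vector_derivative exp (- (x\<^sup>2 / 2))) (at x within {- a..a})"
    unfolding gauss_int_def
    by (rule interval_integral_FTC2) (auto simp: a_def intro!: continuous_intros)
  moreover have "at x within {- a..a} = at x"
    by (rule at_within_interior) (auto simp: a_def)
  ultimately show ?thesis by (simp add: has_real_derivative_iff_has_vector_derivative)
qed

lemma isCont_gauss_int: "isCont gauss_int x"
  using gauss_int_deriv by (rule DERIV_isCont)

lemma gauss_int_strict_mono: "x < y \<Longrightarrow> gauss_int x < gauss_int y"
  by (rule DERIV_pos_imp_increasing) (use gauss_int_deriv in \<open>auto intro!: exI\<close>)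

lemma gauss_int_less_iff [simp]: "gauss_int x < gauss_int y \<longleftrightarrow> x < y"
  by (metis gauss_int_strict_mono less_asym linorder_neqE_linordered_idom less_irrefl)

lemma gauss_int_le_iff [simp]: "gauss_int x \<le> gauss_int y \<longleftrightarrow> x \<le> y"
  by (meson gauss_int_less_iff not_le)

lemma gauss_int_pos: "0 < x \<Longrightarrow> 0 < gauss_int x"
  using gauss_int_strict_mono[of 0 x] by simp

lemma gauss_int_minus: "gauss_int (- x) = - gauss_int x"
proof -
  have "((\<lambda>x. gauss_int x + gauss_int (- x)) has_real_derivative 0) (at z)" for z
    by (rule derivative_eq_intros gauss_int_deriv DERIV_chain'[OF DERIV_minus[OF DERIV_ident] gauss_int_deriv] | simp)+
  from DERIV_isconst_all[OF allI[OF this], of x 0]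
  show ?thesis by simp
qed

lemma nn_integral_gauss_Icc:
  assumes "0 \<le> t"
  shows "(\<integral>\<^sup>+x. ennreal (exp (- (x\<^sup>2 / 2))) * indicator {- t..t} x \<partial>lborel) = ennreal (2 * gauss_int t)"
  using assms by (subst nn_integral_FTC_Icc[where F=gauss_int]) (auto simp: gauss_int_deriv gauss_int_minus)

text \<open>The limit of \<open>gauss_int\<close> at infinity, that is, the mass of a
  half-line.\<close>

definition gauss_half :: real where "gauss_half = sqrt (2 * pi) / 2"

lemma gauss_half_pos: "0 < gauss_half" by (simp add: gauss_half_def)

lemma nn_integral_gauss: "(\<integral>\<^sup>+x. ennreal (exp (- (x\<^sup>2 / 2))) \<partial>lborel) = ennreal (2 * gauss_half)"
proof -
  interpret prob_space "density lborel std_normal_density" by (rule prob_space_normal_density) simp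
  have "(\<integral>\<^sup>+x. ennreal (exp (- (x\<^sup>2 / 2))) \<partial>lborel) = (\<integral>\<^sup>+x. ennreal (sqrt (2 * pi)) * ennreal (std_normal_density x) \<partial>lborel)"
    by (intro nn_integral_cong) (simp add: std_normal_density_def flip: ennreal_mult)
  also have "\<dots> = ennreal (sqrt (2 * pi)) * emeasure (density lborel std_normal_density) UNIV"
    by (subst nn_integral_cmult) (auto simp: emeasure_density)
  also have "\<dots> = ennreal (sqrt (2 * pi))" using emeasure_space_1 by simp
  finally show ?thesis by (simp add: gauss_half_def)
qed

lemma gauss_int_tendsto: "(\<lambda>n. gauss_int (real n)) \<longlonglongrightarrow> gauss_half"
proof -
  define M where "M = density lborel (\<lambda>x. ennreal (exp (- (x\<^sup>2 / 2))))"
  have M: "emeasure M {- real n..real n} = ennreal (2 * gauss_int (real n))" for n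
    unfolding M_def by (subst emeasure_density) (auto simp: nn_integral_gauss_Icc)
  have "(\<lambda>n. emeasure M {- real n..real n}) \<longlonglongrightarrow> emeasure M (\<Union>n. {- real n..real n})"
    by (rule Lim_emeasure_incseq) (auto simp: M_def incseq_def)
  also have "(\<Union>n. {- real n..real n}) = UNIV"
  proof -
    have "x \<in> (\<Union>n. {- real n..real n})" for x
    proof -
      obtain n where "\<bar>x\<bar> \<le> real n" using real_arch_simple by blast
      then show ?thesis by (auto simp: abs_le_iff intro!: exI[of _ n])
    qed
    then show ?thesis by blast
  qed
  also have "emeasure M UNIV = ennreal (2 * gauss_half)"
    unfolding M_def by (subst emeasure_density) (auto simp: nn_integral_gauss)
  finally have "(\<lambda>n. 2 * gauss_int (real n)) \<longlonglongrightarrow> 2 * gauss_half"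
    using gauss_half_pos unfolding M
    by (subst (asm) tendsto_ennreal_iff) (auto intro!: always_eventually simp: less_imp_le gauss_int_le_iff[of 0, simplified])
  from tendsto_mult_left[OF this, of "1/2"] show ?thesis by simp
qed

lemma gauss_int_surj:
  assumes "\<bar>y\<bar> < gauss_half"
  obtains x where "gauss_int x = y"
proof -
  have "\<forall>\<^sub>F n in sequentially. \<bar>y\<bar> < gauss_int (real n)"
    by (rule order_tendstoD(1)[OF gauss_int_tendsto assms])
  then obtain n where n: "\<bar>y\<bar> < gauss_int (real n)" by (auto simp: eventually_sequentially)
  have "\<exists>x. - real n \<le> x \<and> x \<le> real n \<and> gauss_int x = y"
    using n by (intro IVT) (auto simp: gauss_int_minus isCont_gauss_int abs_less_iff)
  then show ?thesis using that by blast
qed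

text \<open>The monotone transport of the Gaussian measure conditioned on \<open>{-h<..<h}\<close> to the Gaussian measure.\<close>

lemma gauss_transport:
  assumes h: "0 < h"
  obtains T where
    "\<And>x. \<bar>x\<bar> < h \<Longrightarrow> (T has_real_derivative exp (- (x\<^sup>2 / 2) + (T x)\<^sup>2 / 2 - ln (gauss_int h / gauss_half))) (at x)"
    "\<And>x y. \<bar>x\<bar> < h \<Longrightarrow> \<bar>y\<bar> < h \<Longrightarrow> x < y \<Longrightarrow> T x < T y"
proof -
  \<comment> \<open>Rescales the values of \<open>gauss_int\<close> on (-h, h) to the full range of
    \<open>gauss_int\<close>.\<close>
  define k where "k = gauss_half / gauss_int h"
  have k: "0 < k" using gauss_half_pos gauss_int_pos[OF h] by (simp add: k_def)
  define g where "g = inv gauss_int"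
  have g: "gauss_int (g y) = y" if "\<bar>y\<bar> < gauss_half" for y
    unfolding g_def using gauss_int_surj[OF that] by (metis f_inv_into_f rangeI)
  have inj: "inj gauss_int" by (intro linorder_injI) (metis gauss_int_strict_mono less_irrefl)
  have g': "g (gauss_int z) = z" for z unfolding g_def using inj by (rule inv_f_f)
  have cont: "isCont g y" if "\<bar>y\<bar> < gauss_half" for y
  proof -
    have "isCont g (gauss_int (g y))"
      by (rule isCont_inverse_function2[of "g y - 1" _ "g y + 1"]) (auto simp: g' isCont_gauss_int)
    then show ?thesis using g[OF that] by simp
  qed
  have dg: "(g has_real_derivative exp ((g y)\<^sup>2 / 2)) (at y)" if "\<bar>y\<bar> < gauss_half" for y
  proof -
    have "(g has_real_derivative inverse (exp (- ((g y)\<^sup>2 / 2)))) (at y)"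
      by (rule DERIV_inverse_function[of gauss_int, where a="- gauss_half" and b=gauss_half])
        (use that g cont in \<open>auto simp: gauss_int_deriv abs_less_iff\<close>)
    then show ?thesis by (simp add: exp_minus)
  qed
  \<comment> \<open>Equality of masses: \<open>gauss_int (T x) = k * gauss_int x\<close>.
    Differentiating gives the derivative, and writing \<open>k\<close> as an exponential turns it
    into the single exponential expected by \<open>exp_sum_le_det\<close>.\<close>
  define T where "T x = g (k * gauss_int x)" for x
  have range: "\<bar>k * gauss_int x\<bar> < gauss_half" if "\<bar>x\<bar> < h" for x
  proof -
    have "\<bar>gauss_int x\<bar> < gauss_int h"
      using that gauss_int_less_iff[of x h] gauss_int_less_iff[of "- x" h] by (auto simp: gauss_int_minus abs_less_iff)
    then have "k * \<bar>gauss_int x\<bar> < k * gauss_int h" using k by (intro mult_strict_left_mono)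
    moreover have "k * gauss_int h = gauss_half" using gauss_int_pos[OF h] by (simp add: k_def)
    moreover have "\<bar>k * gauss_int x\<bar> = k * \<bar>gauss_int x\<bar>" using k by (simp add: abs_mult)
    ultimately show ?thesis by linarith
  qed
  show ?thesis
  proof (rule that[of T])
    fix x assume x: "\<bar>x\<bar> < h"
    have D: "(T has_real_derivative exp ((T x)\<^sup>2 / 2) * (k * exp (- (x\<^sup>2 / 2)))) (at x)"
      using DERIV_chain'[OF DERIV_cmult[OF gauss_int_deriv] dg[OF range[OF x]]] by (simp only: T_def[abs_def])
    have k: "k = exp (- ln (gauss_int h / gauss_half))"
      using gauss_half_pos gauss_int_pos[OF h] by (simp add: exp_minus k_def)
    have "exp ((T x)\<^sup>2 / 2) * (k * exp (- (x\<^sup>2 / 2))) = exp (- (x\<^sup>2 / 2) + (T x)\<^sup>2 / 2 - ln (gauss_int h / gauss_half))"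
      unfolding k mult_exp_exp by (rule arg_cong[where f=exp]) simp
    with D show "(T has_real_derivative exp (- (x\<^sup>2 / 2) + (T x)\<^sup>2 / 2 - ln (gauss_int h / gauss_half))) (at x)"
      by (simp only:)
  next
    fix x y assume xy: "\<bar>x\<bar> < h" "\<bar>y\<bar> < h" "x < y"
    have "k * gauss_int x < k * gauss_int y" using xy k by simp
    then have "gauss_int (T x) < gauss_int (T y)"
      unfolding T_def using g[OF range[OF xy(1)]] g[OF range[OF xy(2)]] by linarith
    then show "T x < T y" unfolding gauss_int_less_iff .
  qed
qed

text \<open>The logarithmic derivative has a decreasing numerator and an increasing denominator on
  the positive half-line.\<close>

lemma gauss_int_log_concave: "concave_on {0<..} (\<lambda>x. ln (gauss_int x))"
  unfolding concave_on_def
proof (rule convex_on_realI)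
  show "connected ({0<..} :: real set)" by simp
  fix x :: real assume x: "x \<in> {0<..}"
  then show "((\<lambda>x. - ln (gauss_int x)) has_real_derivative - (exp (- (x\<^sup>2 / 2)) / gauss_int x)) (at x)"
    using DERIV_minus[OF DERIV_chain'[OF gauss_int_deriv DERIV_ln_divide[OF gauss_int_pos]], of x] by simp
next
  fix x y :: real assume xy: "x \<in> {0<..}" "y \<in> {0<..}" "x \<le> y"
  have "x\<^sup>2 \<le> y\<^sup>2" using xy by (intro power_mono) auto
  then have "exp (- (y\<^sup>2 / 2)) / gauss_int y \<le> exp (- (x\<^sup>2 / 2)) / gauss_int x"
    using xy gauss_int_pos by (intro frac_le) auto
  then show "- (exp (- (x\<^sup>2 / 2)) / gauss_int x) \<le> - (exp (- (y\<^sup>2 / 2)) / gauss_int y)" by simp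
qed

section \<open>Gaussian mass of the space and of cubes\<close>

lemma exp_norm_eq_prod_Basis:
  fixes x :: "'a::euclidean_space"
  shows "exp (- ((norm x)\<^sup>2 / 2)) = (\<Prod>b\<in>Basis. exp (- ((x \<bullet> b)\<^sup>2 / 2)))"
  unfolding power2_norm_eq_inner euclidean_inner[of x x]
  by (simp add: exp_sum[symmetric] sum_negf sum_divide_distrib power2_eq_square)

lemma nn_integral_gaussian:
  "(\<integral>\<^sup>+x. ennreal (exp (- ((norm (x :: 'a::euclidean_space))\<^sup>2 / 2))) \<partial>lborel) = ennreal ((2 * gauss_half) ^ DIM('a))"
proof -
  have "(\<integral>\<^sup>+x. ennreal (exp (- ((norm (x :: 'a))\<^sup>2 / 2))) \<partial>lborel) =
      (\<integral>\<^sup>+x. (\<Prod>b\<in>Basis. ennreal (exp (- (((x::'a) \<bullet> b)\<^sup>2 / 2)))) \<partial>lborel)"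
    by (simp add: exp_norm_eq_prod_Basis prod_ennreal)
  also have "\<dots> = (\<Prod>b\<in>(Basis :: 'a set). \<integral>\<^sup>+x. ennreal (exp (- (x\<^sup>2 / 2))) \<partial>lborel)"
    by (rule nn_integral_lborel_prod) auto
  finally show ?thesis using gauss_half_pos by (simp add: nn_integral_gauss ennreal_power)
qed

lemma nn_integral_gaussian_cube:
  assumes "0 \<le> t"
  shows "(\<integral>\<^sup>+x\<in>{x. \<forall>i. \<bar>x $ i\<bar> \<le> t}. ennreal (exp (- ((norm (x :: real^'n))\<^sup>2 / 2))) \<partial>lborel)
    = ennreal ((2 * gauss_int t) ^ CARD('n))"
proof -
  have ind: "indicator {x. \<forall>i. \<bar>x $ i\<bar> \<le> t} x = (\<Prod>b\<in>Basis. indicator {- t..t} (x \<bullet> b) :: ennreal)" for x :: "real^'n"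
  proof (cases "\<forall>i. \<bar>x $ i\<bar> \<le> t")
    case True
    have "(\<Prod>b\<in>Basis. indicator {- t..t} (x \<bullet> b) :: ennreal) = 1"
    proof (intro prod.neutral ballI)
      fix b :: "real^'n" assume "b \<in> Basis"
      then obtain i where "b = axis i 1" by (auto simp: Basis_vec_def)
      moreover have "x $ i \<in> {- t..t}" using True[rule_format, of i] by auto
      ultimately show "indicator {- t..t} (x \<bullet> b) = (1 :: ennreal)" by (simp add: inner_axis)
    qed
    then show ?thesis using True by simp
  next
    case False
    then obtain i where "\<not> \<bar>x $ i\<bar> \<le> t" by blast
    then have "indicator {- t..t} (x \<bullet> axis i 1) = (0 :: ennreal)" by (auto simp: inner_axis abs_le_iff)
    then have "(\<Prod>b\<in>Basis. indicator {- t..t} (x \<bullet> b) :: ennreal) = 0"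
      by (intro prod_zero bexI[of _ "axis i 1"]) (auto simp: Basis_vec_def)
    then show ?thesis using False by simp
  qed
  have "(\<integral>\<^sup>+x\<in>{x. \<forall>i. \<bar>x $ i\<bar> \<le> t}. ennreal (exp (- ((norm (x :: real^'n))\<^sup>2 / 2))) \<partial>lborel) =
      (\<integral>\<^sup>+x. (\<Prod>b\<in>Basis. ennreal (exp (- (((x::real^'n) \<bullet> b)\<^sup>2 / 2))) * indicator {- t..t} (x \<bullet> b)) \<partial>lborel)"
    by (simp add: exp_norm_eq_prod_Basis prod_ennreal ind prod.distrib)
  also have "\<dots> = (\<Prod>b\<in>(Basis :: (real^'n) set). \<integral>\<^sup>+x. ennreal (exp (- (x\<^sup>2 / 2))) * indicator {- t..t} x \<partial>lborel)"
    by (rule nn_integral_lborel_prod) auto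
  finally show ?thesis using assms gauss_int_le_iff[of 0 t]
    by (simp add: nn_integral_gauss_Icc ennreal_power del: gauss_int_le_iff)
qed

section \<open>The Brascamp--Lieb inequality for slabs\<close>

locale isotropic_frame =
  fixes I :: "'i set" and c :: "'i \<Rightarrow> real" and u :: "'i \<Rightarrow> real^'n"
  assumes finite_I: "finite I" and c_nonneg: "\<And>i. i \<in> I \<Longrightarrow> 0 \<le> c i"
    and norm_u: "\<And>i. i \<in> I \<Longrightarrow> norm (u i) = 1"
    and decomp: "\<And>x. (\<Sum>i\<in>I. c i *\<^sub>R ((u i \<bullet> x) *\<^sub>R u i)) = x"
begin

lemma sum_inner: "(\<Sum>i\<in>I. c i * (u i \<bullet> x) * (u i \<bullet> y)) = x \<bullet> y"
  using arg_cong[OF decomp[of x], of "\<lambda>z. z \<bullet> y"] by (simp add: inner_sum_left mult.assoc)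

lemma sum_inner_square: "(\<Sum>i\<in>I. c i * (u i \<bullet> x)\<^sup>2) = (norm x)\<^sup>2"
  using sum_inner[of x x] unfolding power2_norm_eq_inner by (simp add: power2_eq_square mult.assoc)

text \<open>Pair the sum with itself, apply 2ab \<le> a^2 + b^2 to each term, and absorb one copy of
  its squared norm by the Parseval identity of the frame. It bounds the Gaussian exponent at a
  transported point.\<close>

lemma norm_sum_le: "(norm (\<Sum>i\<in>I. (c i * y i) *\<^sub>R u i))\<^sup>2 \<le> (\<Sum>i\<in>I. c i * (y i)\<^sup>2)"
proof -
  define w where "w = (\<Sum>i\<in>I. (c i * y i) *\<^sub>R u i)"
  have "2 * (norm w)\<^sup>2 = (\<Sum>i\<in>I. c i * (2 * y i * (u i \<bullet> w)))"
    unfolding power2_norm_eq_inner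
    by (subst (1) w_def) (simp add: inner_sum_left sum_distrib_left mult_ac)
  also have "\<dots> \<le> (\<Sum>i\<in>I. c i * ((y i)\<^sup>2 + (u i \<bullet> w)\<^sup>2))"
    by (intro sum_mono mult_left_mono sum_squares_bound c_nonneg)
  also have "\<dots> = (\<Sum>i\<in>I. c i * (y i)\<^sup>2) + (norm w)\<^sup>2"
    by (simp add: distrib_left sum.distrib sum_inner_square)
  finally show ?thesis by (simp add: w_def)
qed

text \<open>Barthe's transport argument: \<open>g\<close> below pushes the Gaussian measure on the slabs into \<open>\<real>\<^sup>n\<close>, and its
  Jacobian is bounded below by the determinant inequality.\<close>

lemma gaussian_slabs_le:
  assumes h: "\<And>i. i \<in> I \<Longrightarrow> 0 < h i"
  shows "(\<integral>\<^sup>+x\<in>{x. \<forall>i\<in>I. \<bar>u i \<bullet> x\<bar> < h i}. ennreal (exp (- ((norm x)\<^sup>2 / 2))) \<partial>lborel)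
    \<le> ennreal (exp (\<Sum>i\<in>I. c i * ln (gauss_int (h i) / gauss_half)) * (2 * gauss_half) ^ CARD('n))"
proof -
  define l where "l i = ln (gauss_int (h i) / gauss_half)" for i
  have "\<forall>i\<in>I. \<exists>T. (\<forall>x. \<bar>x\<bar> < h i \<longrightarrow> (T has_real_derivative exp (- (x\<^sup>2 / 2) + (T x)\<^sup>2 / 2 - l i)) (at x)) \<and>
      (\<forall>x y. \<bar>x\<bar> < h i \<longrightarrow> \<bar>y\<bar> < h i \<longrightarrow> x < y \<longrightarrow> T x < T y)"
    unfolding l_def by (meson gauss_transport h)
  then obtain T where T: "\<And>i x. i \<in> I \<Longrightarrow> \<bar>x\<bar> < h i \<Longrightarrow> (T i has_real_derivative exp (- (x\<^sup>2 / 2) + (T i x)\<^sup>2 / 2 - l i)) (at x)"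
    and T_mono: "\<And>i x y. i \<in> I \<Longrightarrow> \<bar>x\<bar> < h i \<Longrightarrow> \<bar>y\<bar> < h i \<Longrightarrow> x < y \<Longrightarrow> T i x < T i y"
    by metis
  define S where "S = {x. \<forall>i\<in>I. \<bar>u i \<bullet> x\<bar> < h i}"
  define g where "g x = (\<Sum>i\<in>I. (c i * T i (u i \<bullet> x)) *\<^sub>R u i)" for x
  \<comment> \<open>The logarithm of the derivative of \<open>T i\<close> at
    \<open>u i \<bullet> x\<close>, so that \<open>g'\<close> has the form of the operator in
    \<open>exp_sum_le_det\<close>.\<close>
  define \<tau> where "\<tau> x i = - ((u i \<bullet> x)\<^sup>2 / 2) + (T i (u i \<bullet> x))\<^sup>2 / 2 - l i" for x i
  define g' where "g' x = (\<lambda>y. \<Sum>i\<in>I. (c i * exp (\<tau> x i) * (u i \<bullet> y)) *\<^sub>R u i)" for x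
  \<comment> \<open>The product of the one-dimensional mass ratios to the powers \<open>c i\<close>;
    multiplying the target density by it produces the asserted bound.\<close>
  define C where "C = exp (\<Sum>i\<in>I. c i * l i)"
  define f where "f y = C * exp (- ((norm y)\<^sup>2 / 2))" for y :: "real^'n"
  have SI: "\<bar>u i \<bullet> x\<bar> < h i" if "x \<in> S" "i \<in> I" for x i using that by (simp add: S_def)
  have total: "(\<integral>\<^sup>+y. ennreal (f y) \<partial>lborel) = ennreal (C * (2 * gauss_half) ^ CARD('n))"
  proof -
    have "(\<integral>\<^sup>+y. ennreal (f y) \<partial>lborel) = ennreal C * (\<integral>\<^sup>+y. ennreal (exp (- ((norm (y::real^'n))\<^sup>2 / 2))) \<partial>lborel)"
      unfolding f_def by (subst nn_integral_cmult[symmetric]) (auto simp: C_def ennreal_mult)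
    then show ?thesis using gauss_half_pos by (simp add: nn_integral_gaussian C_def ennreal_mult)
  qed
  have "(\<integral>\<^sup>+x\<in>S. ennreal (exp (- ((norm x)\<^sup>2 / 2))) \<partial>lborel) \<le> (\<integral>\<^sup>+y. ennreal (f y) \<partial>lborel)"
  proof (rule nn_integral_le_change_of_variables[where g=g and g'=g'])
    have "S = (\<Inter>i\<in>I. {x. \<bar>u i \<bullet> x\<bar> < h i})" by (auto simp: S_def)
    also have "open \<dots>" by (intro open_INT finite_I ballI open_Collect_less continuous_intros)
    finally show "open S" .
    show "(g has_derivative g' x) (at x)" if x: "x \<in> S" for x
    proof -
      have "((\<lambda>x. T i (u i \<bullet> x)) has_derivative (\<lambda>y. exp (\<tau> x i) * (u i \<bullet> y))) (at x)" if i: "i \<in> I" for i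
      proof -
        have d: "((\<lambda>x. u i \<bullet> x) has_derivative (\<lambda>y. u i \<bullet> y)) (at x)"
          by (intro derivative_eq_intros) auto
        have "(T i has_derivative (\<lambda>z. exp (\<tau> x i) * z)) (at (u i \<bullet> x))"
          using T[OF i SI[OF x i]] by (simp only: has_field_derivative_def \<tau>_def)
        from has_derivative_compose[OF d this] show ?thesis .
      qed
      then show ?thesis
        unfolding g_def g'_def
        by (intro has_derivative_sum has_derivative_scaleR_left) (simp add: mult.assoc has_derivative_mult_right)
    qed
    \<comment> \<open>Pairing \<open>g x - g y\<close> with \<open>x - y\<close> gives a weighted
      sum of terms that are nonnegative as each \<open>T i\<close> is increasing. If it vanishes, x
      and y agree against every \<open>u i\<close> with positive weight, and those determine the
      norm of \<open>x - y\<close>.\<close>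
    show "inj_on g S"
    proof (rule inj_onI)
      fix x y assume xy: "x \<in> S" "y \<in> S" "g x = g y"
      have pos: "0 \<le> c i * ((T i (u i \<bullet> x) - T i (u i \<bullet> y)) * (u i \<bullet> x - u i \<bullet> y))"
        and zero: "(T i (u i \<bullet> x) - T i (u i \<bullet> y)) * (u i \<bullet> x - u i \<bullet> y) = 0 \<Longrightarrow> u i \<bullet> x = u i \<bullet> y" if i: "i \<in> I" for i
      proof -
        consider "u i \<bullet> x < u i \<bullet> y" | "u i \<bullet> x = u i \<bullet> y" | "u i \<bullet> x > u i \<bullet> y" by linarith
        then have "0 \<le> (T i (u i \<bullet> x) - T i (u i \<bullet> y)) * (u i \<bullet> x - u i \<bullet> y) \<and>
          ((T i (u i \<bullet> x) - T i (u i \<bullet> y)) * (u i \<bullet> x - u i \<bullet> y) = 0 \<longrightarrow> u i \<bullet> x = u i \<bullet> y)"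
        proof cases
          case 1
          with T_mono[OF i SI[OF xy(1) i] SI[OF xy(2) i]] show ?thesis by (simp add: mult_nonpos_nonpos)
        next
          case 3
          with T_mono[OF i SI[OF xy(2) i] SI[OF xy(1) i]] show ?thesis by simp
        qed simp
        then show "0 \<le> c i * ((T i (u i \<bullet> x) - T i (u i \<bullet> y)) * (u i \<bullet> x - u i \<bullet> y))"
          and "(T i (u i \<bullet> x) - T i (u i \<bullet> y)) * (u i \<bullet> x - u i \<bullet> y) = 0 \<Longrightarrow> u i \<bullet> x = u i \<bullet> y"
          using c_nonneg[OF i] by auto
      qed
      have "(\<Sum>i\<in>I. c i * ((T i (u i \<bullet> x) - T i (u i \<bullet> y)) * (u i \<bullet> x - u i \<bullet> y))) = (g x - g y) \<bullet> (x - y)"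
        unfolding g_def sum_subtractf[symmetric] inner_sum_left
        by (intro sum.cong refl) (simp add: inner_diff_left inner_diff_right algebra_simps)
      also have "\<dots> = 0" using xy(3) by simp
      finally have "\<forall>i\<in>I. c i * ((T i (u i \<bullet> x) - T i (u i \<bullet> y)) * (u i \<bullet> x - u i \<bullet> y)) = 0"
        using sum_nonneg_eq_0_iff[OF finite_I pos] by simp
      then have "\<forall>i\<in>I. c i * (u i \<bullet> (x - y))\<^sup>2 = 0"
        using zero by (auto simp: inner_diff_right)
      then have "(norm (x - y))\<^sup>2 = 0" unfolding sum_inner_square[symmetric] by (intro sum.neutral) blast
      then show "x = y" by simp
    qed
    show "integrable lborel f"
    proof (rule integrableI_nonneg)
      show "(\<integral>\<^sup>+x. ennreal (f x) \<partial>lborel) < \<infinity>" unfolding total by simp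
      show "f \<in> borel_measurable lborel" unfolding f_def[abs_def] by simp
    qed (simp add: f_def C_def)
    show "0 \<le> f y" for y by (simp add: f_def C_def)
    show "(\<lambda>x. exp (- ((norm x)\<^sup>2 / 2))) \<in> borel_measurable borel" by simp
    show "exp (- ((norm x)\<^sup>2 / 2)) \<le> \<bar>det (matrix (g' x))\<bar> * f (g x)" if x: "x \<in> S" for x
    proof -
      define Y where "Y = (\<Sum>i\<in>I. c i * (T i (u i \<bullet> x))\<^sup>2)"
      \<comment> \<open>The frame identity collects the squares into the exponent at
        \<open>x\<close>, and the \<open>l i\<close> cancel against \<open>C\<close>. The remaining
        \<open>Y\<close> dominates the squared norm of \<open>g x\<close>, so passing to the density
        at \<open>g x\<close> has the right direction.\<close>
      have sum\<tau>: "(\<Sum>i\<in>I. c i * \<tau> x i) = - ((norm x)\<^sup>2 / 2) + Y / 2 - (\<Sum>i\<in>I. c i * l i)"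
        unfolding \<tau>_def Y_def sum_inner_square[symmetric]
        by (simp add: algebra_simps sum.distrib sum_subtractf sum_divide_distrib sum_negf)
      have "exp (- ((norm x)\<^sup>2 / 2)) = exp (\<Sum>i\<in>I. c i * \<tau> x i) * (C * exp (- (Y / 2)))"
        unfolding C_def mult_exp_exp sum\<tau> by (rule arg_cong[where f=exp]) simp
      also have "\<dots> \<le> \<bar>det (matrix (g' x))\<bar> * (C * exp (- ((norm (g x))\<^sup>2 / 2)))"
      proof (intro mult_mono)
        show "exp (\<Sum>i\<in>I. c i * \<tau> x i) \<le> \<bar>det (matrix (g' x))\<bar>"
          using exp_sum_le_det[OF finite_I c_nonneg norm_u decomp, of "\<tau> x"] unfolding g'_def by linarith
        show "exp (- (Y / 2)) \<le> exp (- ((norm (g x))\<^sup>2 / 2))"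
          using norm_sum_le[of "\<lambda>i. T i (u i \<bullet> x)"] by (simp add: Y_def g_def)
      qed (auto simp: C_def)
      finally show ?thesis by (simp add: f_def)
    qed
  qed
  then show ?thesis unfolding total S_def C_def l_def .
qed

text \<open>The weights \<open>c i / n\<close> sum to 1 and average the half-widths to
  \<open>r\<close>, so log-concavity replaces all half-widths by \<open>r\<close>; the powers of
  \<open>gauss_half\<close> cancel. The result is the Gaussian mass of a cube of half-side
  \<open>r\<close>.\<close>

lemma gaussian_slabs_le_cube:
  assumes sum_c: "(\<Sum>i\<in>I. c i) = real CARD('n)" and h: "\<And>i. i \<in> I \<Longrightarrow> 0 < h i"
    and r: "(\<Sum>i\<in>I. c i * h i) = real CARD('n) * r"
  shows "(\<integral>\<^sup>+x\<in>{x. \<forall>i\<in>I. \<bar>u i \<bullet> x\<bar> < h i}. ennreal (exp (- ((norm x)\<^sup>2 / 2))) \<partial>lborel)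
    \<le> ennreal ((2 * gauss_int r) ^ CARD('n))"
proof -
  let ?n = "real CARD('n)"
  have "I \<noteq> {}" using sum_c by auto
  have rc: "(\<Sum>i\<in>I. (c i / ?n) *\<^sub>R h i) = r"
    using r by (simp add: sum_divide_distrib[symmetric])
  have w: "(\<Sum>i\<in>I. c i / ?n) = 1" using sum_c by (simp add: sum_divide_distrib[symmetric])
  have "\<exists>i\<in>I. 0 < c i"
    using sum_c sum_nonpos[of I c] by (force simp: not_less)
  then have "0 < (\<Sum>i\<in>I. c i * h i)"
    using c_nonneg h finite_I by (auto intro!: sum_pos2 simp: less_imp_le)
  then have rpos: "0 < r" using r by (simp add: zero_less_mult_iff)
  have jensen: "(\<Sum>i\<in>I. c i / ?n * ln (gauss_int (h i))) \<le> ln (gauss_int r)"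
    using concave_on_sum[OF finite_I \<open>I \<noteq> {}\<close> gauss_int_log_concave w, of h] c_nonneg h unfolding rc by simp
  have "(\<Sum>i\<in>I. c i * ln (gauss_int (h i) / gauss_half)) = (\<Sum>i\<in>I. c i * ln (gauss_int (h i))) - ?n * ln gauss_half"
    using h gauss_half_pos unfolding sum_c[symmetric] sum_distrib_right sum_subtractf[symmetric]
  proof (intro sum.cong refl)
    fix i assume "i \<in> I"
    then have "0 < gauss_int (h i)" using h gauss_int_pos by blast
    then show "c i * ln (gauss_int (h i) / gauss_half) = c i * ln (gauss_int (h i)) - c i * ln gauss_half"
      using gauss_half_pos by (simp add: ln_div right_diff_distrib)
  qed
  also have "(\<Sum>i\<in>I. c i * ln (gauss_int (h i))) \<le> ?n * ln (gauss_int r)"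
    using mult_left_mono[OF jensen, of ?n] by (simp add: sum_distrib_left)
  finally have "(\<Sum>i\<in>I. c i * ln (gauss_int (h i) / gauss_half)) \<le> ?n * ln (gauss_int r / gauss_half)"
    using gauss_half_pos gauss_int_pos[OF rpos] by (simp add: ln_div right_diff_distrib)
  then have "exp (\<Sum>i\<in>I. c i * ln (gauss_int (h i) / gauss_half)) \<le> exp (?n * ln (gauss_int r / gauss_half))" by simp
  also have "\<dots> = (gauss_int r / gauss_half) ^ CARD('n)"
    using gauss_half_pos gauss_int_pos[OF rpos] unfolding exp_of_nat_mult by simp
  finally have "exp (\<Sum>i\<in>I. c i * ln (gauss_int (h i) / gauss_half)) * (2 * gauss_half) ^ CARD('n)
      \<le> (gauss_int r / gauss_half) ^ CARD('n) * (2 * gauss_half) ^ CARD('n)"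
    using gauss_half_pos by (intro mult_right_mono) auto
  also have "\<dots> = (2 * gauss_int r) ^ CARD('n)"
    unfolding power_mult_distrib[symmetric] using gauss_half_pos by simp
  finally show ?thesis by (intro order_trans[OF gaussian_slabs_le[OF h]] ennreal_leI)
qed

end

section \<open>The Minkowski functional and radial integration\<close>

text \<open>The strict form needs no attained minimum: it is the characterisation of an infimum, and
  the ball in \<open>K\<close> makes the set of admissible scalars nonempty.\<close>

lemma minkowski_functional_less_iff:
  fixes K :: "'a::real_normed_vector set"
  assumes "convex K" "ball 0 e \<subseteq> K" "0 < e"
  shows "minkowski_functional K x < t \<longleftrightarrow> (\<exists>s. 0 \<le> s \<and> s < t \<and> x \<in> (*\<^sub>R) s ` K)"
proof -
  define A where "A = {t. 0 \<le> t \<and> x \<in> (*\<^sub>R) t ` K}"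
  have "A \<noteq> {}"
  proof (cases "x = 0")
    case True
    have "0 \<in> K" using assms by auto
    then have "0 \<in> A" using True unfolding A_def by (auto intro: image_eqI[of _ _ 0])
    then show ?thesis by blast
  next
    case False
    \<comment> \<open>Half the radius, to stay inside the open ball.\<close>
    define y where "y = (e / (2 * norm x)) *\<^sub>R x"
    have "y \<in> K" using False assms by (intro subsetD[OF assms(2)]) (simp add: y_def)
    moreover have "x = (2 * norm x / e) *\<^sub>R y" using False assms by (simp add: y_def)
    ultimately have "2 * norm x / e \<in> A" unfolding A_def using assms(3) by (auto intro: image_eqI)
    then show ?thesis by blast
  qed
  moreover have "bdd_below A" by (auto simp: A_def)
  moreover have "minkowski_functional K x = Inf A" by (simp add: minkowski_functional_def A_def)
  ultimately show ?thesis by (simp add: cInf_less_iff) (auto simp: A_def)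
qed

lemma real_eqI_less: "(\<And>t. a < t \<longleftrightarrow> b < t) \<Longrightarrow> a = (b :: real)"
  by (meson less_irrefl linorder_less_linear)

lemma minkowski_functional_nonneg:
  fixes K :: "'a::real_normed_vector set"
  assumes "convex K" "ball 0 e \<subseteq> K" "0 < e"
  shows "0 \<le> minkowski_functional K x"
  using minkowski_functional_less_iff[OF assms, of x 0] by linarith

lemma minkowski_functional_le:
  fixes K :: "'a::real_normed_vector set"
  assumes "convex K" "ball 0 e \<subseteq> K" "0 < e" "0 \<le> t" "x \<in> K"
  shows "minkowski_functional K (t *\<^sub>R x) \<le> t"
proof (rule dense_ge)
  fix s assume "t < s"
  then show "minkowski_functional K (t *\<^sub>R x) \<le> s"
    using minkowski_functional_less_iff[OF assms(1-3), of "t *\<^sub>R x" s] assms by (auto intro!: less_imp_le)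
qed

lemma minkowski_functional_scaleR:
  fixes K :: "'a::real_normed_vector set"
  assumes K: "convex K" "ball 0 e \<subseteq> K" "0 < e" and c: "0 < c"
  shows "minkowski_functional K (c *\<^sub>R x) = c * minkowski_functional K x"
proof (rule real_eqI_less)
  fix t
  have "c *\<^sub>R x \<in> (*\<^sub>R) s ` K \<longleftrightarrow> x \<in> (*\<^sub>R) (s / c) ` K" for s
  proof
    assume "c *\<^sub>R x \<in> (*\<^sub>R) s ` K"
    then obtain y where "y \<in> K" "c *\<^sub>R x = s *\<^sub>R y" by blast
    have "x = (1 / c) *\<^sub>R (c *\<^sub>R x)" using c by simp
    then have "x = (s / c) *\<^sub>R y" unfolding \<open>c *\<^sub>R x = s *\<^sub>R y\<close> by simp
    then show "x \<in> (*\<^sub>R) (s / c) ` K" using \<open>y \<in> K\<close> by blast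
  qed (use c in auto)
  then have "minkowski_functional K (c *\<^sub>R x) < t \<longleftrightarrow> (\<exists>s. 0 \<le> s \<and> s < t \<and> x \<in> (*\<^sub>R) (s / c) ` K)"
    by (simp add: minkowski_functional_less_iff[OF K])
  also have "\<dots> \<longleftrightarrow> (\<exists>s. 0 \<le> s \<and> s < t / c \<and> x \<in> (*\<^sub>R) s ` K)"
  proof
    assume "\<exists>s. 0 \<le> s \<and> s < t \<and> x \<in> (*\<^sub>R) (s / c) ` K"
    then obtain s where "0 \<le> s" "s < t" "x \<in> (*\<^sub>R) (s / c) ` K" by blast
    then show "\<exists>s. 0 \<le> s \<and> s < t / c \<and> x \<in> (*\<^sub>R) s ` K"
      using c by (intro exI[of _ "s / c"]) (simp add: divide_strict_right_mono)
  next
    assume "\<exists>s. 0 \<le> s \<and> s < t / c \<and> x \<in> (*\<^sub>R) s ` K"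
    then obtain s where "0 \<le> s" "s < t / c" "x \<in> (*\<^sub>R) s ` K" by blast
    then show "\<exists>s. 0 \<le> s \<and> s < t \<and> x \<in> (*\<^sub>R) (s / c) ` K"
      using c by (intro exI[of _ "c * s"]) (simp add: field_simps)
  qed
  also have "\<dots> \<longleftrightarrow> c * minkowski_functional K x < t"
    unfolding minkowski_functional_less_iff[OF K, symmetric] using c by (simp add: field_simps)
  finally show "minkowski_functional K (c *\<^sub>R x) < t \<longleftrightarrow> c * minkowski_functional K x < t" .
qed

lemma minkowski_functional_upper:
  fixes K :: "'a::real_normed_vector set"
  assumes K: "convex K" "ball 0 e \<subseteq> K" "0 < e"
  shows "minkowski_functional K x \<le> 2 / e * norm x"
proof (cases "x = 0")
  case True
  have "0 \<in> K" using K by auto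
  then show ?thesis using minkowski_functional_le[OF K, of 0 0] True by simp
next
  case False
  have "(e / (2 * norm x)) *\<^sub>R x \<in> K" using False K by (intro subsetD[OF K(2)]) simp
  from minkowski_functional_le[OF K _ this, of "2 / e * norm x"] show ?thesis using False K by simp
qed

lemma minkowski_functional_lower:
  fixes K :: "'a::real_normed_vector set"
  assumes K: "convex K" "ball 0 e \<subseteq> K" "0 < e" and R: "0 < R" "\<And>y. y \<in> K \<Longrightarrow> norm y \<le> R"
  shows "norm x / R \<le> minkowski_functional K x"
proof (rule dense_ge)
  fix t assume "minkowski_functional K x < t"
  then obtain s y where s: "0 \<le> s" "s < t" "y \<in> K" "x = s *\<^sub>R y"
    unfolding minkowski_functional_less_iff[OF K] by blast
  then have "norm x \<le> s * R" using R(2)[of y] by (simp add: mult_left_mono)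
  also have "\<dots> \<le> t * R" using s R by (simp add: mult_right_mono)
  finally show "norm x / R \<le> t" using R by (simp add: field_simps)
qed

text \<open>Dilates of \<open>K\<close> are nested, since \<open>K\<close> is convex and contains 0;
  hence a strict sublevel set is a countable union of compact rational dilates.\<close>

lemma borel_measurable_minkowski_functional:
  fixes K :: "'a::euclidean_space set"
  assumes K: "convex K" "ball 0 e \<subseteq> K" "0 < e" and c: "compact K"
  shows "minkowski_functional K \<in> borel_measurable borel"
proof (rule borel_measurableI_less)
  fix t
  have mono: "x \<in> (*\<^sub>R) q ` K" if sq: "0 \<le> s" "s < q" and x: "x \<in> (*\<^sub>R) s ` K" for s q x
  proof -
    obtain y where y: "y \<in> K" "x = s *\<^sub>R y" using x by blast
    have "0 \<in> K" using K by auto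
    then have "(1 - s / q) *\<^sub>R 0 + (s / q) *\<^sub>R y \<in> K"
      using y(1) sq K(1) by (intro convexD) (auto simp: field_simps)
    then have "(s / q) *\<^sub>R y \<in> K" by simp
    moreover have "x = q *\<^sub>R ((s / q) *\<^sub>R y)" using y sq by simp
    ultimately show ?thesis by (rule image_eqI[rotated])
  qed
  have "{x. minkowski_functional K x < t} = (\<Union>q\<in>\<rat> \<inter> {0..<t}. (*\<^sub>R) q ` K)"
  proof (intro equalityI subsetI)
    fix x assume "x \<in> {x. minkowski_functional K x < t}"
    then obtain s where s: "0 \<le> s" "s < t" "x \<in> (*\<^sub>R) s ` K"
      unfolding mem_Collect_eq minkowski_functional_less_iff[OF K] by blast
    obtain q where "q \<in> \<rat>" "s < q" "q < t" using Rats_dense_in_real[OF s(2)] by blast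
    then show "x \<in> (\<Union>q\<in>\<rat> \<inter> {0..<t}. (*\<^sub>R) q ` K)" using mono[OF s(1) _ s(3), of q] s(1) by auto
  next
    fix x assume "x \<in> (\<Union>q\<in>\<rat> \<inter> {0..<t}. (*\<^sub>R) q ` K)"
    then show "x \<in> {x. minkowski_functional K x < t}"
      unfolding mem_Collect_eq minkowski_functional_less_iff[OF K] by auto
  qed
  also have "\<dots> \<in> sets borel"
    using c by (intro sets.countable_UN'' countable_Int1 countable_rat) (auto intro!: borel_compact compact_scaling)
  finally show "{x \<in> space borel. minkowski_functional K x < t} \<in> sets borel" by simp
qed

section \<open>Layer-cake and radial formulas\<close>

text \<open>Layer-cake representation. Strict tails on the left and weak ones on the right are
  harmless, because an interval has the same length with or without its endpoint; this is the form
  that complements of strict sublevel sets provide.\<close>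

lemma nn_integral_le_of_tail_le:
  fixes N1 N2 :: "'a \<Rightarrow> real"
  assumes M: "sigma_finite_measure M"
    and [measurable]: "N1 \<in> borel_measurable M" "N2 \<in> borel_measurable M"
    and tail: "\<And>t. 0 < t \<Longrightarrow> emeasure M {x \<in> space M. t < N1 x} \<le> emeasure M {x \<in> space M. t \<le> N2 x}"
    and nn: "\<And>x. 0 \<le> N1 x" "\<And>x. 0 \<le> N2 x"
  shows "(\<integral>\<^sup>+x. ennreal (N1 x) \<partial>M) \<le> (\<integral>\<^sup>+x. ennreal (N2 x) \<partial>M)"
proof -
  interpret M: sigma_finite_measure M by fact
  interpret pair_sigma_finite M lborel ..
  have "(\<integral>\<^sup>+x. ennreal (N1 x) \<partial>M) = (\<integral>\<^sup>+x. (\<integral>\<^sup>+t. indicator {0<..} t * (if t < N1 x then 1 else 0) \<partial>lborel) \<partial>M)"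
  proof (intro nn_integral_cong)
    fix x
    have "ennreal (N1 x) = (\<integral>\<^sup>+t. indicator {0<..<N1 x} t \<partial>lborel)" using nn by simp
    also have "\<dots> = (\<integral>\<^sup>+t. indicator {0<..} t * (if t < N1 x then 1 else 0) \<partial>lborel)"
      by (intro nn_integral_cong) (auto simp: indicator_def)
    finally show "ennreal (N1 x) = \<dots>" .
  qed
  also have "\<dots> = (\<integral>\<^sup>+t. (\<integral>\<^sup>+x. indicator {0<..} t * (if t < N1 x then 1 else 0) \<partial>M) \<partial>lborel)"
    by (rule Fubini'[symmetric]) measurable
  also have "\<dots> \<le> (\<integral>\<^sup>+t. (\<integral>\<^sup>+x. indicator {0<..} t * (if t \<le> N2 x then 1 else 0) \<partial>M) \<partial>lborel)"
  proof (rule nn_integral_mono)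
    fix t :: real
    show "(\<integral>\<^sup>+x. indicator {0<..} t * (if t < N1 x then 1 else 0) \<partial>M)
        \<le> (\<integral>\<^sup>+x. indicator {0<..} t * (if t \<le> N2 x then 1 else 0) \<partial>M)"
    proof (cases "0 < t")
      case True
      have "(\<integral>\<^sup>+x. (if t < N1 x then 1 else 0) \<partial>M) = (\<integral>\<^sup>+x. indicator {x \<in> space M. t < N1 x} x \<partial>M)"
        by (intro nn_integral_cong) (auto simp: indicator_def)
      moreover have "(\<integral>\<^sup>+x. (if t \<le> N2 x then 1 else 0) \<partial>M) = (\<integral>\<^sup>+x. indicator {x \<in> space M. t \<le> N2 x} x \<partial>M)"
        by (intro nn_integral_cong) (auto simp: indicator_def)
      ultimately show ?thesis using True tail[OF True] by simp
    qed simp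
  qed
  also have "\<dots> = (\<integral>\<^sup>+x. (\<integral>\<^sup>+t. indicator {0<..} t * (if t \<le> N2 x then 1 else 0) \<partial>lborel) \<partial>M)"
    by (rule Fubini') measurable
  also have "\<dots> = (\<integral>\<^sup>+x. ennreal (N2 x) \<partial>M)"
  proof (intro nn_integral_cong)
    fix x
    have "ennreal (N2 x) = (\<integral>\<^sup>+t. indicator {0<..N2 x} t \<partial>lborel)" using nn by simp
    also have "\<dots> = (\<integral>\<^sup>+t. indicator {0<..} t * (if t \<le> N2 x then 1 else 0) \<partial>lborel)"
      by (intro nn_integral_cong) (auto simp: indicator_def)
    finally show "(\<integral>\<^sup>+t. indicator {0<..} t * (if t \<le> N2 x then 1 else 0) \<partial>lborel) = ennreal (N2 x)" by simp
  qed
  finally show ?thesis .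
qed

lemma nn_integral_cball_homogeneous:
  fixes H :: "'a::euclidean_space \<Rightarrow> real"
  assumes [measurable]: "H \<in> borel_measurable borel" and hom: "\<And>s x. 0 < s \<Longrightarrow> H (s *\<^sub>R x) = s ^ k * H x"
    and nn: "\<And>x. 0 \<le> H x" and s: "0 < s"
  shows "(\<integral>\<^sup>+x. ennreal (H x) * (if norm x \<le> s then 1 else 0) \<partial>lborel) =
    ennreal (s ^ (DIM('a) + k)) * (\<integral>\<^sup>+x\<in>cball 0 1. ennreal (H x) \<partial>lborel)"
proof -
  have [measurable]: "cball (0::'a) 1 \<in> sets borel" by simp
  have "(\<integral>\<^sup>+x. ennreal (H x) * (if norm x \<le> s then 1 else 0) \<partial>lborel) =
      (\<integral>\<^sup>+x. ennreal (s ^ DIM('a)) * (ennreal (H (s *\<^sub>R x)) * (if norm (s *\<^sub>R x) \<le> s then 1 else 0)) \<partial>lborel)"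
    using s by (subst lborel_affine[of s 0]) (simp_all add: nn_integral_density nn_integral_distr)
  also have "\<dots> = (\<integral>\<^sup>+x. ennreal (s ^ (DIM('a) + k)) * (ennreal (H x) * indicator (cball 0 1) x) \<partial>lborel)"
    using s nn by (intro nn_integral_cong) (auto simp: hom ennreal_mult[symmetric] power_add mult_ac indicator_def)
  also have "\<dots> = ennreal (s ^ (DIM('a) + k)) * (\<integral>\<^sup>+x\<in>cball 0 1. ennreal (H x) \<partial>lborel)"
    by (rule nn_integral_cmult) measurable
  finally show ?thesis .
qed

text \<open>A radial weight \<open>W\<close> is a superposition of indicators of balls, with density \<open>w\<close>.\<close>

lemma nn_integral_homogeneous_radial:
  fixes H :: "'a::euclidean_space \<Rightarrow> real" and w W :: "real \<Rightarrow> real"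
  assumes [measurable]: "H \<in> borel_measurable borel" and hom: "\<And>s x. 0 < s \<Longrightarrow> H (s *\<^sub>R x) = s ^ k * H x"
    and nn: "\<And>x. 0 \<le> H x"
    and [measurable]: "w \<in> borel_measurable borel" and w: "\<And>s. 0 \<le> s \<Longrightarrow> 0 \<le> w s"
    and W: "\<And>r. 0 \<le> r \<Longrightarrow> (\<integral>\<^sup>+s. ennreal (w s) * indicator {r..} s \<partial>lborel) = ennreal (W r)"
  shows "(\<integral>\<^sup>+x. ennreal (H x) * ennreal (W (norm x)) \<partial>lborel) =
    (\<integral>\<^sup>+s. ennreal (w s * s ^ (DIM('a) + k)) * indicator {0..} s \<partial>lborel) * (\<integral>\<^sup>+x\<in>cball 0 1. ennreal (H x) \<partial>lborel)"
proof -
  define J where "J = (\<integral>\<^sup>+x\<in>cball 0 1. ennreal (H x) \<partial>lborel)"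
  have "(\<integral>\<^sup>+x. ennreal (H x) * ennreal (W (norm x)) \<partial>lborel) =
      (\<integral>\<^sup>+x. (\<integral>\<^sup>+s. ennreal (w s) * indicator {0..} s * (ennreal (H x) * (if norm x \<le> s then 1 else 0)) \<partial>lborel) \<partial>lborel)"
  proof (intro nn_integral_cong)
    fix x :: 'a
    have "ennreal (H x) * ennreal (W (norm x)) = ennreal (H x) * (\<integral>\<^sup>+s. ennreal (w s) * indicator {norm x..} s \<partial>lborel)"
      by (simp add: W)
    also have "\<dots> = (\<integral>\<^sup>+s. ennreal (H x) * (ennreal (w s) * indicator {norm x..} s) \<partial>lborel)"
      by (rule nn_integral_cmult[symmetric]) measurable
    also have "\<dots> = (\<integral>\<^sup>+s. ennreal (w s) * indicator {0..} s * (ennreal (H x) * (if norm x \<le> s then 1 else 0)) \<partial>lborel)"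
      by (intro nn_integral_cong) (auto simp: indicator_def mult_ac dest: order_trans[OF norm_ge_zero])
    finally show "ennreal (H x) * ennreal (W (norm x)) = \<dots>" .
  qed
  also have "\<dots> = (\<integral>\<^sup>+s. (\<integral>\<^sup>+x. ennreal (w s) * indicator {0..} s * (ennreal (H x) * (if norm x \<le> s then 1 else 0)) \<partial>lborel) \<partial>lborel)"
    by (rule lborel_pair.Fubini'[symmetric]) measurable
  also have "\<dots> = (\<integral>\<^sup>+s. ennreal (w s * s ^ (DIM('a) + k)) * indicator {0..} s * J \<partial>lborel)"
  \<comment> \<open>The point s = 0 is discarded because homogeneity is available only for positive
    scalars.\<close>
  proof (intro nn_integral_cong_AE eventually_mono[OF AE_lborel_singleton[of 0]])
    fix s :: real assume "s \<noteq> 0"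
    have "(\<integral>\<^sup>+x. ennreal (w s) * indicator {0..} s * (ennreal (H x) * (if norm x \<le> s then 1 else 0)) \<partial>lborel) =
      ennreal (w s) * indicator {0..} s * (\<integral>\<^sup>+x. ennreal (H x) * (if norm x \<le> s then 1 else 0) \<partial>lborel)"
      by (rule nn_integral_cmult) measurable
    also have "\<dots> = ennreal (w s * s ^ (DIM('a) + k)) * indicator {0..} s * J"
    proof (cases "0 < s")
      case True
      then show ?thesis
        unfolding J_def by (subst nn_integral_cball_homogeneous[OF assms(1) hom nn]) (simp_all add: w ennreal_mult mult_ac)
    qed (use \<open>s \<noteq> 0\<close> in auto)
    finally show "(\<integral>\<^sup>+x. ennreal (w s) * indicator {0..} s * (ennreal (H x) * (if norm x \<le> s then 1 else 0)) \<partial>lborel) = \<dots>" .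
  qed
  also have "\<dots> = (\<integral>\<^sup>+s. ennreal (w s * s ^ (DIM('a) + k)) * indicator {0..} s \<partial>lborel) * J"
    by (rule nn_integral_multc) measurable
  finally show ?thesis unfolding J_def .
qed

section \<open>Gaussian and spherical means\<close>

text \<open>Supplies the density that writes the Gaussian weight as a superposition of balls in
  \<open>nn_integral_homogeneous_radial\<close>.\<close>

lemma nn_integral_gaussian_tail:
  assumes "0 \<le> r"
  shows "(\<integral>\<^sup>+s. ennreal (s * exp (- (s\<^sup>2 / 2))) * indicator {r..} s \<partial>lborel) = ennreal (exp (- (r\<^sup>2 / 2)))"
proof -
  have "filterlim (\<lambda>x::real. x\<^sup>2 / 2) at_top at_top"
  proof (rule filterlim_at_top_mono[OF filterlim_ident])
    show "\<forall>\<^sub>F x::real in at_top. x \<le> x\<^sup>2 / 2"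
      using eventually_ge_at_top[of 2] by eventually_elim (simp add: power2_eq_square)
  qed
  then have "((\<lambda>x::real. exp (- (x\<^sup>2 / 2))) \<longlongrightarrow> 0) at_top"
    by (intro filterlim_compose[OF exp_at_bot]) (simp add: filterlim_uminus_at_top)
  then have "((\<lambda>x::real. - exp (- (x\<^sup>2 / 2))) \<longlongrightarrow> 0) at_top"
    using tendsto_minus by fastforce
  moreover have "((\<lambda>x. - exp (- (x\<^sup>2 / 2))) has_real_derivative x * exp (- (x\<^sup>2 / 2))) (at x)" for x :: real
    by (rule derivative_eq_intros refl | simp)+
  ultimately show ?thesis
    using assms by (subst nn_integral_FTC_atLeast[where F="\<lambda>x. - exp (- (x\<^sup>2 / 2))" and T=0]) auto
qed

text \<open>The spherical measure is the radial projection of the uniform measure on the ball; the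
  origin and the boundary sphere are null sets.\<close>

lemma nn_integral_sphere_prob:
  fixes H :: "real^'n \<Rightarrow> real"
  assumes [measurable]: "H \<in> borel_measurable borel"
  shows "(\<integral>\<^sup>+\<xi>. ennreal (H \<xi>) \<partial>sphere_prob) =
    (\<integral>\<^sup>+x\<in>cball 0 1. ennreal (H (sgn x)) \<partial>lborel) / emeasure lborel (cball (0::real^'n) 1)"
proof -
  have [measurable]: "sgn \<in> borel_measurable (borel :: (real^'n) measure)"
    unfolding sgn_div_norm by measurable
  have [measurable]: "sphere (0::real^'n) 1 \<in> sets borel" "ball (0::real^'n) 1 \<in> sets borel" by auto
  have sph: "sphere (0::real^'n) 1 \<in> null_sets lborel"
    using negligible_sphere[of "0::real^'n" 1] by (simp add: negligible_iff_null_sets null_sets_completion_iff)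
  let ?U = "uniform_measure lborel (ball (0::real^'n) 1)"
  have [measurable_cong]: "sets ?U = sets borel" by simp
  have "(\<integral>\<^sup>+\<xi>. ennreal (H \<xi>) \<partial>sphere_prob) = (\<integral>\<^sup>+\<xi>. ennreal (H \<xi>) * indicator (sphere 0 1) \<xi> \<partial>distr ?U borel sgn)"
    unfolding sphere_prob_eq by (subst nn_integral_restrict_space) auto
  also have "\<dots> = (\<integral>\<^sup>+x. ennreal (H (sgn x)) * indicator (sphere 0 1) (sgn x) \<partial>?U)"
    by (rule nn_integral_distr) measurable
  also have "\<dots> = (\<integral>\<^sup>+x. ennreal (H (sgn x)) * indicator (sphere 0 1) (sgn x) * indicator (ball 0 1) x \<partial>lborel) / emeasure lborel (ball (0::real^'n) 1)"
    by (rule nn_integral_uniform_measure) measurable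
  also have "(\<integral>\<^sup>+x. ennreal (H (sgn x)) * indicator (sphere 0 1) (sgn x) * indicator (ball 0 1) x \<partial>lborel) = (\<integral>\<^sup>+x\<in>cball 0 1. ennreal (H (sgn x)) \<partial>lborel)"
  proof (rule nn_integral_cong_AE, use AE_not_in[OF sph] AE_lborel_singleton[of 0] in eventually_elim)
    fix x :: "real^'n" assume "x \<notin> sphere 0 1" "x \<noteq> 0"
    then show "ennreal (H (sgn x)) * indicator (sphere 0 1) (sgn x) * indicator (ball 0 1) x = ennreal (H (sgn x)) * indicator (cball 0 1) x"
      by (auto simp: indicator_def norm_sgn)
  qed
  also have "emeasure lborel (ball (0::real^'n) 1) = emeasure lborel (cball (0::real^'n) 1)"
    by (simp add: emeasure_ball emeasure_cball)
  finally show ?thesis .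
qed

text \<open>A substitute for polar coordinates. On the ball, \<open>H (sgn x)\<close> splits into
  \<open>H (sgn x) * (1 - norm x)\<close> plus \<open>H x\<close>. The first part has radial weight
  1 - r, a superposition of balls of radius at most 1, and integrates to 1/(n + 1) of the whole. The
  linear bound on \<open>H\<close> makes the integrals finite, so the resulting equation can be
  solved.\<close>

lemma nn_integral_cball_sgn:
  fixes H :: "real^'n \<Rightarrow> real"
  assumes [measurable]: "H \<in> borel_measurable borel" and hom: "\<And>s x. 0 < s \<Longrightarrow> H (s *\<^sub>R x) = s * H x"
    and nn: "\<And>x. 0 \<le> H x" and bd: "\<And>x. H x \<le> D * norm x"
  shows "(\<integral>\<^sup>+x\<in>cball 0 1. ennreal (H x) \<partial>lborel) =
    ennreal (real CARD('n) / (real CARD('n) + 1)) * (\<integral>\<^sup>+x\<in>cball 0 1. ennreal (H (sgn x)) \<partial>lborel)"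
proof -
  let ?n = "real CARD('n)"
  have [measurable]: "sgn \<in> borel_measurable (borel :: (real^'n) measure)"
    unfolding sgn_div_norm by measurable
  have [measurable]: "cball (0::real^'n) 1 \<in> sets borel" by simp
  define a where "a = (\<integral>\<^sup>+x\<in>cball 0 1. ennreal (H x) \<partial>lborel)"
  define b where "b = (\<integral>\<^sup>+x\<in>cball 0 1. ennreal (H (sgn x)) \<partial>lborel)"
  have H_sgn: "norm x * H (sgn x) = H x" if "x \<noteq> 0" for x
    using hom[of "norm x" "sgn x"] that by (simp add: sgn_div_norm)
  have D0: "0 \<le> D" using bd[of "axis undefined 1"] nn[of "axis undefined 1"] by simp
  have "b \<le> (\<integral>\<^sup>+x. ennreal D * indicator (cball (0::real^'n) 1) x \<partial>lborel)"
    unfolding b_def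
  proof (intro nn_integral_mono mult_right_mono ennreal_leI)
    fix x :: "real^'n"
    show "H (sgn x) \<le> D" using bd[of "sgn x"] D0 by (cases "x = 0") (auto simp: norm_sgn)
  qed simp
  also have "\<dots> < \<infinity>"
    using emeasure_lborel_cball_finite[of "0::real^'n" 1] by (simp add: nn_integral_cmult_indicator ennreal_mult_less_top)
  finally have b_fin: "b < \<infinity>" .
  have "(\<integral>\<^sup>+x. ennreal (H (sgn x)) * ennreal (max 0 (1 - norm x)) \<partial>lborel) =
    (\<integral>\<^sup>+s. ennreal ((if s \<le> 1 then 1 else 0) * s ^ (DIM(real^'n) + 0)) * indicator {0..} s \<partial>lborel) * b"
    unfolding b_def
  proof (rule nn_integral_homogeneous_radial)
    show "H (sgn (s *\<^sub>R x)) = s ^ 0 * H (sgn x)" if "0 < s" for s x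
      using that by (simp add: sgn_scaleR)
    show "(\<integral>\<^sup>+s. ennreal (if s \<le> 1 then 1 else 0) * indicator {r..} s \<partial>lborel) = ennreal (max 0 (1 - r))" for r :: real
    proof -
      have "(\<integral>\<^sup>+s. ennreal (if s \<le> 1 then 1 else 0) * indicator {r..} s \<partial>lborel) = (\<integral>\<^sup>+s. indicator {r..1} s \<partial>lborel)"
        by (intro nn_integral_cong) (auto simp: indicator_def)
      also have "\<dots> = ennreal (max 0 (1 - r))" by (cases "r \<le> 1") auto
      finally show ?thesis .
    qed
  qed (use nn in auto)
  also have "(\<integral>\<^sup>+s. ennreal ((if s \<le> 1 then 1 else 0) * s ^ (DIM(real^'n) + 0)) * indicator {0..} s \<partial>lborel) =
      (\<integral>\<^sup>+s. ennreal (s ^ CARD('n)) * indicator {0..1} s \<partial>lborel)"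
    by (intro nn_integral_cong) (auto simp: indicator_def)
  also have "\<dots> = ennreal (1 / (?n + 1))"
  proof -
    have "((\<lambda>x. x ^ Suc CARD('n) / (?n + 1)) has_real_derivative x ^ CARD('n)) (at x)" for x :: real
      by (rule DERIV_cong[OF DERIV_cdivide[OF DERIV_pow]]) (simp add: add.commute[of 1])
    then show ?thesis
      by (subst nn_integral_FTC_Icc[where F="\<lambda>x. x ^ Suc CARD('n) / (?n + 1)"]) auto
  qed
  finally have layer: "(\<integral>\<^sup>+x. ennreal (H (sgn x)) * ennreal (max 0 (1 - norm x)) \<partial>lborel) = ennreal (1 / (?n + 1)) * b" .
  have "b = (\<integral>\<^sup>+x. ennreal (H (sgn x)) * ennreal (max 0 (1 - norm x)) + ennreal (H x) * indicator (cball 0 1) x \<partial>lborel)"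
    unfolding b_def
  proof (rule nn_integral_cong_AE, rule eventually_mono[OF AE_lborel_singleton[of 0]])
    fix x :: "real^'n" assume x: "x \<noteq> 0"
    show "ennreal (H (sgn x)) * indicator (cball 0 1) x =
      ennreal (H (sgn x)) * ennreal (max 0 (1 - norm x)) + ennreal (H x) * indicator (cball 0 1) x"
    proof (cases "norm x \<le> 1")
      case True
      have "ennreal (H (sgn x)) * ennreal (1 - norm x) + ennreal (H x) = ennreal (H (sgn x) * (1 - norm x) + H x)"
        using nn True by (simp add: ennreal_mult)
      also have "H (sgn x) * (1 - norm x) + H x = H (sgn x)"
        using H_sgn[OF x] by (simp add: algebra_simps)
      finally show ?thesis using True by simp
    qed simp
  qed
  also have "\<dots> = ennreal (1 / (?n + 1)) * b + a"
    unfolding a_def layer[symmetric] by (rule nn_integral_add) measurable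
  finally have ba: "b = ennreal (1 / (?n + 1)) * b + a" .
  obtain b' where b': "b = ennreal b'" "0 \<le> b'" using b_fin by (cases b) auto
  have "a \<le> b" by (rule ord_le_eq_trans[OF add_increasing[OF zero_le order_refl] ba[symmetric]])
  then obtain a' where a': "a = ennreal a'" "0 \<le> a'" using b_fin by (cases a) (auto simp: top_unique)
  have "b' = 1 / (?n + 1) * b' + a'"
    using ba b'(2) a'(2) unfolding b'(1) a'(1)
    by (simp add: ennreal_mult[symmetric] ennreal_plus[symmetric] del: ennreal_plus)
  then have eq: "a' = ?n / (?n + 1) * b'" by (simp add: field_simps)
  show ?thesis
    unfolding a_def[symmetric] b_def[symmetric] a'(1) b'(1) eq using b'(2) by (intro ennreal_mult) simp_all
qed

text \<open>The quantifier order is the point: one \<open>C\<close> serves every \<open>H\<close>,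
  so it can be cancelled when two norms are compared.\<close>

lemma gaussian_mean_eq_sphere_mean:
  "\<exists>C>0. \<forall>(H :: real^'n \<Rightarrow> real) D. H \<in> borel_measurable borel \<longrightarrow> (\<forall>s x. 0 < s \<longrightarrow> H (s *\<^sub>R x) = s * H x) \<longrightarrow>
    (\<forall>x. 0 \<le> H x) \<longrightarrow> (\<forall>x. H x \<le> D * norm x) \<longrightarrow>
    (\<integral>\<^sup>+x. ennreal (H x) * ennreal (exp (- ((norm x)\<^sup>2 / 2))) \<partial>lborel) = ennreal C * (\<integral>\<^sup>+\<xi>. ennreal (H \<xi>) \<partial>sphere_prob)"
proof -
  let ?n = "real CARD('n)"
  \<comment> \<open>The exponent is n from scaling volume, 1 from the degree of \<open>H\<close> and
    1 from the radial density s exp(-s^2/2).\<close>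
  define k where "k = CARD('n) + 2"
  define c1 where "c1 = (\<integral>\<^sup>+s. ennreal (s ^ k * exp (- (s\<^sup>2 / 2))) * indicator {0..} s \<partial>lborel)"
  have "c1 < \<infinity>"
  proof -
    have "integrable lborel (\<lambda>s. sqrt (2 * pi) * (std_normal_density s * s ^ k))"
      by (intro integrable_mult_right integrable_std_normal_moment)
    then have "(\<integral>\<^sup>+s. ennreal (norm (sqrt (2 * pi) * (std_normal_density s * s ^ k))) \<partial>lborel) < \<infinity>"
      unfolding integrable_iff_bounded by blast
    moreover have "c1 \<le> (\<integral>\<^sup>+s. ennreal (norm (sqrt (2 * pi) * (std_normal_density s * s ^ k))) \<partial>lborel)"
      unfolding c1_def by (intro nn_integral_mono) (auto simp: std_normal_density_def indicator_def abs_mult mult.commute)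
    ultimately show ?thesis by (rule le_less_trans[rotated])
  qed
  then obtain c where c: "c1 = ennreal c" "0 \<le> c" by (cases c1) auto
  have "c1 \<noteq> 0"
  proof -
    \<comment> \<open>A crude lower bound: on [1, 2] the integrand is at least exp(-2).\<close>
    have "ennreal (exp (- 2)) = (\<integral>\<^sup>+s. ennreal (exp (- 2)) * indicator {1..2::real} s \<partial>lborel)"
      by (subst nn_integral_cmult_indicator) auto
    also have "\<dots> \<le> c1"
      unfolding c1_def
    proof (intro nn_integral_mono)
      fix s :: real
      show "ennreal (exp (- 2)) * indicator {1..2} s \<le> ennreal (s ^ k * exp (- (s\<^sup>2 / 2))) * indicator {0..} s"
      proof (cases "s \<in> {1..2}")
        case True
        then have "s\<^sup>2 \<le> 2\<^sup>2" by (intro power_mono) auto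
        then have "exp (- 2) \<le> exp (- (s\<^sup>2 / 2))" by simp
        moreover have "1 \<le> s ^ k" using True by simp
        ultimately have "1 * exp (- 2) \<le> s ^ k * exp (- (s\<^sup>2 / 2))" using True by (intro mult_mono) auto
        then show ?thesis using True by (simp add: ennreal_leI)
      qed simp
    qed
    finally show ?thesis by (metis ennreal_eq_0_iff exp_gt_zero le_zero_eq not_le)
  qed
  then have cpos: "0 < c" using c by (cases "c = 0") auto
  obtain V where V: "emeasure lborel (cball (0::real^'n) 1) = ennreal V" "0 < V"
    using unit_ball_vol_pos[of "real DIM(real^'n)"] by (auto simp: emeasure_cball)
  show ?thesis
  proof (intro exI[of _ "c * (?n / (?n + 1)) * V"] conjI allI impI)
    show "0 < c * (?n / (?n + 1)) * V" using cpos V by simp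
    have q: "0 \<le> ?n / (?n + 1)" by simp
    have split: "ennreal (c * q * V) = ennreal c * ennreal q * ennreal V" if "0 \<le> q" for q
      using that c(2) V(2) by (simp add: ennreal_mult)
    fix H :: "real^'n \<Rightarrow> real" and D
    assume "H \<in> borel_measurable borel" "\<forall>s x. 0 < s \<longrightarrow> H (s *\<^sub>R x) = s * H x"
      "\<forall>x. 0 \<le> H x" "\<forall>x. H x \<le> D * norm x"
    then have H: "H \<in> borel_measurable borel" "\<And>s x. 0 < s \<Longrightarrow> H (s *\<^sub>R x) = s * H x"
      "\<And>x. 0 \<le> H x" "\<And>x. H x \<le> D * norm x" by simp_all
    have "(\<integral>\<^sup>+x. ennreal (H x) * ennreal (exp (- ((norm x)\<^sup>2 / 2))) \<partial>lborel) =
        (\<integral>\<^sup>+s. ennreal (s * exp (- (s\<^sup>2 / 2)) * s ^ (DIM(real^'n) + 1)) * indicator {0..} s \<partial>lborel) *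
        (\<integral>\<^sup>+x\<in>cball 0 1. ennreal (H x) \<partial>lborel)"
      by (rule nn_integral_homogeneous_radial) (use H nn_integral_gaussian_tail in auto)
    also have "(\<integral>\<^sup>+s. ennreal (s * exp (- (s\<^sup>2 / 2)) * s ^ (DIM(real^'n) + 1)) * indicator {0..} s \<partial>lborel) = c1"
      unfolding c1_def k_def by (intro nn_integral_cong) (simp add: mult_ac)
    also have "(\<integral>\<^sup>+x\<in>cball 0 1. ennreal (H x) \<partial>lborel) =
        ennreal (?n / (?n + 1)) * (\<integral>\<^sup>+x\<in>cball 0 1. ennreal (H (sgn x)) \<partial>lborel)"
      by (rule nn_integral_cball_sgn[OF H])
    also have "(\<integral>\<^sup>+x\<in>cball 0 1. ennreal (H (sgn x)) \<partial>lborel) = ennreal V * (\<integral>\<^sup>+\<xi>. ennreal (H \<xi>) \<partial>sphere_prob)"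
      unfolding nn_integral_sphere_prob[OF H(1)] V(1) using V(2)
      by (simp add: ennreal_times_divide mult_divide_eq_ennreal mult.commute[of "ennreal V"])
    finally show "(\<integral>\<^sup>+x. ennreal (H x) * ennreal (exp (- ((norm x)\<^sup>2 / 2))) \<partial>lborel) =
        ennreal (c * (?n / (?n + 1)) * V) * (\<integral>\<^sup>+\<xi>. ennreal (H \<xi>) \<partial>sphere_prob)"
      using split[OF q] unfolding c(1) by (simp only: mult.assoc)
  qed
qed


text \<open>The inner ball bounds the functional on the sphere, so the Bochner integral is the true
  mean; an outer ball keeps it away from 0, as later division requires.\<close>

lemma mean_norm_nn_integral:
  fixes K :: "(real^'n) set"
  assumes K: "convex K" "ball 0 e \<subseteq> K" "0 < e" and c: "compact K"
  shows "ennreal (mean_norm K) = (\<integral>\<^sup>+\<xi>. ennreal (minkowski_functional K \<xi>) \<partial>sphere_prob)"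
    and "0 < mean_norm K"
proof -
  have sp: "sets (sphere_prob :: (real^'n) measure) = sets (restrict_space borel (sphere 0 1))"
    and "prob_space (sphere_prob :: (real^'n) measure)"
    using rotation_invariant_prob_sphere_prob unfolding rotation_invariant_prob_def by blast+
  interpret prob_space "sphere_prob :: (real^'n) measure" by fact
  have space: "space (sphere_prob :: (real^'n) measure) = sphere 0 1"
    using sets_eq_imp_space_eq[OF sp] by (simp add: space_restrict_space)
  have meas: "minkowski_functional K \<in> borel_measurable sphere_prob"
    unfolding measurable_cong_sets[OF sp refl]
    by (intro measurable_restrict_space1 borel_measurable_minkowski_functional[OF K c])
  note nonneg = minkowski_functional_nonneg[OF K]
  have int: "integrable sphere_prob (minkowski_functional K)"
  proof (rule integrable_const_bound[OF _ meas])
    show "AE x in sphere_prob. norm (minkowski_functional K x) \<le> 2 / e"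
    proof (rule AE_I2)
      fix x :: "real^'n" assume "x \<in> space sphere_prob"
      then show "norm (minkowski_functional K x) \<le> 2 / e"
        using minkowski_functional_upper[OF K, of x] nonneg[of x] by (simp add: space)
    qed
  qed
  show "ennreal (mean_norm K) = (\<integral>\<^sup>+\<xi>. ennreal (minkowski_functional K \<xi>) \<partial>sphere_prob)"
    unfolding mean_norm_def by (rule nn_integral_eq_integral[OF int, symmetric]) (simp add: nonneg)
  obtain R where R: "0 < R" "\<And>y. y \<in> K \<Longrightarrow> norm y \<le> R"
    using compact_imp_bounded[OF c] unfolding bounded_pos by blast
  have "1 / R \<le> mean_norm K"
    unfolding mean_norm_def
  proof (rule integral_ge_const[OF int], rule AE_I2)
    fix x :: "real^'n" assume "x \<in> space sphere_prob"
    then show "1 / R \<le> minkowski_functional K x"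
      using minkowski_functional_lower[OF K R, of x] by (simp add: space)
  qed
  then show "0 < mean_norm K" using R(1) by (meson less_le_trans zero_less_divide_1_iff)
qed

section \<open>Comparison of the mean norms and conclusion\<close>

text \<open>If a ball about z lies in \<open>K\<close>, then each y in the ball of that radius about
  0 is the midpoint of z + y and -(z - y), both in \<open>K\<close>.\<close>

lemma centrally_symmetric_convex_body_ball:
  fixes K :: "'a::euclidean_space set"
  assumes "convex_body K" "centrally_symmetric K"
  obtains e where "0 < e" "ball 0 e \<subseteq> K"
proof -
  obtain z where "z \<in> interior K" using assms(1) unfolding convex_body_def by blast
  then obtain e where e: "0 < e" "ball z e \<subseteq> K" unfolding mem_interior by blast
  have "ball 0 e \<subseteq> K"
  proof
    fix y :: 'a assume "y \<in> ball 0 e"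
    then have "z + y \<in> K" "z - y \<in> K" using e(2) by (auto simp: subset_iff dist_norm)
    then have "z + y \<in> K" "- (z - y) \<in> K" using assms(2) unfolding centrally_symmetric_def by blast+
    then have "(1/2) *\<^sub>R (z + y) + (1/2) *\<^sub>R (- (z - y)) \<in> K"
      using assms(1) unfolding convex_body_def by (intro convexD) auto
    also have "(1/2) *\<^sub>R (z + y) + (1/2) *\<^sub>R (- (z - y)) = y"
      unfolding scaleR_add_right[symmetric] by (simp add: scaleR_2[symmetric])
    finally show "y \<in> K" .
  qed
  then show ?thesis using that e(1) by blast
qed

lemma mem_B_infty_iff: "x \<in> B_infty \<longleftrightarrow> (\<forall>i. \<bar>x $ i\<bar> \<le> 1)"
  by (auto simp: B_infty_def abs_le_iff minus_le_iff)

lemma B_infty_props: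
  shows "convex (B_infty :: (real^'n) set)" "ball 0 1 \<subseteq> (B_infty :: (real^'n) set)" "compact (B_infty :: (real^'n) set)"
proof -
  have cbox: "(B_infty :: (real^'n) set) = cbox (- 1) 1"
    by (auto simp: B_infty_def mem_box_cart)
  show "convex (B_infty :: (real^'n) set)" "compact (B_infty :: (real^'n) set)"
    unfolding cbox by (simp_all add: convex_box)
  show "ball 0 1 \<subseteq> (B_infty :: (real^'n) set)"
  proof
    fix x :: "real^'n" assume "x \<in> ball 0 1"
    then have "\<bar>x $ i\<bar> \<le> 1" for i using component_le_norm_cart[of x i] by simp
    then show "x \<in> B_infty" unfolding mem_B_infty_iff by blast
  qed
qed

text \<open>By the Brascamp--Lieb inequality the Gaussian measure of \<open>t K\<close> is at most that of the cube
  \<open>t r B_infty\<close>; integrating the tails over \<open>t\<close> compares the mean norms.\<close>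

lemma mean_norm_B_infty_le:
  fixes K :: "(real^'n) set"
  assumes frame: "isotropic_frame I c u" and sum_c: "(\<Sum>i\<in>I. c i) = real CARD('n)"
    and r: "(\<Sum>i\<in>I. c i * h i) = real CARD('n) * r" and h: "\<And>i. i \<in> I \<Longrightarrow> 0 < h i"
    and slab: "\<And>i x. i \<in> I \<Longrightarrow> x \<in> K \<Longrightarrow> \<bar>u i \<bullet> x\<bar> \<le> h i" and rpos: "0 < r"
    and K: "convex K" "ball 0 e \<subseteq> K" "0 < e" and c: "compact K"
  shows "mean_norm (B_infty :: (real^'n) set) \<le> r * mean_norm K"
proof -
  interpret isotropic_frame I c u by fact
  let ?B = "B_infty :: (real^'n) set"
  note BK = B_infty_props(1,2)[where 'n='n] zero_less_one[where 'a=real]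
  define M where "M = density lborel (\<lambda>x::real^'n. ennreal (exp (- ((norm x)\<^sup>2 / 2))))"
  have sM: "sets M = sets borel" "space M = UNIV" by (simp_all add: M_def)
  have em: "emeasure M A = (\<integral>\<^sup>+x\<in>A. ennreal (exp (- ((norm x)\<^sup>2 / 2))) \<partial>lborel)" if "A \<in> sets borel" for A
    unfolding M_def using that by (subst emeasure_density) auto
  have "emeasure M (space M) \<noteq> \<infinity>"
    using em[of UNIV] nn_integral_gaussian[where 'a="real^'n"] by (simp add: sM)
  then interpret M: finite_measure M by (rule finite_measureI)
  have NB [measurable]: "minkowski_functional ?B \<in> borel_measurable borel"
    by (rule borel_measurable_minkowski_functional[OF BK B_infty_props(3)])
  have NK [measurable]: "minkowski_functional K \<in> borel_measurable borel"
    by (rule borel_measurable_minkowski_functional[OF K c])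
  have tail: "emeasure M {x \<in> space M. t < minkowski_functional ?B x} \<le> emeasure M {x \<in> space M. t \<le> r * minkowski_functional K x}"
    if t: "0 < t" for t
  proof -
    define Q where "Q = {x::real^'n. \<forall>i. \<bar>x $ i\<bar> \<le> t}"
    have Qm: "Q \<in> sets borel"
    proof -
      have "closed Q" unfolding Q_def by (intro closed_Collect_all closed_Collect_le continuous_intros)
      then show ?thesis by simp
    qed
    \<comment> \<open>The strict sublevel set: its points lie in dilates by factors strictly below
      t/r, hence in the open slabs of the slab inequality.\<close>
    define L where "L = {x. minkowski_functional K x < t / r}"
    have Lm: "L \<in> sets borel" unfolding L_def by measurable
    have "emeasure M L \<le> (\<integral>\<^sup>+x\<in>{x. \<forall>i\<in>I. \<bar>u i \<bullet> x\<bar> < t / r * h i}. ennreal (exp (- ((norm x)\<^sup>2 / 2))) \<partial>lborel)"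
      unfolding em[OF Lm]
    proof (intro nn_integral_mono mult_left_mono indicator_leI impI)
      fix x assume "x \<in> L"
      then obtain s y where s: "0 \<le> s" "s < t / r" "y \<in> K" "x = s *\<^sub>R y"
        unfolding L_def mem_Collect_eq minkowski_functional_less_iff[OF K] by blast
      have "\<bar>u i \<bullet> x\<bar> < t / r * h i" if i: "i \<in> I" for i
      proof -
        have "\<bar>u i \<bullet> x\<bar> \<le> s * h i" using slab[OF i s(3)] s(1) by (simp add: s(4) abs_mult mult_left_mono)
        also have "\<dots> < t / r * h i" using s(2) h[OF i] by (rule mult_strict_right_mono)
        finally show ?thesis .
      qed
      then show "x \<in> {x. \<forall>i\<in>I. \<bar>u i \<bullet> x\<bar> < t / r * h i}" by blast
    qed simp
    also have "\<dots> \<le> ennreal ((2 * gauss_int t) ^ CARD('n))"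
    proof (rule gaussian_slabs_le_cube[OF sum_c])
      \<comment> \<open>After scaling by t/r the half-widths have weighted mean t, so the comparison
        cube has half-side t.\<close>
      have "(\<Sum>i\<in>I. c i * (t / r * h i)) = t / r * (\<Sum>i\<in>I. c i * h i)" by (simp add: sum_distrib_left mult_ac)
      then show "(\<Sum>i\<in>I. c i * (t / r * h i)) = real CARD('n) * t" using r rpos by simp
    qed (use t rpos h in simp)
    also have "\<dots> = emeasure M Q"
      unfolding em[OF Qm] unfolding Q_def using t by (intro nn_integral_gaussian_cube[symmetric]) simp
    finally have LQ: "emeasure M L \<le> emeasure M Q" .
    have "emeasure M {x \<in> space M. t < minkowski_functional ?B x} \<le> emeasure M (space M - Q)"
    proof (rule emeasure_mono)
      show "{x \<in> space M. t < minkowski_functional ?B x} \<subseteq> space M - Q"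
      proof
        fix x assume "x \<in> {x \<in> space M. t < minkowski_functional ?B x}"
        then have x: "t < minkowski_functional ?B x" by simp
        have "x \<notin> Q"
        proof
          assume "x \<in> Q"
          then have "\<bar>x $ i\<bar> \<le> t" for i by (simp add: Q_def)
          then have "\<bar>((1 / t) *\<^sub>R x) $ i\<bar> \<le> 1" for i using t by (simp add: abs_mult)
          then have "(1 / t) *\<^sub>R x \<in> ?B" unfolding mem_B_infty_iff by blast
          from minkowski_functional_le[OF BK less_imp_le[OF t] this] show False using x t by simp
        qed
        then show "x \<in> space M - Q" by (simp add: sM)
      qed
    qed (use Qm sM in auto)
    also have "\<dots> = emeasure M (space M) - emeasure M Q"
      using Qm by (intro emeasure_compl) (auto simp: sM)
    also have "\<dots> \<le> emeasure M (space M) - emeasure M L" using LQ by (rule ennreal_mono_minus)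
    also have "\<dots> = emeasure M (space M - L)"
      using Lm by (intro emeasure_compl[symmetric]) (auto simp: sM)
    also have "space M - L = {x \<in> space M. t \<le> r * minkowski_functional K x}"
      unfolding L_def sM by (simp add: set_eq_iff not_less pos_divide_le_eq[OF rpos] mult.commute[of r])
    finally show ?thesis .
  qed
  have le: "(\<integral>\<^sup>+x. ennreal (minkowski_functional ?B x) \<partial>M) \<le> (\<integral>\<^sup>+x. ennreal (r * minkowski_functional K x) \<partial>M)"
  proof (rule nn_integral_le_of_tail_le[OF M.sigma_finite_measure_axioms _ _ tail])
    show "0 \<le> minkowski_functional ?B x" for x by (rule minkowski_functional_nonneg[OF BK])
    show "0 \<le> r * minkowski_functional K x" for x using minkowski_functional_nonneg[OF K] rpos by simp
    show "minkowski_functional ?B \<in> borel_measurable M" using NB by (simp add: measurable_cong_sets[OF sM(1) refl])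
    show "(\<lambda>x. r * minkowski_functional K x) \<in> borel_measurable M"
      unfolding measurable_cong_sets[OF sM(1) refl] by measurable
  qed
  have dens: "(\<integral>\<^sup>+x. ennreal (H x) \<partial>M) = (\<integral>\<^sup>+x. ennreal (H x) * ennreal (exp (- ((norm x)\<^sup>2 / 2))) \<partial>lborel)"
    if [measurable]: "H \<in> borel_measurable borel" for H :: "real^'n \<Rightarrow> real"
    unfolding M_def by (subst nn_integral_density) (auto simp: mult.commute)
  obtain C where C: "0 < C" and mean: "\<forall>(H :: real^'n \<Rightarrow> real) D. H \<in> borel_measurable borel \<longrightarrow>
    (\<forall>s x. 0 < s \<longrightarrow> H (s *\<^sub>R x) = s * H x) \<longrightarrow> (\<forall>x. 0 \<le> H x) \<longrightarrow> (\<forall>x. H x \<le> D * norm x) \<longrightarrow>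
    (\<integral>\<^sup>+x. ennreal (H x) * ennreal (exp (- ((norm x)\<^sup>2 / 2))) \<partial>lborel) = ennreal C * (\<integral>\<^sup>+\<xi>. ennreal (H \<xi>) \<partial>sphere_prob)"
    using gaussian_mean_eq_sphere_mean by (elim exE conjE)
  have mB: "(\<integral>\<^sup>+x. ennreal (minkowski_functional ?B x) \<partial>M) = ennreal (C * mean_norm ?B)"
  proof -
    have "(\<integral>\<^sup>+x. ennreal (minkowski_functional ?B x) \<partial>M) = ennreal C * (\<integral>\<^sup>+\<xi>. ennreal (minkowski_functional ?B \<xi>) \<partial>sphere_prob)"
      unfolding dens[OF NB]
      by (rule mean[rule_format, OF NB])
        (rule minkowski_functional_scaleR[OF BK] minkowski_functional_nonneg[OF BK] minkowski_functional_upper[OF BK]; assumption?)+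
    also have "\<dots> = ennreal (C * mean_norm ?B)"
      unfolding mean_norm_nn_integral(1)[OF BK B_infty_props(3), symmetric]
      using C mean_norm_nn_integral(2)[OF BK B_infty_props(3)] by (intro ennreal_mult[symmetric]) auto
    finally show ?thesis .
  qed
  have mK: "(\<integral>\<^sup>+x. ennreal (r * minkowski_functional K x) \<partial>M) = ennreal (r * (C * mean_norm K))"
  proof -
    have "(\<integral>\<^sup>+x. ennreal (r * minkowski_functional K x) \<partial>M) = (\<integral>\<^sup>+x. ennreal r * ennreal (minkowski_functional K x) \<partial>M)"
      using rpos minkowski_functional_nonneg[OF K] by (intro nn_integral_cong) (simp add: ennreal_mult)
    also have "\<dots> = ennreal r * (\<integral>\<^sup>+x. ennreal (minkowski_functional K x) \<partial>M)"
      using NK by (intro nn_integral_cmult) (simp add: measurable_cong_sets[OF sM(1) refl])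
    also have "(\<integral>\<^sup>+x. ennreal (minkowski_functional K x) \<partial>M) = ennreal C * (\<integral>\<^sup>+\<xi>. ennreal (minkowski_functional K \<xi>) \<partial>sphere_prob)"
      unfolding dens[OF NK]
      by (rule mean[rule_format, OF NK])
        (rule minkowski_functional_scaleR[OF K] minkowski_functional_nonneg[OF K] minkowski_functional_upper[OF K]; assumption?)+
    also have "ennreal r * \<dots> = ennreal (r * (C * mean_norm K))"
      unfolding mean_norm_nn_integral(1)[OF K c, symmetric]
      using C rpos mean_norm_nn_integral(2)[OF K c] by (simp add: ennreal_mult less_imp_le)
    finally show ?thesis .
  qed
  have "C * mean_norm ?B \<le> r * (C * mean_norm K)"
    using le mB mK C rpos mean_norm_nn_integral(2)[OF K c] by simp
  then show ?thesis using C by (simp add: mult.left_commute)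
qed

theorem theorem6p5:
  fixes K :: "(real^'n::finite) set"
  assumes "convex_body K"
    and "centrally_symmetric K"
    and "minimal_surface_area_position K"
  shows "surface_area K
    \<le> real CARD('n) / mean_norm (B_infty :: (real^'n) set) * measure lborel K * mean_norm K"
proof -
  let ?n = "real CARD('n)" and ?MB = "mean_norm (B_infty :: (real^'n) set)"
  obtain e where e: "0 < e" "ball 0 e \<subseteq> K"
    using centrally_symmetric_convex_body_ball[OF assms(1,2)] by blast
  have K: "compact K" "convex K" "K \<noteq> {}" using assms(1) e by (auto simp: convex_body_def)
  have MB: "0 < ?MB" by (rule mean_norm_nn_integral(2)[OF B_infty_props(1,2) zero_less_one B_infty_props(3)])
  have MK: "0 < mean_norm K" by (rule mean_norm_nn_integral(2)[OF K(2) e(2,1) K(1)])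
  show ?thesis
  \<comment> \<open>The decomposition divides by the surface area; if that is zero, the bound holds
    because its right-hand side is nonnegative.\<close>
  proof (cases "surface_area K = 0")
    case True
    then show ?thesis using MB MK by simp
  next
    case False
    then have S: "0 < surface_area K" using surface_area_tendsto(2)[OF K] by simp
    obtain I :: "((real^'n^'n) \<times> real) set" and c u h where d:
      "finite I" "\<And>i. i \<in> I \<Longrightarrow> 0 \<le> c i" "\<And>i. i \<in> I \<Longrightarrow> norm (u i) = 1"
      "\<And>i x. i \<in> I \<Longrightarrow> x \<in> K \<Longrightarrow> u i \<bullet> x \<le> h i"
      "(\<Sum>i\<in>I. c i) = ?n"
      "\<And>x. (\<Sum>i\<in>I. c i *\<^sub>R ((u i \<bullet> x) *\<^sub>R u i)) = x"
      "(\<Sum>i\<in>I. c i * h i) * surface_area K = ?n\<^sup>2 * measure lborel K"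
      using minimal_surface_area_position_decomposition[OF K assms(3) S] by blast
    define r where "r = (\<Sum>i\<in>I. c i * h i) / ?n"
    \<comment> \<open>Test the support inequality at half the radius of the open ball in direction
      \<open>u i\<close>.\<close>
    have h: "e / 2 \<le> h i" if i: "i \<in> I" for i
    proof -
      have "(e / 2) *\<^sub>R u i \<in> K" using e d(3)[OF i] by (intro subsetD[OF e(2)]) simp
      from d(4)[OF i this] show ?thesis using d(3)[OF i] by (simp add: norm_eq_1)
    qed
    have "?n * (e / 2) \<le> (\<Sum>i\<in>I. c i * h i)"
      unfolding d(5)[symmetric] sum_distrib_right using d(2) h by (intro sum_mono mult_left_mono)
    moreover have "0 < ?n * (e / 2)" using e by simp
    ultimately have r: "0 < r" by (simp add: r_def)
    have "?MB \<le> r * mean_norm K"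
    proof (rule mean_norm_B_infty_le[of I c u h r K e])
      show "isotropic_frame I c u" using d(1,2,3,6) by unfold_locales
      \<comment> \<open>Central symmetry turns the half-space into a slab.\<close>
      show "\<bar>u i \<bullet> x\<bar> \<le> h i" if "i \<in> I" "x \<in> K" for i x
        using d(4)[OF that] d(4)[OF that(1), of "- x"] assms(2) that(2)
        by (auto simp: centrally_symmetric_def abs_le_iff)
      show "0 < h i" if "i \<in> I" for i using h[OF that] e by linarith
    qed (use d(5) r K e in \<open>auto simp: r_def\<close>)
    then have "?MB * surface_area K \<le> r * mean_norm K * surface_area K"
      using S by (intro mult_right_mono) auto
    also have "\<dots> = ?n * measure lborel K * mean_norm K"
    proof -
      have "r * surface_area K = ?n * measure lborel K"
        using d(7) by (simp add: r_def power2_eq_square field_simps)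
      then show ?thesis by (simp add: mult_ac)
    qed
    finally show ?thesis using MB by (simp add: field_simps)
  qed
qed

end
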